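(* Let $\mu\in\mathcal{M}^\infty(G)$ be a translation bounded measure on $G$ and let $\mathcal{A}=(A_n)$ be a van Hove sequence in $G$. Then $\mu$ is Besicovitch almost periodic along $\mathcal{A}$ if and only if there exists an ergodic measure $m$ on the hull $\mathbb{X}(\mu)$ with pure point spectrum such that $\mu$ is a Wiener–Wintner point for $(m,\mathcal{A})$, i.e. a Wiener–Wintner point of $(\mathbb{X}(\mu),G,m)$ with respect to $\mathcal{A}$.
   Context: $G$ is a $\sigma$-compact locally compact abelian group, written additively, with a fixed Haar measure; $|A|$ is the Haar measure of $A\subseteq G$ and $dt$ denotes integration against it. $\widehat{G}$ is the dual group (continuous homomorphisms $G\to\{w\in\mathbb{C}:|w|=1\}$). A van Hove sequence is a sequence $(A_n)$ of open relatively compact subsets of $G$ with $|A_n|>0$ such that $\lim_n|\partial^KA_n|/|A_n|=0$ for every compact $K\subseteq G$, where $\partial^KA=\big(\overline{(A+K)\setminus A}\big)\cup\big((\overline{G\setminus A}-K)\cap\overline{A}\big)$; in particular it is a Følner sequence, i.e. $\lim_n|A_n\triangle(t+A_n)|/|A_n|=0$ for all $t\in G$. Radon measures on $G$ are identified with the linear functionals on $C_c(G)$ that are continuous in the inductive topology. For $\varphi\in C_c(G)$, $(\mu*\varphi)(t)=\int_G\varphi(t-s)\,d\mu(s)$. $\mu$ is translation bounded if $\mu*\varphi$ is bounded for all $\varphi\in C_c(G)$; equivalently $\|\mu\|_U=\sup_{t\in G}|\mu|(t+U)<\infty$ for one (equivalently every) precompact $U\subseteq G$ with nonempty interior, $|\mu|$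 being the total variation measure. $\mathcal{M}^\infty(G)$ is the set of translation bounded measures. $G$ acts on it via translates: $t.\mu=\alpha(t,\mu)$ is the translate of $\mu$ by $t$, i.e. $(t.\mu)(\varphi)=\int_G\varphi(s+t)\,d\mu(s)$ (for functions on $G$ the corresponding translate by $t$ is $x\mapsto f(x-t)$). The hull $\mathbb{X}(\mu)=\overline{\{\alpha(t,\mu):t\in G\}}$ is the closure in the vague topology (convergence on test functions $\varphi\in C_c(G)$); it is compact and $(\mathbb{X}(\mu),G)$ is a topological dynamical system (continuous action of $G$ on a compact space). For bounded measurable $h:G\to\mathbb{C}$ put $\|h\|_b=\limsup_n\sqrt{\frac{1}{|A_n|}\int_{A_n}|h(t)|^2dt}$. $h$ is Besicovitch almost periodic w.r.t. $\mathcal{A}$ if for every $\varepsilon>0$ there is a finite linear combination $p$ of elements of $\widehat{G}$ with $\|h-p\|_b\le\varepsilon$; the set of such $h$ is $Bap^2_{\mathcal{A}}(G)$. The measure $\mu$ is Besicovitch almost periodic along (with respect to) $\mathcal{A}$ if $\mu*\varphi\in Bap^2_{\mathcal{A}}(G)$ for all $\varphi\in C_c(G)$. For a topological dynamical system $(X,G)$ with a $G$-invariant probability measure $m$: $m$ is ergodic if every measurable $f:X\to\mathbb{C}$ such that for each $t\in G$ one has $f(t.\,\cdot)=f$ $m$-a.e. is constant $m$-a.e. (ergodic measures are understood to be $G$-invariant probability measures); an eigenfunction to $\chi\in\widehat{G}$ is a nonzero $f\in L^2(X,m)$ with $f(t\,\cdot)=\chi(t)f$ in $L^2(X,m)$ for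 all $t\in G$ (with $0$ they form the eigenspace of $\chi$); $\mathbb{S}$ is the set of $\chi$ having an eigenfunction; $m$ has pure point spectrum if the closed linear span of the eigenfunctions is $L^2(X,m)$; $\langle f,g\rangle=\int_Xf\overline{g}\,dm$. $\mathcal{L}^2(X,m)$ denotes the square-integrable measurable functions on $X$ (functions, not classes). A point $x\in X$ is a Wiener–Wintner point of $(X,G,m)$ with respect to $\mathcal{A}$ if there is a set $B\subseteq\mathcal{L}^2(X,m)$ consisting of eigenfunctions such that: (1) for each $\chi\in\mathbb{S}$ the set of $e\in B$ that are eigenfunctions for $\chi$ is an orthonormal basis of the eigenspace for $\chi$; (2) for all $f\in C(X)$ and $e\in B$ with corresponding eigenvalue $\chi_e$ the limit $\lim_n\frac{1}{|A_n|}\int_{A_n}f(t.x)\overline{\chi_e(t)}\,dt$ exists and equals $\langle f,e\rangle$.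
   Formalization: The action of G on the hull is taken as (t.ν)(φ) = ∫φ(s−t)dν(s) instead of ∫φ(s+t)dν(s), since with the printed sign the claim fails for non-symmetric van Hove sequences; for symmetric A_n = −A_n the two versions agree. *)

theory Defs
  imports "HOL-Probability.Probability"
begin

section \<open>The group, Haar measure and averaging sequences\<close>

definition sigma_compact :: "'a::topological_space set \<Rightarrow> bool" where
  "sigma_compact S \<longleftrightarrow> (\<exists>K :: nat \<Rightarrow> 'a set. (\<forall>n. compact (K n)) \<and> S = (\<Union>n. K n))"

definition haar_measure :: "'g::{topological_ab_group_add, t2_space} measure \<Rightarrow> bool" where
  "haar_measure haar \<longleftrightarrow>
     sets haar = sets borel \<and>
     emeasure haar UNIV \<noteq> 0 \<and>
     (\<forall>K. compact K \<longrightarrow> emeasure haar K < \<infinity>) \<and>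
     (\<forall>B\<in>sets borel. emeasure haar B = (INF U\<in>{U. open U \<and> B \<subseteq> U}. emeasure haar U)) \<and>
     (\<forall>U. open U \<longrightarrow> emeasure haar U = (SUP K\<in>{K. compact K \<and> K \<subseteq> U}. emeasure haar K)) \<and>
     (\<forall>t. \<forall>B\<in>sets borel. emeasure haar ((+) t ` B) = emeasure haar B)"

definition vH_boundary :: "'g::{topological_ab_group_add, t2_space} set \<Rightarrow> 'g set \<Rightarrow> 'g set" where
  "vH_boundary K A =
     closure ({a + k |a k. a \<in> A \<and> k \<in> K} - A) \<union>
     ({x - k |x k. x \<in> closure (- A) \<and> k \<in> K} \<inter> closure A)"

definition van_Hove :: "'g::{topological_ab_group_add, t2_space} measure \<Rightarrow> (nat \<Rightarrow> 'g set) \<Rightarrow> bool" where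
  "van_Hove haar A \<longleftrightarrow>
     (\<forall>n. open (A n) \<and> compact (closure (A n)) \<and> measure haar (A n) > 0) \<and>
     (\<forall>K. compact K \<longrightarrow>
        (\<lambda>n. measure haar (vH_boundary K (A n)) / measure haar (A n)) \<longlonglongrightarrow> 0)"

definition dual_group :: "('g::{topological_ab_group_add, t2_space} \<Rightarrow> complex) set" where
  "dual_group = {\<xi>. continuous_on UNIV \<xi> \<and> (\<forall>t. cmod (\<xi> t) = 1) \<and>
                     (\<forall>s t. \<xi> (s + t) = \<xi> s * \<xi> t)}"

definition linear_combinations :: "('x \<Rightarrow> complex) set \<Rightarrow> ('x \<Rightarrow> complex) set" where
  "linear_combinations F = {(\<lambda>x. \<Sum>e\<in>S. c e * e x) |S c. finite S \<and> S \<subseteq> F}"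


section \<open>Radon measures and their hulls\<close>

definition Cc :: "('g::topological_space \<Rightarrow> complex) set" where
  "Cc = {\<phi>. continuous_on UNIV \<phi> \<and> compact (closure {x. \<phi> x \<noteq> 0})}"

text \<open>
  A (complex) Radon measure is a linear functional on \<^term>\<open>Cc\<close>, represented by a function that is
  \<^term>\<open>undefined\<close> outside \<^term>\<open>Cc\<close>, so that equality of measures is equality in HOL. Continuity
  in the inductive topology means boundedness on the functions supported in \<open>K\<close>, for each compact \<open>K\<close>.
\<close>

definition radon_measures :: "(('g::topological_space \<Rightarrow> complex) \<Rightarrow> complex) set" where
  "radon_measures = {\<mu> \<in> extensional Cc.
     (\<forall>\<phi>\<in>Cc. \<forall>\<psi>\<in>Cc. \<mu> (\<lambda>x. \<phi> x + \<psi> x) = \<mu> \<phi> + \<mu> \<psi>) \<and>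
     (\<forall>c. \<forall>\<phi>\<in>Cc. \<mu> (\<lambda>x. c * \<phi> x) = c * \<mu> \<phi>) \<and>
     (\<forall>K. compact K \<longrightarrow>
        (\<exists>C. \<forall>\<phi>\<in>Cc. closure {x. \<phi> x \<noteq> 0} \<subseteq> K \<longrightarrow> cmod (\<mu> \<phi>) \<le> C * (SUP x. cmod (\<phi> x))))}"

definition vague_topology :: "(('g::topological_space \<Rightarrow> complex) \<Rightarrow> complex) topology" where
  "vague_topology = subtopology (product_topology (\<lambda>_. euclidean) Cc) radon_measures"

definition mconv ::
  "(('g::topological_ab_group_add \<Rightarrow> complex) \<Rightarrow> complex) \<Rightarrow> ('g \<Rightarrow> complex) \<Rightarrow> 'g \<Rightarrow> complex" where
  "mconv \<mu> \<phi> t = \<mu> (\<lambda>s. \<phi> (t - s))"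

definition translation_bounded_measures ::
  "(('g::topological_ab_group_add \<Rightarrow> complex) \<Rightarrow> complex) set" where
  "translation_bounded_measures =
     {\<mu> \<in> radon_measures. \<forall>\<phi>\<in>Cc. bounded (range (mconv \<mu> \<phi>))}"

definition translate ::
  "'g::topological_ab_group_add \<Rightarrow> (('g \<Rightarrow> complex) \<Rightarrow> complex) \<Rightarrow> (('g \<Rightarrow> complex) \<Rightarrow> complex)" where
  "translate t \<mu> = (\<lambda>\<phi>\<in>Cc. \<mu> (\<lambda>s. \<phi> (s + t)))"

text \<open>
  \<^term>\<open>translate t \<mu>\<close> is \<open>\<mu>\<close> moved by \<open>t\<close>: it takes the Dirac measure at \<open>x\<close> to the one at
  \<open>x + t\<close>. Hence \<open>mconv \<mu> \<phi> t\<close> is the value at \<open>\<lambda>s. \<phi> (- s)\<close> of \<^term>\<open>translate (- t) \<mu>\<close>, not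
  of \<^term>\<open>translate t \<mu>\<close>. So averages of \<open>mconv \<mu> \<phi>\<close> over a set \<open>A\<close> are averages over \<open>A\<close> along the
  orbit of \<open>\<mu>\<close> for the action \<open>\<lambda>t. translate (- t)\<close>; for the action \<open>translate\<close> one would have to
  reflect \<open>A\<close>. The orbit closure is the same for both actions.
\<close>

definition measure_hull ::
  "(('g::topological_ab_group_add \<Rightarrow> complex) \<Rightarrow> complex) \<Rightarrow> (('g \<Rightarrow> complex) \<Rightarrow> complex) topology" where
  "measure_hull \<mu> =
     subtopology vague_topology (vague_topology closure_of (range (\<lambda>t. translate t \<mu>)))"


section \<open>Besicovitch almost periodicity\<close>

definition besicovitch_norm ::
  "'g::topological_space measure \<Rightarrow> (nat \<Rightarrow> 'g set) \<Rightarrow> ('g \<Rightarrow> complex) \<Rightarrow> ereal" where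
  "besicovitch_norm haar A h =
     limsup (\<lambda>n. ereal (sqrt (1 / measure haar (A n) * (LINT t:A n|haar. (cmod (h t))\<^sup>2))))"

definition Bap2 ::
  "'g::{topological_ab_group_add, t2_space} measure \<Rightarrow> (nat \<Rightarrow> 'g set) \<Rightarrow> ('g \<Rightarrow> complex) set" where
  "Bap2 haar A = {h. h \<in> borel_measurable borel \<and> bounded (range h) \<and>
     (\<forall>\<epsilon>>0. \<exists>p\<in>linear_combinations dual_group. besicovitch_norm haar A (\<lambda>t. h t - p t) \<le> ereal \<epsilon>)}"

definition besicovitch_almost_periodic ::
  "'g::{topological_ab_group_add, t2_space} measure \<Rightarrow> (nat \<Rightarrow> 'g set) \<Rightarrow>
   (('g \<Rightarrow> complex) \<Rightarrow> complex) \<Rightarrow> bool" where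
  "besicovitch_almost_periodic haar A \<mu> \<longleftrightarrow> (\<forall>\<phi>\<in>Cc. mconv \<mu> \<phi> \<in> Bap2 haar A)"


section \<open>Topological dynamical systems with an invariant measure\<close>

text \<open>
  A system is given by a topology \<open>X\<close> (with its underlying space \<^term>\<open>topspace X\<close>) and an action \<open>T\<close>
  of the group. The space \<open>X\<close> need not be metrizable; as usual on compact spaces, a probability
  measure on \<open>X\<close> is understood to be a regular Borel measure.
\<close>

definition borel_sigma :: "'x topology \<Rightarrow> 'x measure" where
  "borel_sigma X = sigma (topspace X) {U. openin X U}"

definition regular_probability :: "'x topology \<Rightarrow> 'x measure \<Rightarrow> bool" where
  "regular_probability X m \<longleftrightarrow>
     prob_space m \<and> sets m = sets (borel_sigma X) \<and>
     (\<forall>B\<in>sets m. emeasure m B = (SUP K\<in>{K. compactin X K \<and> K \<subseteq> B}. emeasure m K))"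

definition invariant_probability :: "'x topology \<Rightarrow> ('g \<Rightarrow> 'x \<Rightarrow> 'x) \<Rightarrow> 'x measure \<Rightarrow> bool" where
  "invariant_probability X T m \<longleftrightarrow>
     regular_probability X m \<and> (\<forall>t. T t \<in> measurable m m \<and> distr m m (T t) = m)"

definition ergodic :: "'x topology \<Rightarrow> ('g \<Rightarrow> 'x \<Rightarrow> 'x) \<Rightarrow> 'x measure \<Rightarrow> bool" where
  "ergodic X T m \<longleftrightarrow>
     invariant_probability X T m \<and>
     (\<forall>f :: 'x \<Rightarrow> complex. f \<in> borel_measurable m \<longrightarrow> (\<forall>t. AE x in m. f (T t x) = f x) \<longrightarrow>
        (\<exists>c. AE x in m. f x = c))"

definition L2 :: "'x measure \<Rightarrow> ('x \<Rightarrow> complex) set" where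
  "L2 m = {f. f \<in> borel_measurable m \<and> integrable m (\<lambda>x. (cmod (f x))\<^sup>2)}"

definition inner_L2 :: "'x measure \<Rightarrow> ('x \<Rightarrow> complex) \<Rightarrow> ('x \<Rightarrow> complex) \<Rightarrow> complex" where
  "inner_L2 m f g = (LINT x|m. f x * cnj (g x))"

definition norm_L2 :: "'x measure \<Rightarrow> ('x \<Rightarrow> complex) \<Rightarrow> real" where
  "norm_L2 m f = sqrt (LINT x|m. (cmod (f x))\<^sup>2)"

definition closed_span_L2 :: "'x measure \<Rightarrow> ('x \<Rightarrow> complex) set \<Rightarrow> ('x \<Rightarrow> complex) set" where
  "closed_span_L2 m F =
     {f \<in> L2 m. \<forall>\<epsilon>>0. \<exists>g\<in>linear_combinations F. norm_L2 m (\<lambda>x. f x - g x) \<le> \<epsilon>}"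

definition eigenspace ::
  "('g \<Rightarrow> 'x \<Rightarrow> 'x) \<Rightarrow> 'x measure \<Rightarrow> ('g \<Rightarrow> complex) \<Rightarrow> ('x \<Rightarrow> complex) set" where
  "eigenspace T m \<xi> = {f \<in> L2 m. \<forall>t. AE x in m. f (T t x) = \<xi> t * f x}"

definition eigenfunction ::
  "('g::{topological_ab_group_add, t2_space} \<Rightarrow> 'x \<Rightarrow> 'x) \<Rightarrow> 'x measure \<Rightarrow>
   ('g \<Rightarrow> complex) \<Rightarrow> ('x \<Rightarrow> complex) \<Rightarrow> bool" where
  "eigenfunction T m \<xi> f \<longleftrightarrow> \<xi> \<in> dual_group \<and> f \<in> eigenspace T m \<xi> \<and> \<not> (AE x in m. f x = 0)"

definition eigenvalues ::
  "('g::{topological_ab_group_add, t2_space} \<Rightarrow> 'x \<Rightarrow> 'x) \<Rightarrow> 'x measure \<Rightarrow> ('g \<Rightarrow> complex) set" where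
  "eigenvalues T m = {\<xi>. \<exists>f. eigenfunction T m \<xi> f}"

definition pure_point_spectrum ::
  "('g::{topological_ab_group_add, t2_space} \<Rightarrow> 'x \<Rightarrow> 'x) \<Rightarrow> 'x measure \<Rightarrow> bool" where
  "pure_point_spectrum T m \<longleftrightarrow> closed_span_L2 m {f. \<exists>\<xi>. eigenfunction T m \<xi> f} = L2 m"

definition orthonormal_basis_L2 ::
  "'x measure \<Rightarrow> ('x \<Rightarrow> complex) set \<Rightarrow> ('x \<Rightarrow> complex) set \<Rightarrow> bool" where
  "orthonormal_basis_L2 m B E \<longleftrightarrow>
     B \<subseteq> L2 m \<and>
     (\<forall>e\<in>B. \<forall>e'\<in>B. inner_L2 m e e' = (if e = e' then 1 else 0)) \<and>
     closed_span_L2 m B = E"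

definition wiener_wintner_point ::
  "'g::{topological_ab_group_add, t2_space} measure \<Rightarrow> (nat \<Rightarrow> 'g set) \<Rightarrow>
   'x topology \<Rightarrow> ('g \<Rightarrow> 'x \<Rightarrow> 'x) \<Rightarrow> 'x measure \<Rightarrow> 'x \<Rightarrow> bool" where
  "wiener_wintner_point haar A X T m x \<longleftrightarrow>
     x \<in> topspace X \<and>
     (\<exists>B. B \<subseteq> L2 m \<and> (\<forall>e\<in>B. \<exists>\<xi>. eigenfunction T m \<xi> e) \<and>
        (\<forall>\<xi>\<in>eigenvalues T m.
           orthonormal_basis_L2 m {e \<in> B. eigenfunction T m \<xi> e} (eigenspace T m \<xi>)) \<and>
        (\<forall>f e \<xi>. continuous_map X euclidean f \<and> e \<in> B \<and> eigenfunction T m \<xi> e \<longrightarrow>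
           (\<lambda>n. (LINT t:A n|haar. f (T t x) * cnj (\<xi> t)) / of_real (measure haar (A n)))
             \<longlonglongrightarrow> inner_L2 m f e))"

end

theory Submission
  imports Defs
begin

text \<open>
  Let \<open>T t = translate (- t)\<close>, let \<open>X\<close> be the hull, and for continuous \<open>f\<close> on \<open>X\<close> let
  \<open>orb f t = f (T t \<mu>)\<close>. The functions \<open>\<mu> * \<phi>\<close> are the orbit functions of the evaluations
  \<open>\<nu> \<mapsto> \<nu> (\<lambda>s. \<phi> (- s))\<close>. The theorem compares two Hilbert space geometries on the continuous functions on
  \<open>X\<close>: the one of \<open>L2(X, m)\<close>, and the one in which the inner product of \<open>f\<close> and \<open>g\<close> is the mean of
  \<open>orb f * cnj (orb g)\<close> along \<open>A\<close>. In the second one the characters of \<open>G\<close> are orthonormal, because a van Hove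
  sequence is a Foelner sequence (\<open>orthogonal_characters\<close>). When the two geometries agree, approximating
  \<open>orb f\<close> by trigonometric polynomials and approximating \<open>f\<close> by eigenfunctions are the same thing.

  Suppose that \<open>\<mu>\<close> is a Wiener--Wintner point of an ergodic measure with pure point spectrum. By ergodicity the
  basis has one element \<open>e\<close> for each eigenvalue. The Wiener--Wintner condition says that \<open>\<langle>f, e\<rangle>\<close> is the
  Fourier--Bohr coefficient of \<open>orb f\<close> at that eigenvalue. For the eigenvalue \<open>1\<close> the basis element is the
  constant \<open>1\<close>, as one sees by testing with \<open>f = 1\<close>; so means of orbit functions are integrals, and norms agree. Hence
  the distance of \<open>orb f\<close> to its Fourier--Bohr polynomial is the distance of \<open>f\<close> to its projection on finitely many
  eigenfunctions, which is small by pure point spectrum (\<open>Wiener_Wintner_imp_BAP\<close>).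

  Conversely let \<open>\<mu>\<close> be Besicovitch almost periodic. The continuous \<open>f\<close> with almost periodic \<open>orb f\<close> form a
  uniformly closed algebra which contains the evaluations, so by Stone--Weierstrass they are all continuous functions
  (\<open>orbits_BAP\<close>). This needs compactness of \<open>X\<close>, which is Tychonoff's theorem together with the
  Banach--Steinhaus theorem: the latter makes limits of translates of \<open>\<mu>\<close> Radon again
  (\<open>orbit_closure_radon\<close>). Almost periodic functions have means, the mean of \<open>orb f\<close> is a positive functional of
  \<open>f\<close>, and the Riesz representation theorem turns it into an invariant regular measure \<open>m\<close>, for which the two
  geometries agree by construction. Let \<open>\<xi>\<close> be a character at which some \<open>orb f\<close> has a nonzero coefficient.
  Averaging translates of \<open>orb f\<close> against \<open>\<xi>\<close> suppresses all other frequencies, so that \<open>\<xi>\<close> itself is a limit of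
  orbit functions in the Besicovitch seminorm (\<open>isolate_frequency\<close>, \<open>spectrum_approx\<close>). The corresponding
  continuous functions form a Cauchy sequence in \<open>L2(X, m)\<close>, and their limit is a normalized eigenfunction
  \<open>e\<close> such that \<open>\<langle>f, e\<rangle>\<close> is the coefficient of \<open>orb f\<close> at \<open>\<xi>\<close> (\<open>eigenfunction_exists\<close>). Parseval's
  equation on \<open>G\<close> makes these eigenfunctions a basis of \<open>L2(X, m)\<close> (\<open>L2_span\<close>). So all eigenspaces are
  one-dimensional, \<open>m\<close> is ergodic, the spectrum is pure point, and the Wiener--Wintner condition is the formula for
  \<open>\<langle>f, e\<rangle>\<close>.
\<close>

section \<open>Square-integrable functions as a Hilbert space\<close>

lemma norm_L2_nonneg [simp]: "0 \<le> norm_L2 m f"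
  by (simp add: norm_L2_def)

lemma norm_L2_sq: "(norm_L2 m f)\<^sup>2 = (LINT x|m. (cmod (f x))\<^sup>2)"
  by (simp add: norm_L2_def)

lemma L2_measurable: "f \<in> L2 m \<Longrightarrow> f \<in> borel_measurable m"
  by (simp add: L2_def)

lemma L2_integrable: "f \<in> L2 m \<Longrightarrow> integrable m (\<lambda>x. (cmod (f x))\<^sup>2)"
  by (simp add: L2_def)

lemma two_mult_le_sum_squares: "2 * (a * b) \<le> a\<^sup>2 + (b::real)\<^sup>2"
  using zero_le_power2[of "a - b"] by (simp add: power2_diff)

lemma L2_integrable_norms:
  assumes "f \<in> L2 m" "g \<in> L2 m"
  shows "integrable m (\<lambda>x. cmod (f x) * cmod (g x))"
proof (rule Bochner_Integration.integrable_bound)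
  show "integrable m (\<lambda>x. (cmod (f x))\<^sup>2 + (cmod (g x))\<^sup>2)"
    using assms by (simp add: L2_def)
  show "AE x in m. norm (cmod (f x) * cmod (g x)) \<le> norm ((cmod (f x))\<^sup>2 + (cmod (g x))\<^sup>2)"
  proof (rule AE_I2)
    fix x
    have "2 * (cmod (f x) * cmod (g x)) \<le> (cmod (f x))\<^sup>2 + (cmod (g x))\<^sup>2" by (rule two_mult_le_sum_squares)
    moreover have "0 \<le> cmod (f x) * cmod (g x)" by simp
    ultimately have "cmod (f x) * cmod (g x) \<le> (cmod (f x))\<^sup>2 + (cmod (g x))\<^sup>2" by linarith
    then show "norm (cmod (f x) * cmod (g x)) \<le> norm ((cmod (f x))\<^sup>2 + (cmod (g x))\<^sup>2)"
      by (simp add: norm_mult)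
  qed
  have [measurable]: "f \<in> borel_measurable m" "g \<in> borel_measurable m" using assms by (auto simp: L2_def)
  show "(\<lambda>x. cmod (f x) * cmod (g x)) \<in> borel_measurable m" by measurable
qed

lemma borel_measurable_cnj [measurable]:
  "g \<in> borel_measurable m \<Longrightarrow> (\<lambda>x. cnj (g x)) \<in> borel_measurable m"
  by (rule borel_measurable_continuous_on) (auto intro!: continuous_intros)

lemma L2_integrable_prod:
  assumes "f \<in> L2 m" "g \<in> L2 m"
  shows "integrable m (\<lambda>x. f x * cnj (g x))"
proof (rule Bochner_Integration.integrable_bound[OF L2_integrable_norms[OF assms]])
  have [measurable]: "f \<in> borel_measurable m" "g \<in> borel_measurable m" using assms by (auto simp: L2_def)
  show "(\<lambda>x. f x * cnj (g x)) \<in> borel_measurable m" by measurable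
qed (simp add: norm_mult)

lemma L2_scale: "f \<in> L2 m \<Longrightarrow> (\<lambda>x. c * f x) \<in> L2 m"
  by (auto simp: L2_def norm_mult power_mult_distrib)

lemma L2_add:
  assumes "f \<in> L2 m" "g \<in> L2 m"
  shows "(\<lambda>x. f x + g x) \<in> L2 m"
proof -
  have [measurable]: "f \<in> borel_measurable m" "g \<in> borel_measurable m" using assms by (auto simp: L2_def)
  have "integrable m (\<lambda>x. (cmod (f x + g x))\<^sup>2)"
  proof (rule Bochner_Integration.integrable_bound)
    show "integrable m (\<lambda>x. (cmod (f x))\<^sup>2 + 2 * (cmod (f x) * cmod (g x)) + (cmod (g x))\<^sup>2)"
      using L2_integrable_norms[OF assms] assms by (simp add: L2_def)
    show "AE x in m. norm ((cmod (f x + g x))\<^sup>2)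
        \<le> norm ((cmod (f x))\<^sup>2 + 2 * (cmod (f x) * cmod (g x)) + (cmod (g x))\<^sup>2)"
    proof (rule AE_I2)
      fix x
      have "(cmod (f x + g x))\<^sup>2 \<le> (cmod (f x) + cmod (g x))\<^sup>2"
        by (intro power_mono norm_triangle_ineq) auto
      then show "norm ((cmod (f x + g x))\<^sup>2)
        \<le> norm ((cmod (f x))\<^sup>2 + 2 * (cmod (f x) * cmod (g x)) + (cmod (g x))\<^sup>2)"
        by (simp add: power2_sum algebra_simps)
    qed
  qed measurable
  then show ?thesis by (simp add: L2_def)
qed

lemma L2_zero: "(\<lambda>x. 0) \<in> L2 m"
  by (simp add: L2_def)

lemma L2_diff:
  assumes "f \<in> L2 m" "g \<in> L2 m"
  shows "(\<lambda>x. f x - g x) \<in> L2 m"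
  using L2_add[OF assms(1) L2_scale[OF assms(2), of "-1"]] by simp

lemma L2_sum: "(\<And>i. i \<in> S \<Longrightarrow> f i \<in> L2 m) \<Longrightarrow> (\<lambda>x. \<Sum>i\<in>S. f i x) \<in> L2 m"
  by (induction S rule: infinite_finite_induct) (auto intro: L2_zero L2_add)

lemma L2_comb: "(\<And>i. i \<in> S \<Longrightarrow> f i \<in> L2 m) \<Longrightarrow> (\<lambda>x. \<Sum>i\<in>S. c i * f i x) \<in> L2 m"
  by (intro L2_sum L2_scale)

lemma L2_bounded:
  assumes "finite_measure m" "f \<in> borel_measurable m" "AE x in m. cmod (f x) \<le> C"
  shows "f \<in> L2 m"
proof -
  interpret finite_measure m by fact
  have [measurable]: "f \<in> borel_measurable m" by fact
  have "integrable m (\<lambda>x. (cmod (f x))\<^sup>2)"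
  proof (rule integrable_const_bound)
    show "AE x in m. norm ((cmod (f x))\<^sup>2) \<le> C\<^sup>2"
      using assms(3) by eventually_elim (simp add: power_mono)
  qed measurable
  with assms(2) show ?thesis by (simp add: L2_def)
qed

lemma norm_L2_bounded:
  assumes "prob_space m" "f \<in> borel_measurable m" "AE x in m. cmod (f x) \<le> C" "0 \<le> C"
  shows "norm_L2 m f \<le> C"
proof -
  interpret prob_space m by fact
  have "f \<in> L2 m" using assms by (intro L2_bounded[of _ _ C]) (auto simp: finite_measure_axioms)
  then have "(LINT x|m. (cmod (f x))\<^sup>2) \<le> (LINT x|m. C\<^sup>2)"
    using assms(3)
    by (intro integral_mono_AE) (auto simp: L2_def power_mono elim!: eventually_mono)
  also have "\<dots> = C\<^sup>2" by (simp add: prob_space)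
  finally show ?thesis using assms(4) by (simp add: norm_L2_def real_le_lsqrt)
qed

lemma norm_L2_eq_0:
  assumes "f \<in> L2 m"
  shows "norm_L2 m f = 0 \<longleftrightarrow> (AE x in m. f x = 0)"
  using integral_nonneg_eq_0_iff_AE[OF L2_integrable[OF assms]] by (simp add: norm_L2_def)

lemma norm_L2_scale: "norm_L2 m (\<lambda>x. c * f x) = cmod c * norm_L2 m f"
  by (simp add: norm_L2_def norm_mult power_mult_distrib real_sqrt_mult)

lemma norm_L2_commute: "norm_L2 m (\<lambda>x. f x - g x) = norm_L2 m (\<lambda>x. g x - f x)"
  by (simp add: norm_L2_def norm_minus_commute)

text \<open>
  The weighted inequality \<open>2 a b \<le> a\<^sup>2 + b\<^sup>2\<close>, with weights chosen from the two norms, gives the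
  Cauchy--Schwarz inequality without a division by zero once null functions are set aside.
\<close>

lemma integral_norms_le:
  assumes "f \<in> L2 m" "g \<in> L2 m"
  shows "(LINT x|m. cmod (f x) * cmod (g x)) \<le> norm_L2 m f * norm_L2 m g"
proof -
  have [measurable]: "f \<in> borel_measurable m" "g \<in> borel_measurable m" using assms by (auto simp: L2_def)
  show ?thesis
  proof (cases "norm_L2 m f = 0 \<or> norm_L2 m g = 0")
    case True
    then have "AE x in m. cmod (f x) * cmod (g x) = 0"
      using norm_L2_eq_0[OF assms(1)] norm_L2_eq_0[OF assms(2)] by (auto elim: eventually_mono)
    then have "(LINT x|m. cmod (f x) * cmod (g x)) = (LINT x|m. 0)"
      by (intro integral_cong_AE) auto
    then show ?thesis by simp
  next
    case False
    define a b where "a = norm_L2 m f" and "b = norm_L2 m g"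
    have ab: "0 < a" "0 < b" using False norm_L2_nonneg[of m f] norm_L2_nonneg[of m g]
      by (auto simp: a_def b_def less_le)
    have "(LINT x|m. cmod (f x) * cmod (g x))
        \<le> (LINT x|m. (b / (2 * a)) * (cmod (f x))\<^sup>2 + (a / (2 * b)) * (cmod (g x))\<^sup>2)"
    proof (intro integral_mono)
      show "integrable m (\<lambda>x. cmod (f x) * cmod (g x))" by (rule L2_integrable_norms[OF assms])
      show "integrable m (\<lambda>x. b / (2 * a) * (cmod (f x))\<^sup>2 + a / (2 * b) * (cmod (g x))\<^sup>2)"
        using assms by (simp add: L2_def)
      fix x
      have "2 * ((b * cmod (f x)) * (a * cmod (g x))) \<le> (b * cmod (f x))\<^sup>2 + (a * cmod (g x))\<^sup>2"
        by (rule two_mult_le_sum_squares)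
      then show "cmod (f x) * cmod (g x)
          \<le> b / (2 * a) * (cmod (f x))\<^sup>2 + a / (2 * b) * (cmod (g x))\<^sup>2"
        using ab by (simp add: field_simps power2_eq_square)
    qed
    also have "\<dots> = (b / (2 * a)) * a\<^sup>2 + (a / (2 * b)) * b\<^sup>2"
      using assms by (simp add: L2_def a_def b_def norm_L2_sq)
    also have "\<dots> = a * b" using ab by (simp add: field_simps power2_eq_square)
    finally show ?thesis by (simp add: a_def b_def)
  qed
qed

lemma Cauchy_Schwarz_L2:
  assumes "f \<in> L2 m" "g \<in> L2 m"
  shows "cmod (inner_L2 m f g) \<le> norm_L2 m f * norm_L2 m g"
proof -
  have "cmod (inner_L2 m f g) \<le> (LINT x|m. cmod (f x * cnj (g x)))"
    unfolding inner_L2_def by (rule integral_norm_bound)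
  then show ?thesis using integral_norms_le[OF assms] by (simp add: norm_mult)
qed

lemma norm_L2_triangle:
  assumes "f \<in> L2 m" "g \<in> L2 m"
  shows "norm_L2 m (\<lambda>x. f x + g x) \<le> norm_L2 m f + norm_L2 m g"
proof -
  have "(LINT x|m. (cmod (f x + g x))\<^sup>2)
      \<le> (LINT x|m. (cmod (f x))\<^sup>2 + 2 * (cmod (f x) * cmod (g x)) + (cmod (g x))\<^sup>2)"
  proof (intro integral_mono)
    show "integrable m (\<lambda>x. (cmod (f x + g x))\<^sup>2)" using L2_add[OF assms] by (simp add: L2_def)
    show "integrable m (\<lambda>x. (cmod (f x))\<^sup>2 + 2 * (cmod (f x) * cmod (g x)) + (cmod (g x))\<^sup>2)"
      using L2_integrable_norms[OF assms] assms by (simp add: L2_def)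
    fix x
    have "(cmod (f x + g x))\<^sup>2 \<le> (cmod (f x) + cmod (g x))\<^sup>2"
      by (intro power_mono norm_triangle_ineq) auto
    then show "(cmod (f x + g x))\<^sup>2 \<le> (cmod (f x))\<^sup>2 + 2 * (cmod (f x) * cmod (g x)) + (cmod (g x))\<^sup>2"
      by (simp add: power2_sum algebra_simps)
  qed
  also have "\<dots> = (norm_L2 m f)\<^sup>2 + 2 * (LINT x|m. cmod (f x) * cmod (g x)) + (norm_L2 m g)\<^sup>2"
    using L2_integrable_norms[OF assms] assms by (simp add: L2_def norm_L2_sq)
  also have "\<dots> \<le> (norm_L2 m f + norm_L2 m g)\<^sup>2"
    using integral_norms_le[OF assms] by (simp add: power2_sum)
  finally show ?thesis
    unfolding norm_L2_def[of m "\<lambda>x. f x + g x"] by (intro real_le_lsqrt) auto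
qed

lemma norm_L2_triangle_diff:
  assumes "f \<in> L2 m" "g \<in> L2 m" "h \<in> L2 m"
  shows "norm_L2 m (\<lambda>x. f x - h x) \<le> norm_L2 m (\<lambda>x. f x - g x) + norm_L2 m (\<lambda>x. g x - h x)"
  using norm_L2_triangle[OF L2_diff[OF assms(1,2)] L2_diff[OF assms(2,3)]] by simp

lemma norm_L2_diff_ge:
  assumes "f \<in> L2 m" "g \<in> L2 m"
  shows "\<bar>norm_L2 m f - norm_L2 m g\<bar> \<le> norm_L2 m (\<lambda>x. f x - g x)"
  using norm_L2_triangle[OF L2_diff[OF assms] assms(2)]
    norm_L2_triangle[OF L2_diff[OF assms(2,1)] assms(1)] norm_L2_commute[of m f g] by simp

lemma norm_L2_sum:
  "finite S \<Longrightarrow> (\<And>i. i \<in> S \<Longrightarrow> f i \<in> L2 m) \<Longrightarrow>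
    norm_L2 m (\<lambda>x. \<Sum>i\<in>S. f i x) \<le> (\<Sum>i\<in>S. norm_L2 m (f i))"
proof (induction S rule: finite_induct)
  case empty
  then show ?case by (simp add: norm_L2_def)
next
  case (insert j S)
  then show ?case
    using norm_L2_triangle[of "f j" m "\<lambda>x. \<Sum>i\<in>S. f i x"] L2_sum[of S f m] by simp
qed

lemma inner_L2_add_left:
  "f \<in> L2 m \<Longrightarrow> g \<in> L2 m \<Longrightarrow> h \<in> L2 m \<Longrightarrow>
    inner_L2 m (\<lambda>x. f x + g x) h = inner_L2 m f h + inner_L2 m g h"
  using L2_integrable_prod[of f m h] L2_integrable_prod[of g m h]
  by (simp add: inner_L2_def algebra_simps)

lemma inner_L2_diff_left:
  "f \<in> L2 m \<Longrightarrow> g \<in> L2 m \<Longrightarrow> h \<in> L2 m \<Longrightarrow>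
    inner_L2 m (\<lambda>x. f x - g x) h = inner_L2 m f h - inner_L2 m g h"
  using L2_integrable_prod[of f m h] L2_integrable_prod[of g m h]
  by (simp add: inner_L2_def algebra_simps)

lemma inner_L2_scale_left: "inner_L2 m (\<lambda>x. c * f x) h = c * inner_L2 m f h"
  by (simp add: inner_L2_def mult.assoc)

lemma inner_L2_commute: "inner_L2 m f g = cnj (inner_L2 m g f)"
proof -
  have "cnj (inner_L2 m g f) = (LINT x|m. cnj (g x * cnj (f x)))"
    unfolding inner_L2_def by (rule Bochner_Integration.integral_cnj[symmetric])
  then show ?thesis by (simp add: inner_L2_def mult.commute)
qed

lemma inner_L2_diff_right:
  "f \<in> L2 m \<Longrightarrow> g \<in> L2 m \<Longrightarrow> h \<in> L2 m \<Longrightarrow>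
    inner_L2 m h (\<lambda>x. f x - g x) = inner_L2 m h f - inner_L2 m h g"
  using inner_L2_diff_left[of f m g h] by (metis complex_cnj_diff inner_L2_commute)

lemma inner_L2_sum_left:
  "finite S \<Longrightarrow> (\<And>i. i \<in> S \<Longrightarrow> f i \<in> L2 m) \<Longrightarrow> h \<in> L2 m \<Longrightarrow>
    inner_L2 m (\<lambda>x. \<Sum>i\<in>S. c i * f i x) h = (\<Sum>i\<in>S. c i * inner_L2 m (f i) h)"
proof (induction S rule: finite_induct)
  case empty
  then show ?case by (simp add: inner_L2_def)
next
  case (insert j S)
  then show ?case
    using inner_L2_add_left[of "\<lambda>x. c j * f j x" m "\<lambda>x. \<Sum>i\<in>S. c i * f i x" h] L2_comb[of S f m c]
      L2_scale[of "f j" m "c j"] inner_L2_scale_left[of m "c j" "f j" h]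
    by simp
qed

lemma inner_L2_self: "inner_L2 m f f = of_real ((norm_L2 m f)\<^sup>2)"
proof -
  have "inner_L2 m f f = (LINT x|m. of_real ((cmod (f x))\<^sup>2))"
    unfolding inner_L2_def by (intro Bochner_Integration.integral_cong) (auto simp: complex_norm_square[symmetric])
  then show ?thesis by (simp only: norm_L2_sq integral_complex_of_real)
qed

lemma norm_L2_diff_sq:
  assumes "f \<in> L2 m" "g \<in> L2 m"
  shows "(norm_L2 m (\<lambda>x. f x - g x))\<^sup>2
    = (norm_L2 m f)\<^sup>2 - 2 * Re (inner_L2 m f g) + (norm_L2 m g)\<^sup>2"
proof -
  have "complex_of_real ((norm_L2 m (\<lambda>x. f x - g x))\<^sup>2)
      = inner_L2 m f f - inner_L2 m f g - (inner_L2 m g f - inner_L2 m g g)"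
    unfolding inner_L2_self[symmetric] using assms
    by (simp add: inner_L2_diff_left inner_L2_diff_right L2_diff)
  then have "complex_of_real ((norm_L2 m (\<lambda>x. f x - g x))\<^sup>2)
      = of_real ((norm_L2 m f)\<^sup>2) - inner_L2 m f g - cnj (inner_L2 m f g) + of_real ((norm_L2 m g)\<^sup>2)"
    by (simp add: inner_L2_self inner_L2_commute[of m g f])
  then have "Re (complex_of_real ((norm_L2 m (\<lambda>x. f x - g x))\<^sup>2)) = Re
      (of_real ((norm_L2 m f)\<^sup>2) - inner_L2 m f g - cnj (inner_L2 m f g) + of_real ((norm_L2 m g)\<^sup>2))"
    by simp
  then show ?thesis by simp
qed

lemma norm_L2_comb_sq:
  assumes "finite S" "\<And>i. i \<in> S \<Longrightarrow> e i \<in> L2 m"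
  shows "of_real ((norm_L2 m (\<lambda>x. \<Sum>i\<in>S. c i * e i x))\<^sup>2)
    = (\<Sum>i\<in>S. \<Sum>j\<in>S. c i * cnj (c j) * inner_L2 m (e i) (e j))"
proof -
  let ?p = "\<lambda>x. \<Sum>i\<in>S. c i * e i x"
  have p: "?p \<in> L2 m" using assms by (intro L2_comb)
  have "inner_L2 m (e i) ?p = (\<Sum>j\<in>S. cnj (c j) * inner_L2 m (e i) (e j))" if "i \<in> S" for i
  proof -
    have "inner_L2 m (e i) ?p = cnj (\<Sum>j\<in>S. c j * inner_L2 m (e j) (e i))"
      using inner_L2_sum_left[of S e m "e i" c] assms that inner_L2_commute[of m "e i" ?p] by simp
    also have "\<dots> = (\<Sum>j\<in>S. cnj (c j) * inner_L2 m (e i) (e j))"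
      by (simp add: inner_L2_commute[of m "e i"])
    finally show ?thesis .
  qed
  then show ?thesis
    unfolding inner_L2_self[symmetric] using inner_L2_sum_left[of S e m ?p c] assms p
    by (simp add: sum_distrib_left mult.assoc)
qed

lemma norm_L2_diff_comb_sq:
  assumes "f \<in> L2 m" "finite S" "\<And>i. i \<in> S \<Longrightarrow> e i \<in> L2 m"
  shows "(norm_L2 m (\<lambda>x. f x - (\<Sum>i\<in>S. c i * e i x)))\<^sup>2
    = (norm_L2 m f)\<^sup>2 - 2 * Re (\<Sum>i\<in>S. cnj (c i) * inner_L2 m f (e i))
      + Re (\<Sum>i\<in>S. \<Sum>j\<in>S. c i * cnj (c j) * inner_L2 m (e i) (e j))"
proof -
  let ?p = "\<lambda>x. \<Sum>i\<in>S. c i * e i x"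
  have p: "?p \<in> L2 m" using assms by (intro L2_comb)
  have "inner_L2 m f ?p = cnj (\<Sum>i\<in>S. c i * inner_L2 m (e i) f)"
    using inner_L2_sum_left[of S e m f c] assms inner_L2_commute[of m f ?p] by simp
  also have "\<dots> = (\<Sum>i\<in>S. cnj (c i) * inner_L2 m f (e i))"
    by (simp add: inner_L2_commute[of m f])
  moreover have "(norm_L2 m ?p)\<^sup>2 = Re (\<Sum>i\<in>S. \<Sum>j\<in>S. c i * cnj (c j) * inner_L2 m (e i) (e j))"
    using arg_cong[OF norm_L2_comb_sq[of S e m c, OF assms(2,3)], of Re]
    by (simp only: Re_complex_of_real)
  ultimately show ?thesis using norm_L2_diff_sq[OF assms(1) p] by simp
qed

text \<open>
  With orthonormal vectors, \<open>a i\<close> the coefficients of a vector of squared norm \<open>H\<close> and \<open>c i\<close>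
  arbitrary, both sides are the squared distance of the vector to \<open>\<Sum> c i e i\<close>. The right-hand side shows that the choice
  \<open>c = a\<close> is optimal.
\<close>

lemma complete_square:
  assumes "finite S"
  shows "H - 2 * Re (\<Sum>i\<in>S. cnj (c i) * a i) + Re (\<Sum>i\<in>S. c i * cnj (c i))
    = H - (\<Sum>i\<in>S. (cmod (a i))\<^sup>2) + (\<Sum>i\<in>S. (cmod (a i - c i))\<^sup>2)"
proof -
  have "(cmod (a i - c i))\<^sup>2 = (cmod (a i))\<^sup>2 - 2 * Re (cnj (c i) * a i) + Re (c i * cnj (c i))" for i
    unfolding cmod_power2 by (simp add: power2_eq_square algebra_simps)
  then show ?thesis by (simp add: sum.distrib sum_subtractf sum_distrib_left Re_sum)
qed

lemma double_sum_orthonormal: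
  fixes c :: "'i \<Rightarrow> complex"
  assumes "finite S"
  shows "(\<Sum>i\<in>S. \<Sum>j\<in>S. c i * cnj (c j) * (if i = j then 1 else 0)) = (\<Sum>i\<in>S. c i * cnj (c i))"
  using assms by (simp add: sum.delta' if_distrib cong: if_cong)

lemma norm_L2_diff_orthonormal:
  assumes "f \<in> L2 m" "finite S" "\<And>i. i \<in> S \<Longrightarrow> e i \<in> L2 m"
    and "\<And>i j. i \<in> S \<Longrightarrow> j \<in> S \<Longrightarrow> inner_L2 m (e i) (e j) = (if i = j then 1 else 0)"
  shows "(norm_L2 m (\<lambda>x. f x - (\<Sum>i\<in>S. c i * e i x)))\<^sup>2
    = (norm_L2 m f)\<^sup>2 - (\<Sum>i\<in>S. (cmod (inner_L2 m f (e i)))\<^sup>2)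
      + (\<Sum>i\<in>S. (cmod (inner_L2 m f (e i) - c i))\<^sup>2)"
proof -
  have "(\<Sum>i\<in>S. \<Sum>j\<in>S. c i * cnj (c j) * inner_L2 m (e i) (e j))
      = (\<Sum>i\<in>S. \<Sum>j\<in>S. c i * cnj (c j) * (if i = j then 1 else 0))"
    by (intro sum.cong) (auto simp: assms(4))
  then have "(\<Sum>i\<in>S. \<Sum>j\<in>S. c i * cnj (c j) * inner_L2 m (e i) (e j)) = (\<Sum>i\<in>S. c i * cnj (c i))"
    using double_sum_orthonormal[OF assms(2), of c] by simp
  then show ?thesis
    using norm_L2_diff_comb_sq[of f m S e c, OF assms(1-3)]
      complete_square[OF assms(2), of "(norm_L2 m f)\<^sup>2" c "\<lambda>i. inner_L2 m f (e i)"] by simp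
qed

lemma linear_combinations_add:
  assumes "p \<in> linear_combinations F" "q \<in> linear_combinations F"
  shows "(\<lambda>x. p x + q x) \<in> linear_combinations F"
proof -
  obtain S c T d where 1: "finite S" "S \<subseteq> F" "p = (\<lambda>x. \<Sum>e\<in>S. c e * e x)"
    "finite T" "T \<subseteq> F" "q = (\<lambda>x. \<Sum>e\<in>T. d e * e x)"
    using assms unfolding linear_combinations_def by blast
  define k where "k e = (if e \<in> S then c e else 0) + (if e \<in> T then d e else 0)" for e
  have "p x + q x = (\<Sum>e\<in>S \<union> T. k e * e x)" for x
  proof -
    have "p x = (\<Sum>e\<in>S \<union> T. (if e \<in> S then c e else 0) * e x)"
      unfolding 1 using 1 by (intro sum.mono_neutral_cong_left) auto
    moreover have "q x = (\<Sum>e\<in>S \<union> T. (if e \<in> T then d e else 0) * e x)"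
      unfolding 1 using 1 by (intro sum.mono_neutral_cong_left) auto
    ultimately show ?thesis by (simp add: k_def sum.distrib ring_distribs)
  qed
  then show ?thesis unfolding linear_combinations_def using 1 by (intro CollectI exI[of _ "S \<union> T"] exI[of _ k]) auto
qed

lemma linear_combinations_scale:
  assumes "p \<in> linear_combinations F"
  shows "(\<lambda>x. k * p x) \<in> linear_combinations F"
proof -
  obtain S c where 1: "finite S" "S \<subseteq> F" "p = (\<lambda>x. \<Sum>e\<in>S. c e * e x)"
    using assms unfolding linear_combinations_def by blast
  then show ?thesis unfolding linear_combinations_def
    by (intro CollectI exI[of _ S] exI[of _ "\<lambda>e. k * c e"]) (auto simp: sum_distrib_left mult.assoc)
qed

lemma linear_combinations_mem:
  assumes "e \<in> F"
  shows "e \<in> linear_combinations F"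
  unfolding linear_combinations_def using assms by (intro CollectI exI[of _ "{e}"] exI[of _ "\<lambda>_. 1"]) auto

lemma linear_combinations_zero: "(\<lambda>x. 0) \<in> linear_combinations F"
  unfolding linear_combinations_def by (intro CollectI exI[of _ "{}"]) auto

lemma linear_combinations_sum:
  "(\<And>i. i \<in> S \<Longrightarrow> g i \<in> linear_combinations F) \<Longrightarrow> (\<lambda>x. \<Sum>i\<in>S. c i * g i x) \<in> linear_combinations F"
  by (induction S rule: infinite_finite_induct)
    (simp_all add: linear_combinations_zero linear_combinations_add linear_combinations_scale)

lemma linear_combinations_L2: "F \<subseteq> L2 m \<Longrightarrow> g \<in> linear_combinations F \<Longrightarrow> g \<in> L2 m"
  unfolding linear_combinations_def by (auto intro!: L2_comb)

text \<open>
  Each of the finitely many vectors of a combination from \<open>F'\<close> is replaced by a combination from \<open>F\<close>; the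
  error is controlled by the sum of the moduli of the coefficients.
\<close>

lemma closed_span_L2_trans:
  assumes "F \<subseteq> L2 m" "F' \<subseteq> closed_span_L2 m F"
  shows "closed_span_L2 m F' \<subseteq> closed_span_L2 m F"
proof
  fix f assume f: "f \<in> closed_span_L2 m F'"
  have fL: "f \<in> L2 m" using f by (simp add: closed_span_L2_def)
  have "\<exists>g\<in>linear_combinations F. norm_L2 m (\<lambda>x. f x - g x) \<le> \<epsilon>" if "\<epsilon> > 0" for \<epsilon> :: real
  proof -
    obtain S c where S: "finite S" "S \<subseteq> F'" and
      le: "norm_L2 m (\<lambda>x. f x - (\<Sum>e\<in>S. c e * e x)) \<le> \<epsilon> / 2"
      using f \<open>\<epsilon> > 0\<close> unfolding closed_span_L2_def linear_combinations_def
      by (auto dest!: spec[of _ "\<epsilon> / 2"])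
    define C where "C = (\<Sum>e\<in>S. cmod (c e)) + 1"
    have C: "C > 0" by (auto simp: C_def intro!: add_nonneg_pos sum_nonneg)
    have "\<forall>e\<in>S. \<exists>g\<in>linear_combinations F. norm_L2 m (\<lambda>x. e x - g x) \<le> \<epsilon> / 2 / C"
    proof
      fix e assume "e \<in> S"
      then have "e \<in> closed_span_L2 m F" using S assms by auto
      moreover have "\<epsilon> / 2 / C > 0" using C \<open>\<epsilon> > 0\<close> by simp
      ultimately show "\<exists>g\<in>linear_combinations F. norm_L2 m (\<lambda>x. e x - g x) \<le> \<epsilon> / 2 / C"
        unfolding closed_span_L2_def by blast
    qed
    then obtain g where g: "\<And>e. e \<in> S \<Longrightarrow> g e \<in> linear_combinations F"
      "\<And>e. e \<in> S \<Longrightarrow> norm_L2 m (\<lambda>x. e x - g e x) \<le> \<epsilon> / 2 / C" by metis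
    define h where "h x = (\<Sum>e\<in>S. c e * g e x)" for x
    have hF: "h \<in> linear_combinations F" unfolding h_def using g by (intro linear_combinations_sum) auto
    have eL: "e \<in> L2 m" if "e \<in> S" for e using that S assms unfolding closed_span_L2_def by auto
    have gL: "g e \<in> L2 m" if "e \<in> S" for e using that linear_combinations_L2[OF assms(1) g(1)] by auto
    have "norm_L2 m (\<lambda>x. (\<Sum>e\<in>S. c e * e x) - h x) = norm_L2 m (\<lambda>x. \<Sum>e\<in>S. c e * (e x - g e x))"
      by (simp add: h_def sum_subtractf right_diff_distrib)
    also have "\<dots> \<le> (\<Sum>e\<in>S. norm_L2 m (\<lambda>x. c e * (e x - g e x)))"
      using S eL gL by (intro norm_L2_sum L2_scale L2_diff) auto
    also have "\<dots> \<le> (\<Sum>e\<in>S. cmod (c e) * (\<epsilon> / 2 / C))"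
      using g(2) unfolding norm_L2_scale by (intro sum_mono mult_left_mono) auto
    also have "\<dots> = (C - 1) * (\<epsilon> / 2 / C)"
      unfolding sum_distrib_right[symmetric] by (simp add: C_def)
    also have "\<dots> \<le> C * (\<epsilon> / 2 / C)" using C \<open>\<epsilon> > 0\<close> by (intro mult_right_mono) auto
    also have "\<dots> = \<epsilon> / 2" using C by simp
    finally have "norm_L2 m (\<lambda>x. (\<Sum>e\<in>S. c e * e x) - h x) \<le> \<epsilon> / 2" .
    moreover have "norm_L2 m (\<lambda>x. f x - h x) \<le> norm_L2 m (\<lambda>x. f x - (\<Sum>e\<in>S. c e * e x))
        + norm_L2 m (\<lambda>x. (\<Sum>e\<in>S. c e * e x) - h x)"
      using fL eL linear_combinations_L2[OF assms(1) hF] by (intro norm_L2_triangle_diff L2_comb) auto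
    ultimately show ?thesis using le hF by (intro bexI[of _ h]) auto
  qed
  then show "f \<in> closed_span_L2 m F" using fL by (simp add: closed_span_L2_def)
qed

lemma nn_integral_norm_le_norm_L2:
  assumes "prob_space m" "g \<in> L2 m"
  shows "(\<integral>\<^sup>+x. ennreal (cmod (g x)) \<partial>m) \<le> ennreal (norm_L2 m g)"
proof -
  interpret prob_space m by fact
  have "finite_measure m" by (rule finite_measure_axioms)
  then have one: "(\<lambda>x. 1) \<in> L2 m" by (rule L2_bounded[where C = 1]) simp_all
  have "norm_L2 m (\<lambda>x. 1) = 1" by (simp add: norm_L2_def prob_space)
  then have "(LINT x|m. cmod (g x)) \<le> norm_L2 m g" using integral_norms_le[OF assms(2) one] by simp
  moreover have "integrable m (\<lambda>x. cmod (g x))" using L2_integrable_norms[OF assms(2) one] by simp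
  ultimately show ?thesis by (simp add: nn_integral_eq_integral ennreal_leI)
qed

lemma nn_integral_sq_norm_L2:
  "g \<in> L2 m \<Longrightarrow> (\<integral>\<^sup>+x. ennreal ((cmod (g x))\<^sup>2) \<partial>m) = ennreal ((norm_L2 m g)\<^sup>2)"
  by (simp add: nn_integral_eq_integral L2_def norm_L2_sq)

text \<open>
  The increments are summable in \<open>L1\<close>, so that the sequence converges almost everywhere; Fatou's lemma
  then bounds the \<open>L2\<close> distance to the limit. A sequence with geometrically decreasing steps is all that the
  construction of eigenfunctions produces.
\<close>

lemma L2_complete:
  fixes f :: "nat \<Rightarrow> 'x \<Rightarrow> complex"
  assumes m: "prob_space m" and fL: "\<And>k. f k \<in> L2 m"
    and le: "\<And>k. norm_L2 m (\<lambda>x. f k x - f (Suc k) x) \<le> C * (1 / 2) ^ k"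
  shows "\<exists>e\<in>L2 m. (\<lambda>k. norm_L2 m (\<lambda>x. f k x - e x)) \<longlonglongrightarrow> 0"
proof -
  interpret prob_space m by fact
  have meas [measurable]: "f k \<in> borel_measurable m" for k using fL by (simp add: L2_def)
  have C: "C \<ge> 0" using order_trans[OF norm_L2_nonneg le[of 0]] by simp
  have dist: "norm_L2 m (\<lambda>x. f k x - f (k + j) x) \<le> 2 * C * (1 / 2) ^ k" for k j
  proof -
    have "norm_L2 m (\<lambda>x. f k x - f (k + j) x) \<le> 2 * C * (1 / 2) ^ k * (1 - (1 / 2) ^ j)"
    proof (induction j)
      case 0
      then show ?case by (simp add: norm_L2_def)
    next
      case (Suc j)
      have "norm_L2 m (\<lambda>x. f k x - f (k + Suc j) x)
          \<le> norm_L2 m (\<lambda>x. f k x - f (k + j) x) + norm_L2 m (\<lambda>x. f (k + j) x - f (k + Suc j) x)"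
        by (rule norm_L2_triangle_diff[OF fL fL fL])
      also have "\<dots> \<le> 2 * C * (1 / 2) ^ k * (1 - (1 / 2) ^ j) + C * (1 / 2) ^ (k + j)"
        using Suc le[of "k + j"] by (intro add_mono) simp_all
      also have "\<dots> = 2 * C * (1 / 2) ^ k * (1 - (1 / 2) ^ Suc j)"
        by (simp add: power_add right_diff_distrib)
      finally show ?case .
    qed
    also have "\<dots> \<le> 2 * C * (1 / 2) ^ k * 1"
      using C by (intro mult_left_mono) auto
    finally show ?thesis by simp
  qed
  have "(\<integral>\<^sup>+x. (\<Sum>k. ennreal (cmod (f k x - f (Suc k) x))) \<partial>m)
      = (\<Sum>k. \<integral>\<^sup>+x. ennreal (cmod (f k x - f (Suc k) x)) \<partial>m)"
    by (rule nn_integral_suminf) measurable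
  also have "\<dots> \<le> (\<Sum>k. ennreal (C * (1 / 2) ^ k))"
  proof (intro suminf_le)
    fix k
    show "(\<integral>\<^sup>+x. ennreal (cmod (f k x - f (Suc k) x)) \<partial>m) \<le> ennreal (C * (1 / 2) ^ k)"
      using nn_integral_norm_le_norm_L2[OF m L2_diff[OF fL[of k] fL[of "Suc k"]]] le[of k]
      by (meson ennreal_leI order_trans)
  qed (rule summableI)+
  also have "\<dots> = ennreal (\<Sum>k. C * (1 / 2) ^ k)"
    using C by (intro suminf_ennreal2 summable_mult summable_geometric) simp_all
  finally have "(\<integral>\<^sup>+x. (\<Sum>k. ennreal (cmod (f k x - f (Suc k) x))) \<partial>m) < top"
    by (rule le_less_trans[OF _ ennreal_less_top])
  then have "(\<integral>\<^sup>+x. (\<Sum>k. ennreal (cmod (f k x - f (Suc k) x))) \<partial>m) \<noteq> \<infinity>" by simp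
  then have "AE x in m. (\<Sum>k. ennreal (cmod (f k x - f (Suc k) x))) \<noteq> \<infinity>"
    by (intro nn_integral_PInf_AE) measurable
  then have conv: "AE x in m. convergent (\<lambda>k. f k x)"
  proof eventually_elim
    case (elim x)
    have "summable (\<lambda>k. cmod (f k x - f (Suc k) x))"
      using elim by (intro summable_suminf_not_top) auto
    then have "summable (\<lambda>k. f k x - f (Suc k) x)" by (rule summable_norm_cancel)
    then have "summable (\<lambda>k. f (Suc k) x - f k x)" using summable_minus by fastforce
    then have "convergent (\<lambda>k. \<Sum>i<k. f (Suc i) x - f i x)"
      by (simp add: summable_iff_convergent)
    then have "convergent (\<lambda>k. f k x - f 0 x)" by (simp add: sum_lessThan_telescope[of "\<lambda>k. f k x"])
    then obtain l where "(\<lambda>k. f k x - f 0 x) \<longlonglongrightarrow> l" unfolding convergent_def by blast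
    then have "(\<lambda>k. (f k x - f 0 x) + f 0 x) \<longlonglongrightarrow> l + f 0 x" by (intro tendsto_intros)
    then show ?case unfolding convergent_def by auto
  qed
  define e where "e x = lim (\<lambda>k. f k x)" for x
  have e_meas [measurable]: "e \<in> borel_measurable m"
    unfolding e_def by measurable
  have est: "(\<integral>\<^sup>+x. ennreal ((cmod (f k x - e x))\<^sup>2) \<partial>m) \<le> ennreal ((2 * C * (1 / 2) ^ k)\<^sup>2)" for k
  proof -
    have "(\<integral>\<^sup>+x. ennreal ((cmod (f k x - e x))\<^sup>2) \<partial>m)
        = (\<integral>\<^sup>+x. liminf (\<lambda>j. ennreal ((cmod (f k x - f (k + j) x))\<^sup>2)) \<partial>m)"
    proof (rule nn_integral_cong_AE)
      show "AE x in m. ennreal ((cmod (f k x - e x))\<^sup>2)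
          = liminf (\<lambda>j. ennreal ((cmod (f k x - f (k + j) x))\<^sup>2))"
        using conv
      proof eventually_elim
        case (elim x)
        then have "(\<lambda>j. f j x) \<longlonglongrightarrow> e x" by (simp add: e_def convergent_LIMSEQ_iff)
        then have "(\<lambda>j. f (j + k) x) \<longlonglongrightarrow> e x" by (rule LIMSEQ_ignore_initial_segment)
        then have "(\<lambda>j. ennreal ((cmod (f k x - f (k + j) x))\<^sup>2)) \<longlonglongrightarrow> ennreal ((cmod (f k x - e x))\<^sup>2)"
          by (intro tendsto_intros) (simp add: add.commute)
        from lim_imp_Liminf[OF trivial_limit_sequentially this] show ?case by (rule sym)
      qed
    qed
    also have "\<dots> \<le> liminf (\<lambda>j. \<integral>\<^sup>+x. ennreal ((cmod (f k x - f (k + j) x))\<^sup>2) \<partial>m)"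
      by (rule nn_integral_liminf) measurable
    also have "\<dots> \<le> liminf (\<lambda>j::nat. ennreal ((2 * C * (1 / 2) ^ k)\<^sup>2))"
    proof (rule Liminf_mono, rule always_eventually, rule allI)
      fix j
      show "(\<integral>\<^sup>+x. ennreal ((cmod (f k x - f (k + j) x))\<^sup>2) \<partial>m) \<le> ennreal ((2 * C * (1 / 2) ^ k)\<^sup>2)"
        using nn_integral_sq_norm_L2[OF L2_diff[OF fL[of k] fL[of "k + j"]]] dist[of k j]
        by (simp add: ennreal_leI power_mono)
    qed
    also have "\<dots> = ennreal ((2 * C * (1 / 2) ^ k)\<^sup>2)" by (rule Liminf_const) simp
    finally show ?thesis .
  qed
  have diffL: "(\<lambda>x. f k x - e x) \<in> L2 m" for k
  proof -
    have "integrable m (\<lambda>x. (cmod (f k x - e x))\<^sup>2)"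
    proof (rule integrableI_bounded)
      have "(\<integral>\<^sup>+x. ennreal (norm ((cmod (f k x - e x))\<^sup>2)) \<partial>m) \<le> ennreal ((2 * C * (1 / 2) ^ k)\<^sup>2)"
        using est[of k] by simp
      also have "\<dots> < \<infinity>" by simp
      finally show "(\<integral>\<^sup>+x. ennreal (norm ((cmod (f k x - e x))\<^sup>2)) \<partial>m) < \<infinity>" .
    qed measurable
    then show ?thesis by (simp add: L2_def)
  qed
  have bound: "norm_L2 m (\<lambda>x. f k x - e x) \<le> 2 * C * (1 / 2) ^ k" for k
  proof -
    have "ennreal ((norm_L2 m (\<lambda>x. f k x - e x))\<^sup>2) \<le> ennreal ((2 * C * (1 / 2) ^ k)\<^sup>2)"
      using est[of k] nn_integral_sq_norm_L2[OF diffL[of k]] by simp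
    then have "(norm_L2 m (\<lambda>x. f k x - e x))\<^sup>2 \<le> (2 * C * (1 / 2) ^ k)\<^sup>2"
      by (simp only: ennreal_le_iff zero_le_power2)
    moreover have "0 \<le> 2 * C * (1 / 2) ^ k" using C by simp
    ultimately show ?thesis by (rule power2_le_imp_le)
  qed
  have lim: "(\<lambda>k. 2 * C * (1 / 2) ^ k) \<longlonglongrightarrow> 2 * C * 0"
    by (intro tendsto_mult_left LIMSEQ_power_zero) simp
  have "(\<lambda>k. norm_L2 m (\<lambda>x. f k x - e x)) \<longlonglongrightarrow> 0"
  proof (rule tendsto_sandwich)
    show "\<forall>\<^sub>F k in sequentially. 0 \<le> norm_L2 m (\<lambda>x. f k x - e x)" by simp
    show "\<forall>\<^sub>F k in sequentially. norm_L2 m (\<lambda>x. f k x - e x) \<le> 2 * C * (1 / 2) ^ k"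
      using bound by (intro always_eventually allI)
    show "(\<lambda>k. 2 * C * (1 / 2) ^ k) \<longlonglongrightarrow> 0" using lim by (simp only: mult_zero_right)
  qed (rule tendsto_const)
  moreover have "e \<in> L2 m" using L2_diff[OF fL[of 0] diffL[of 0]] by simp
  ultimately show ?thesis by blast
qed

section \<open>The Riesz representation theorem on a compact Hausdorff space\<close>

text \<open>
  The space of functionals on an uncountable set is Hausdorff but is no instance of the class of Hausdorff
  types. This is why compact subsets \<open>S\<close> of arbitrary spaces are used here, with the Hausdorff property required of
  the subspace.
\<close>

lemma compact_closedin:
  assumes "Hausdorff_space (top_of_set S)" "compact K" "K \<subseteq> S"
  shows "closedin (top_of_set S) K"
  using assms by (intro compactin_imp_closedin) (simp_all add: compactin_subtopology)

lemma compact_Urysohn: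
  fixes S :: "'a::topological_space set"
  assumes "compact S" "Hausdorff_space (top_of_set S)" "compact K" "K \<subseteq> S" "openin (top_of_set S) U" "K \<subseteq> U"
  obtains g :: "'a \<Rightarrow> real" where "continuous_on S g" "\<And>x. 0 \<le> g x" "\<And>x. g x \<le> 1"
    "\<And>x. x \<in> K \<Longrightarrow> g x = 1" "\<And>x. x \<in> S \<Longrightarrow> x \<notin> U \<Longrightarrow> g x = 0"
proof -
  have "normal_space (top_of_set S)"
  proof (rule compact_Hausdorff_or_regular_imp_normal_space)
    show "compact_space (top_of_set S)"
      using assms(1) by (simp add: compact_space_def compactin_subtopology)
    show "Hausdorff_space (top_of_set S) \<or> regular_space (top_of_set S)" using assms(2) by simp
  qed
  moreover have "closedin (top_of_set S) K"
    using assms by (intro compact_closedin)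
  moreover have "closedin (top_of_set S) (S - U)"
    using assms(5) by (intro closedin_diff) simp_all
  moreover have "disjnt (S - U) K" using assms by (auto simp: disjnt_def)
  ultimately obtain f where f: "continuous_map (top_of_set S) (top_of_set {0..1::real}) f"
    "f ` (S - U) \<subseteq> {0}" "f ` K \<subseteq> {1}"
    using Urysohn_lemma[of "top_of_set S" "S - U" K 0 1] by auto
  define g where "g x = max 0 (min 1 (f x))" for x
  show ?thesis
  proof (rule that[of g])
    have "continuous_on S f" using f(1) by (simp add: continuous_map_in_subtopology)
    then show "continuous_on S g" unfolding g_def by (intro continuous_intros)
  qed (use f in \<open>auto simp: g_def\<close>)
qed

locale positive_functional =
  fixes S :: "'a::topological_space set" and I :: "('a \<Rightarrow> real) \<Rightarrow> real"
  assumes compact_S: "compact S" and Hausdorff_S: "Hausdorff_space (top_of_set S)"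
    and I_add: "continuous_on S f \<Longrightarrow> continuous_on S g \<Longrightarrow> I (\<lambda>x. f x + g x) = I f + I g"
    and I_scale: "continuous_on S f \<Longrightarrow> I (\<lambda>x. c * f x) = c * I f"
    and I_nonneg: "continuous_on S f \<Longrightarrow> (\<And>x. x \<in> S \<Longrightarrow> 0 \<le> f x) \<Longrightarrow> 0 \<le> I f"
begin

lemma I_mono:
  assumes "continuous_on S f" "continuous_on S g" "\<And>x. x \<in> S \<Longrightarrow> f x \<le> g x"
  shows "I f \<le> I g"
proof -
  have "I (\<lambda>x. g x + (-1) * f x) = I g + I (\<lambda>x. (-1) * f x)"
    using assms by (intro I_add continuous_intros)
  moreover have "0 \<le> I (\<lambda>x. g x + (-1) * f x)"
    using assms by (intro I_nonneg continuous_intros) auto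
  ultimately show ?thesis using I_scale[OF assms(1), of "-1"] by simp
qed

lemma I_one_nonneg: "0 \<le> I (\<lambda>x. 1)"
  by (rule I_nonneg) auto

text \<open>
  The competitors for the volume of an open set vanish outside it. That they can be taken with compact support
  inside \<open>U\<close> is the content of \<open>cut_off\<close>.
\<close>

definition below :: "'a set \<Rightarrow> ('a \<Rightarrow> real) set" where
  "below U = {f. continuous_on S f \<and> (\<forall>x\<in>S. 0 \<le> f x \<and> f x \<le> indicator U x)}"

definition vol :: "'a set \<Rightarrow> ennreal" where
  "vol U = (SUP f\<in>below U. ennreal (I f))"

definition outer :: "'a set \<Rightarrow> ennreal" where
  "outer E = (INF U\<in>{U. openin (top_of_set S) U \<and> E \<subseteq> U}. vol U)"

lemma below_le: "f \<in> below U \<Longrightarrow> ennreal (I f) \<le> vol U"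
  unfolding vol_def by (rule SUP_upper)

lemma vol_mono: "U \<subseteq> V \<Longrightarrow> vol U \<le> vol V"
  unfolding vol_def below_def
  by (intro SUP_subset_mono) (auto intro: order_trans split: split_indicator)

lemma vol_le_one: "vol U \<le> ennreal (I (\<lambda>x. 1))"
  unfolding vol_def
proof (rule SUP_least)
  fix f assume "f \<in> below U"
  then show "ennreal (I f) \<le> ennreal (I (\<lambda>x. 1))"
    unfolding below_def by (intro ennreal_leI I_mono) (auto intro: order_trans split: split_indicator)
qed

lemma vol_S: "vol S = ennreal (I (\<lambda>x. 1))"
  by (rule antisym[OF vol_le_one]) (rule below_le, auto simp: below_def)

lemma vol_finite: "vol U < \<infinity>"
  using vol_le_one[of U] by (auto intro: le_less_trans)

text \<open>
  The set where \<open>f \<ge> \<epsilon>\<close> is compact and lies in \<open>U\<close>, and it carries the part of \<open>f\<close> above \<open>\<epsilon>\<close>. So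
  at the price of \<open>\<epsilon>\<close> times the total mass a competitor can be taken to live on a compact set.
\<close>

lemma cut_off:
  assumes f: "continuous_on S f" "\<forall>x\<in>S. 0 \<le> f x \<and> f x \<le> indicator U x" and \<epsilon>: "\<epsilon> > 0"
  defines "h \<equiv> \<lambda>x. max 0 (f x - \<epsilon>)"
  shows "compact {x\<in>S. \<epsilon> \<le> f x}" "{x\<in>S. \<epsilon> \<le> f x} \<subseteq> U" "continuous_on S h"
    "\<And>x. 0 \<le> h x" "\<And>x. x \<in> S \<Longrightarrow> h x \<le> 1" "\<And>x. x \<in> S \<Longrightarrow> h x \<noteq> 0 \<Longrightarrow> x \<in> {x\<in>S. \<epsilon> \<le> f x}"
    "ennreal (I f) \<le> ennreal (I h) + ennreal (\<epsilon> * I (\<lambda>x. 1))"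
proof -
  have "closedin (top_of_set S) (S \<inter> f -` {\<epsilon>..})"
    by (rule continuous_closedin_preimage[OF f(1)]) auto
  moreover have "S \<inter> f -` {\<epsilon>..} = {x\<in>S. \<epsilon> \<le> f x}" by auto
  ultimately have "closedin (top_of_set S) {x\<in>S. \<epsilon> \<le> f x}" by simp
  then show "compact {x\<in>S. \<epsilon> \<le> f x}" using compact_S by (rule closedin_compact[rotated])
  show "{x\<in>S. \<epsilon> \<le> f x} \<subseteq> U"
    using f(2) \<epsilon> by (force split: split_indicator_asm)
  show h: "continuous_on S h" unfolding h_def using f(1) by (intro continuous_intros)
  show "\<And>x. 0 \<le> h x" by (simp add: h_def)
  show "h x \<le> 1" if "x \<in> S" for x using bspec[OF f(2) that] \<epsilon> by (auto simp: h_def split: split_indicator_asm)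
  show "\<And>x. x \<in> S \<Longrightarrow> h x \<noteq> 0 \<Longrightarrow> x \<in> {x\<in>S. \<epsilon> \<le> f x}" by (auto simp: h_def max_def split: if_splits)
  have "I f \<le> I (\<lambda>x. h x + \<epsilon> * 1)"
    using f h by (intro I_mono continuous_intros) (auto simp: h_def)
  also have "\<dots> = I h + \<epsilon> * I (\<lambda>x. 1)"
    using h I_add[of h "\<lambda>x. \<epsilon> * 1"] I_scale[of "\<lambda>x. 1" \<epsilon>] by simp
  finally have "ennreal (I f) \<le> ennreal (I h + \<epsilon> * I (\<lambda>x. 1))" by (rule ennreal_leI)
  also have "\<dots> = ennreal (I h) + ennreal (\<epsilon> * I (\<lambda>x. 1))"
    using I_nonneg[OF h] I_one_nonneg \<epsilon> by (intro ennreal_plus) (simp_all add: h_def)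
  finally show "ennreal (I f) \<le> ennreal (I h) + ennreal (\<epsilon> * I (\<lambda>x. 1))" .
qed

lemma ennreal_le_eps_mult:
  fixes a b :: ennreal
  assumes "\<And>\<epsilon>. \<epsilon> > 0 \<Longrightarrow> a \<le> b + ennreal (\<epsilon> * C)" "C \<ge> 0"
  shows "a \<le> b"
proof (rule ennreal_le_epsilon)
  fix e :: real assume e: "0 < e"
  have "a \<le> b + ennreal (e / (C + 1) * C)" using e assms(2) by (intro assms(1)) auto
  also have "e / (C + 1) * C \<le> e" using e assms(2) by (simp add: field_simps)
  finally show "a \<le> b + ennreal e" by (meson add_left_mono ennreal_leI order_trans)
qed

text \<open>
  In place of a partition of unity, a cut-off competitor \<open>h\<close> for the union is split as \<open>h g + h (1 - g)\<close> with an
  Urysohn function \<open>g\<close> which is \<open>1\<close> on the part of the compact set outside \<open>V\<close> and vanishes outside \<open>U\<close>.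
\<close>

lemma vol_Un:
  assumes "openin (top_of_set S) U" "openin (top_of_set S) V"
  shows "vol (U \<union> V) \<le> vol U + vol V"
  unfolding vol_def[of "U \<union> V"]
proof (rule SUP_least)
  fix f assume "f \<in> below (U \<union> V)"
  then have f: "continuous_on S f" "\<forall>x\<in>S. 0 \<le> f x \<and> f x \<le> indicator (U \<union> V) x"
    by (auto simp: below_def)
  show "ennreal (I f) \<le> vol U + vol V"
  proof (rule ennreal_le_eps_mult[OF _ I_one_nonneg])
    fix \<epsilon> :: real assume "\<epsilon> > 0"
    define h where "h x = max 0 (f x - \<epsilon>)" for x
    note h = cut_off[OF f \<open>\<epsilon> > 0\<close>, folded h_def]
    let ?K = "{x\<in>S. \<epsilon> \<le> f x}"
    have "closedin (top_of_set S) (?K - V)"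
      using h(1) assms(2) by (intro closedin_diff compact_closedin Hausdorff_S) auto
    then have "compact (?K - V)" using compact_S by (rule closedin_compact[rotated])
    then obtain g where g: "continuous_on S g" "\<And>x. 0 \<le> g x" "\<And>x. g x \<le> 1"
      "\<And>x. x \<in> ?K - V \<Longrightarrow> g x = 1" "\<And>x. x \<in> S \<Longrightarrow> x \<notin> U \<Longrightarrow> g x = (0::real)"
      using compact_Urysohn[OF compact_S Hausdorff_S _ _ assms(1), of "?K - V"] h(2) by blast
    have hg: "h x * g x \<le> 1" "h x * (1 - g x) \<le> 1" if "x \<in> S" for x
      using h(4)[of x] h(5)[OF that] g(2,3)[of x] by (auto intro!: mult_le_one)
    have "(\<lambda>x. h x * g x) \<in> below U"
      using h(3,4) hg g by (auto simp: below_def intro!: continuous_intros split: split_indicator)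
    moreover have "(\<lambda>x. h x * (1 - g x)) \<in> below V"
      unfolding below_def
    proof (intro CollectI conjI ballI)
      show "continuous_on S (\<lambda>x. h x * (1 - g x))" using h(3) g(1) by (intro continuous_intros)
      fix x assume x: "x \<in> S"
      show "0 \<le> h x * (1 - g x)" using h(4)[of x] g(3)[of x] by simp
      show "h x * (1 - g x) \<le> indicator V x"
      proof (cases "x \<in> V")
        case True
        then show ?thesis using hg(2)[OF x] by simp
      next
        case False
        then have "h x = 0 \<or> g x = 1" using h(6)[OF x] g(4)[of x] by blast
        then show ?thesis using False by auto
      qed
    qed
    moreover have "I h = I (\<lambda>x. h x * g x) + I (\<lambda>x. h x * (1 - g x))"
      using I_add[of "\<lambda>x. h x * g x" "\<lambda>x. h x * (1 - g x)"] h(3) g(1)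
      by (simp add: continuous_intros algebra_simps)
    moreover have "0 \<le> I (\<lambda>x. h x * g x)" "0 \<le> I (\<lambda>x. h x * (1 - g x))"
      using h(3,4) g by (auto intro!: I_nonneg continuous_intros)
    ultimately have "ennreal (I h) \<le> vol U + vol V"
      by (auto simp: ennreal_plus intro: add_mono below_le)
    then have "ennreal (I h) + ennreal (\<epsilon> * I (\<lambda>x. 1)) \<le> vol U + vol V + ennreal (\<epsilon> * I (\<lambda>x. 1))"
      by (rule add_right_mono)
    moreover note h(7)
    ultimately show "ennreal (I f) \<le> vol U + vol V + ennreal (\<epsilon> * I (\<lambda>x. 1))" by (rule order_trans[rotated])
  qed
qed

lemma vol_finite_UN:
  assumes "finite F" "\<And>i. openin (top_of_set S) (U i)"
  shows "vol (\<Union>i\<in>F. U i) \<le> (\<Sum>i\<in>F. vol (U i))"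
  using assms(1)
proof (induction F rule: finite_induct)
  case empty
  have "vol {} \<le> 0"
    unfolding vol_def
  proof (rule SUP_least)
    fix f assume "f \<in> below {}"
    then have f: "continuous_on S f" "\<And>x. x \<in> S \<Longrightarrow> f x \<le> 0" by (auto simp: below_def)
    then have "I f \<le> I (\<lambda>x. 0 * 1)" by (intro I_mono) auto
    then show "ennreal (I f) \<le> 0" using I_scale[of "\<lambda>x. 1" 0] by (simp add: ennreal_neg)
  qed
  then show ?case by simp
next
  case (insert i F)
  have "vol (\<Union>i\<in>insert i F. U i) \<le> vol (U i) + vol (\<Union>i\<in>F. U i)"
    using vol_Un[of "U i" "\<Union>i\<in>F. U i"] assms(2) by auto
  also have "\<dots> \<le> vol (U i) + (\<Sum>i\<in>F. vol (U i))" using insert by (intro add_left_mono)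
  finally show ?case using insert by simp
qed

text \<open>
  By compactness a cut-off competitor for a countable union is a competitor for a finite subunion.
\<close>

lemma vol_UN:
  assumes U: "\<And>i::nat. openin (top_of_set S) (U i)"
  shows "vol (\<Union>i. U i) \<le> (\<Sum>i. vol (U i))"
  unfolding vol_def[of "\<Union>i. U i"]
proof (rule SUP_least)
  fix f assume "f \<in> below (\<Union>i. U i)"
  then have f: "continuous_on S f" "\<forall>x\<in>S. 0 \<le> f x \<and> f x \<le> indicator (\<Union>i. U i) x"
    by (auto simp: below_def)
  show "ennreal (I f) \<le> (\<Sum>i. vol (U i))"
  proof (rule ennreal_le_eps_mult[OF _ I_one_nonneg])
    fix \<epsilon> :: real assume "\<epsilon> > 0"
    define h where "h x = max 0 (f x - \<epsilon>)" for x
    note h = cut_off[OF f \<open>\<epsilon> > 0\<close>, folded h_def]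
    obtain W where W: "\<And>i. open (W i)" "\<And>i. U i = S \<inter> W i"
      using U unfolding openin_open by metis
    have op: "open (W i)" if "i \<in> UNIV" for i by (rule W(1))
    have cov: "{x\<in>S. \<epsilon> \<le> f x} \<subseteq> (\<Union>i\<in>UNIV. W i)" using h(2) W(2) by blast
    obtain F where F: "F \<subseteq> UNIV" "finite F" "{x\<in>S. \<epsilon> \<le> f x} \<subseteq> (\<Union>i\<in>F. W i)"
      by (rule compactE_image[OF h(1) op cov])
    have "h \<in> below (\<Union>i\<in>F. U i)"
      using h(3-6) F W by (auto simp: below_def split: split_indicator)
    then have "ennreal (I h) \<le> vol (\<Union>i\<in>F. U i)" by (rule below_le)
    also have "\<dots> \<le> (\<Sum>i\<in>F. vol (U i))" by (rule vol_finite_UN[OF F(2) U])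
    also have "\<dots> \<le> (\<Sum>i. vol (U i))" using F(2) by (intro sum_le_suminf) auto
    finally have "ennreal (I h) + ennreal (\<epsilon> * I (\<lambda>x. 1)) \<le> (\<Sum>i. vol (U i)) + ennreal (\<epsilon> * I (\<lambda>x. 1))"
      by (rule add_right_mono)
    moreover note h(7)
    ultimately show "ennreal (I f) \<le> (\<Sum>i. vol (U i)) + ennreal (\<epsilon> * I (\<lambda>x. 1))" by (rule order_trans[rotated])
  qed
qed

lemma outer_open: "openin (top_of_set S) U \<Longrightarrow> outer U = vol U"
  unfolding outer_def
  by (rule antisym) (auto intro!: INF_lower2[of U] INF_greatest vol_mono)

lemma outer_mono: "E \<subseteq> E' \<Longrightarrow> outer E \<le> outer E'"
  unfolding outer_def by (rule INF_superset_mono) auto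

lemma outer_approx:
  assumes "E \<subseteq> S" "0 < (\<epsilon>::ennreal)"
  obtains U where "openin (top_of_set S) U" "E \<subseteq> U" "vol U \<le> outer E + \<epsilon>"
proof -
  have "outer E \<le> vol S" unfolding outer_def using assms by (intro INF_lower) auto
  then have "outer E < \<infinity>" using vol_finite[of S] by (auto intro: le_less_trans)
  then have "outer E < outer E + \<epsilon>" using assms(2) ennreal_add_left_cancel_less[of "outer E" 0 \<epsilon>] by simp
  then obtain U where "openin (top_of_set S) U" "E \<subseteq> U" "vol U < outer E + \<epsilon>"
    unfolding outer_def[of E] INF_less_iff by auto
  then show ?thesis by (intro that[of U]) auto
qed

lemma outer_measure_space_outer: "outer_measure_space (Pow S) outer"
  unfolding outer_measure_space_def
proof (intro conjI)
  have "outer {} = vol {}" by (rule outer_open) simp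
  also have "vol {} = 0" using vol_finite_UN[of "{}" "\<lambda>i::nat. {}"] by simp
  finally show "positive (Pow S) outer" by (simp add: positive_def)
  show "increasing (Pow S) outer" by (simp add: increasing_def outer_mono)
  show "countably_subadditive (Pow S) outer"
    unfolding countably_subadditive_def
  proof (intro allI impI)
    fix E :: "nat \<Rightarrow> 'a set"
    assume E: "range E \<subseteq> Pow S"
    show "outer (\<Union>i. E i) \<le> (\<Sum>i. outer (E i))"
    proof (rule ennreal_le_epsilon)
      fix \<epsilon> :: real assume \<epsilon>: "0 < \<epsilon>"
      have "\<exists>U. openin (top_of_set S) U \<and> E i \<subseteq> U \<and> vol U \<le> outer (E i) + ennreal (\<epsilon> * (1 / 2) ^ Suc i)" for i
        using outer_approx[of "E i" "ennreal (\<epsilon> * (1 / 2) ^ Suc i)"] E \<epsilon>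
        by (metis (no_types, lifting) Pow_iff ennreal_less_zero_iff half_gt_zero_iff image_subset_iff mult_pos_pos rangeI
            zero_less_one zero_less_power UNIV_I)
      then obtain U where U: "\<And>i. openin (top_of_set S) (U i)" "\<And>i. E i \<subseteq> U i"
        "\<And>i. vol (U i) \<le> outer (E i) + ennreal (\<epsilon> * (1 / 2) ^ Suc i)" by metis
      have "outer (\<Union>i. E i) \<le> vol (\<Union>i. U i)"
        unfolding outer_def using U by (intro INF_lower) blast
      also have "\<dots> \<le> (\<Sum>i. vol (U i))" by (rule vol_UN[OF U(1)])
      also have "\<dots> \<le> (\<Sum>i. outer (E i) + ennreal (\<epsilon> * (1 / 2) ^ Suc i))"
        by (intro suminf_le U) auto
      also have "\<dots> = (\<Sum>i. outer (E i)) + (\<Sum>i. ennreal (\<epsilon> * (1 / 2) ^ Suc i))"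
        by (rule suminf_add[symmetric]) auto
      also have "(\<Sum>i. ennreal (\<epsilon> * (1 / 2) ^ Suc i)) = ennreal \<epsilon>"
        using sums_mult[OF power_half_series, of \<epsilon>] \<epsilon>
        by (intro sums_unique[symmetric] sums_ennreal[THEN iffD2]) auto
      finally show "outer (\<Union>i. E i) \<le> (\<Sum>i. outer (E i)) + ennreal \<epsilon>" .
    qed
  qed
qed

text \<open>
  Caratheodory's condition for an open set \<open>V\<close>: for an open \<open>U\<close>, a cut-off competitor \<open>h\<close> for \<open>U \<inter> V\<close>
  lives on a compact set \<open>K\<close>, and \<open>h\<close> plus a competitor for \<open>U - K\<close> is a competitor for \<open>U\<close>.
\<close>

lemma open_in_lambda_system:
  assumes V: "openin (top_of_set S) V"
  shows "V \<in> lambda_system S (Pow S) outer"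
proof -
  interpret sigma_algebra S "Pow S" by (rule sigma_algebra_Pow)
  have VS: "V \<subseteq> S" using V openin_imp_subset by blast
  have "outer (V \<inter> E) + outer ((S - V) \<inter> E) = outer E" if E: "E \<subseteq> S" for E
  proof (rule antisym)
    show "outer (V \<inter> E) + outer ((S - V) \<inter> E) \<le> outer E"
      unfolding outer_def[of E]
    proof (rule INF_greatest, clarify)
      fix U assume U: "openin (top_of_set S) U" "E \<subseteq> U"
      have "vol (U \<inter> V) + outer ((S - V) \<inter> E) \<le> vol U"
      proof (cases "below (U \<inter> V) = {}")
        case True
        have "(\<lambda>x. 0) \<in> below (U \<inter> V)" by (auto simp: below_def)
        with True show ?thesis by simp
      next
        case False
        have *: "ennreal (I f) + outer ((S - V) \<inter> E) \<le> vol U" if "f \<in> below (U \<inter> V)" for f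
        proof (rule ennreal_le_eps_mult[OF _ I_one_nonneg])
          fix \<epsilon> :: real assume "\<epsilon> > 0"
          have f: "continuous_on S f" "\<forall>x\<in>S. 0 \<le> f x \<and> f x \<le> indicator (U \<inter> V) x"
            using that by (auto simp: below_def)
          define h where "h x = max 0 (f x - \<epsilon>)" for x
          note h = cut_off[OF f \<open>\<epsilon> > 0\<close>, folded h_def]
          let ?K = "{x\<in>S. \<epsilon> \<le> f x}"
          have W: "openin (top_of_set S) (U - ?K)"
            using h(1) U(1) by (intro openin_diff compact_closedin Hausdorff_S) auto
          have "outer ((S - V) \<inter> E) \<le> vol (U - ?K)"
            unfolding outer_def using W U h(2) by (intro INF_lower) auto
          moreover have "ennreal (I h) + vol (U - ?K) \<le> vol U"
          proof -
            have "ennreal (I h) + ennreal (I g) \<le> vol U" if g: "g \<in> below (U - ?K)" for g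
            proof -
              have g': "continuous_on S g" "\<And>x. x \<in> S \<Longrightarrow> 0 \<le> g x \<and> g x \<le> indicator (U - ?K) x"
                using g by (auto simp: below_def)
              have "h x + g x \<le> indicator U x" if x: "x \<in> S" for x
              proof (cases "x \<in> ?K")
                case True
                then have "g x \<le> 0" "x \<in> U" using g'(2)[OF x] h(2) by auto
                then show ?thesis using h(5)[OF x] by simp
              next
                case False
                then have "h x = 0" using h(6)[OF x] by blast
                moreover have "g x \<le> indicator (U - ?K) x" using g'(2)[OF x] by (rule conjunct2)
                moreover have "indicator (U - ?K) x \<le> (indicator U x :: real)" by (simp add: indicator_def)
                ultimately show ?thesis by linarith
              qed
              then have "(\<lambda>x. h x + g x) \<in> below U"
                using h(3,4) g' by (auto simp: below_def intro!: continuous_intros)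
              from below_le[OF this] show ?thesis
                using I_add[OF h(3) g'(1)] I_nonneg[OF h(3,4)] I_nonneg[OF g'(1)] g'(2)
                by (simp add: ennreal_plus)
            qed
            moreover have "below (U - ?K) \<noteq> {}"
              by (auto simp: below_def intro!: exI[of _ "\<lambda>x. 0"])
            ultimately show ?thesis
              unfolding vol_def[of "U - ?K"]
              by (subst ennreal_SUP_add_right) (auto intro!: SUP_least)
          qed
          moreover note h(7)
          ultimately have "ennreal (I f) + outer ((S - V) \<inter> E)
              \<le> (ennreal (I h) + ennreal (\<epsilon> * I (\<lambda>x. 1))) + vol (U - ?K)" by (intro add_mono)
          also have "\<dots> = (ennreal (I h) + vol (U - ?K)) + ennreal (\<epsilon> * I (\<lambda>x. 1))"
            by (simp add: ac_simps)
          also have "\<dots> \<le> vol U + ennreal (\<epsilon> * I (\<lambda>x. 1))"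
            using \<open>ennreal (I h) + vol (U - ?K) \<le> vol U\<close> by (rule add_right_mono)
          finally show "ennreal (I f) + outer ((S - V) \<inter> E) \<le> vol U + ennreal (\<epsilon> * I (\<lambda>x. 1))" .
        qed
        show ?thesis
          unfolding vol_def[of "U \<inter> V"] using False *
          by (subst ennreal_SUP_add_left[symmetric]) (auto intro!: SUP_least)
      qed
      moreover have "outer (V \<inter> E) \<le> vol (U \<inter> V)"
      proof -
        have "openin (top_of_set S) (U \<inter> V)" using U(1) V by (rule openin_Int)
        then have "outer (U \<inter> V) = vol (U \<inter> V)" by (rule outer_open)
        moreover have "outer (V \<inter> E) \<le> outer (U \<inter> V)" using U(2) by (intro outer_mono) auto
        ultimately show ?thesis by simp
      qed
      ultimately show "outer (V \<inter> E) + outer ((S - V) \<inter> E) \<le> vol U"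
        by (meson add_right_mono order_trans)
    qed
    have "countably_subadditive (Pow S) outer" "positive (Pow S) outer"
      using outer_measure_space_outer by (auto simp: outer_measure_space_def)
    then have "subadditive (Pow S) outer" by (rule countably_subadditive_subadditive[rotated])
    then have "outer ((V \<inter> E) \<union> ((S - V) \<inter> E)) \<le> outer (V \<inter> E) + outer ((S - V) \<inter> E)"
      using E by (intro subadditiveD) auto
    moreover have "(V \<inter> E) \<union> ((S - V) \<inter> E) = E" using E by auto
    ultimately show "outer E \<le> outer (V \<inter> E) + outer ((S - V) \<inter> E)" by simp
  qed
  then show ?thesis using VS by (auto simp: lambda_system_def)
qed

text \<open>
  Caratheodory's theorem makes the outer measure a measure on its measurable sets, and these contain the
  open sets, hence the Borel sets.
\<close>

definition riesz_measure :: "'a measure" where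
  "riesz_measure = measure_of S {U. openin (top_of_set S) U} outer"

lemma sets_riesz: "sets riesz_measure = sets (borel_sigma (top_of_set S))"
  and space_riesz: "space riesz_measure = S"
proof -
  have "{U. openin (top_of_set S) U} \<subseteq> Pow S" using openin_imp_subset by blast
  then show "sets riesz_measure = sets (borel_sigma (top_of_set S))" "space riesz_measure = S"
    unfolding riesz_measure_def borel_sigma_def by (simp_all add: sets_measure_of space_measure_of)
qed

lemma emeasure_riesz:
  assumes "B \<in> sets riesz_measure"
  shows "emeasure riesz_measure B = outer B"
proof -
  have sub: "{U. openin (top_of_set S) U} \<subseteq> Pow S" using openin_imp_subset by blast
  have ms: "measure_space S (lambda_system S (Pow S) outer) outer"
    by (rule sigma_algebra.caratheodory_lemma[OF sigma_algebra_Pow outer_measure_space_outer])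
  then have "sigma_algebra S (lambda_system S (Pow S) outer)"
    unfolding measure_space_def by (rule conjunct1)
  then interpret L: sigma_algebra S "lambda_system S (Pow S) outer" .
  have "sigma_sets S {U. openin (top_of_set S) U} \<subseteq> lambda_system S (Pow S) outer"
    by (rule L.sigma_sets_subset) (use open_in_lambda_system in blast)
  then have "measure_space S (sigma_sets S {U. openin (top_of_set S) U}) outer"
    by (rule measure_down[OF ms sigma_algebra_sigma_sets[OF sub]])
  then have "positive (sets riesz_measure) outer" "countably_additive (sets riesz_measure) outer"
    using sub by (simp_all add: riesz_measure_def sets_measure_of measure_space_def)
  with assms show ?thesis by (intro emeasure_measure_of[OF riesz_measure_def sub])
qed

end

lemma space_borel_sigma [simp]: "space (borel_sigma (top_of_set S)) = S"
proof -
  have "{U. openin (top_of_set S) U} \<subseteq> Pow S" using openin_imp_subset by blast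
  then show ?thesis by (simp add: borel_sigma_def space_measure_of)
qed

lemma sets_borel_sigma: "sets (borel_sigma (top_of_set S)) = sigma_sets S {U. openin (top_of_set S) U}"
proof -
  have "{U. openin (top_of_set S) U} \<subseteq> Pow S" using openin_imp_subset by blast
  then show ?thesis by (simp add: borel_sigma_def sets_measure_of)
qed

lemma openin_borel_sigma: "openin (top_of_set S) U \<Longrightarrow> U \<in> sets (borel_sigma (top_of_set S))"
  by (simp add: sets_borel_sigma sigma_sets.Basic)

lemma compact_borel_sigma:
  assumes "Hausdorff_space (top_of_set S)" "compact K" "K \<subseteq> S"
  shows "K \<in> sets (borel_sigma (top_of_set S))"
proof -
  have "closedin (top_of_set S) K" using assms by (rule compact_closedin)
  then have "openin (top_of_set S) (S - K)" by (simp add: closedin_def)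
  from sets.compl_sets[OF openin_borel_sigma[OF this]]
  have "S - (S - K) \<in> sets (borel_sigma (top_of_set S))" by simp
  then show ?thesis using assms(3) by (simp add: double_diff)
qed

lemma continuous_borel_sigma:
  assumes "continuous_on S f" "sets m = sets (borel_sigma (top_of_set S))"
  shows "f \<in> borel_measurable m"
proof (rule borel_measurableI)
  fix A :: "'b set" assume "open A"
  have "space m = S" using sets_eq_imp_space_eq[OF assms(2)] by simp
  then have "f -` A \<inter> space m = S \<inter> f -` A" by auto
  then show "f -` A \<inter> space m \<in> sets m"
    using continuous_openin_preimage_gen[OF assms(1) \<open>open A\<close>] assms(2) openin_borel_sigma by metis
qed

lemma measurable_borel_sigma_self:
  assumes "continuous_on S T" "T ` S \<subseteq> S" "sets m = sets (borel_sigma (top_of_set S))"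
  shows "T \<in> measurable m m"
proof -
  have sp: "space m = S" using sets_eq_imp_space_eq[OF assms(3)] by simp
  have "T \<in> measurable m (sigma S {U. openin (top_of_set S) U})"
  proof (rule measurable_measure_of)
    show "{U. openin (top_of_set S) U} \<subseteq> Pow S" using openin_imp_subset by blast
    show "T \<in> space m \<rightarrow> S" using assms(2) sp by auto
    fix U assume "U \<in> {U. openin (top_of_set S) U}"
    then have "openin (top_of_set S) (S \<inter> T -` U)"
      using assms(1,2) by (intro continuous_openin_preimage[where T = S]) auto
    then show "T -` U \<inter> space m \<in> sets m"
      using openin_borel_sigma assms(3) sp by (metis Int_commute)
  qed
  then have "T \<in> measurable m (borel_sigma (top_of_set S))" by (simp add: borel_sigma_def)
  then show ?thesis using measurable_cong_sets[OF refl assms(3)] by blast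
qed

context positive_functional
begin

lemma emeasure_riesz_open: "openin (top_of_set S) U \<Longrightarrow> emeasure riesz_measure U = vol U"
  by (simp add: emeasure_riesz outer_open sets_riesz openin_borel_sigma)

lemma emeasure_riesz_space: "emeasure riesz_measure S = ennreal (I (\<lambda>x. 1))"
  by (simp add: emeasure_riesz_open vol_S)

lemma finite_measure_riesz: "finite_measure riesz_measure"
  by (rule finite_measureI) (simp add: space_riesz emeasure_riesz_space)

lemma I_sum:
  "finite F \<Longrightarrow> (\<And>i. i \<in> F \<Longrightarrow> continuous_on S (f i)) \<Longrightarrow> I (\<lambda>x. \<Sum>i\<in>F. f i x) = (\<Sum>i\<in>F. I (f i))"
proof (induction F rule: finite_induct)
  case empty
  then show ?case using I_scale[of "\<lambda>x. 1" 0] by simp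
next
  case (insert i F)
  then have "I (\<lambda>x. f i x + (\<Sum>j\<in>F. f j x)) = I (f i) + I (\<lambda>x. \<Sum>j\<in>F. f j x)"
    by (intro I_add continuous_on_sum) simp_all
  then show ?case using insert by simp
qed

text \<open>
  Cut at the heights \<open>0, c, 2 c, \<dots>\<close>, the lowest \<open>n\<close> layers fill \<open>y\<close> up to the height \<open>n c\<close>.
\<close>

lemma layer_sum:
  fixes y c :: real
  assumes "0 \<le> y" "0 \<le> c"
  shows "(\<Sum>k<n. max 0 (min (y - real k * c) c)) = min y (real n * c)"
proof (induction n)
  case 0
  then show ?case using assms by simp
next
  case (Suc n)
  have "real (Suc n) * c = real n * c + c" by (simp add: algebra_simps)
  moreover have "0 \<le> real n * c" using assms by simp
  ultimately show ?case using Suc assms by (simp add: min_def max_def)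
qed

lemma continuous_integrable_riesz:
  assumes "continuous_on S (f :: 'a \<Rightarrow> real)"
  shows "integrable riesz_measure f"
proof -
  interpret finite_measure riesz_measure by (rule finite_measure_riesz)
  have "bounded (f ` S)" using compact_continuous_image[OF assms compact_S] by (rule compact_imp_bounded)
  then obtain C where "\<And>x. x \<in> S \<Longrightarrow> norm (f x) \<le> C" unfolding bounded_iff by blast
  then have "AE x in riesz_measure. norm (f x) \<le> C" by (intro AE_I2) (simp add: space_riesz)
  moreover have "f \<in> borel_measurable riesz_measure"
    by (rule continuous_borel_sigma[OF assms sets_riesz])
  ultimately show ?thesis by (rule integrable_const_bound)
qed

text \<open>
  Cut \<open>f\<close> into \<open>N\<close> layers of height \<open>1 / N\<close>. The layer number \<open>k\<close>, scaled to height \<open>1\<close>, is a competitor for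
  the open set where \<open>f > k / N\<close> and dominates the indicator of the set where \<open>f > (k + 1) / N\<close>. So the functional
  and the integral are both between Riemann sums that differ by one term of size at most \<open>I 1 / N\<close>.
\<close>

lemma I_le_integral:
  assumes f: "continuous_on S f" "\<forall>x\<in>S. 0 \<le> f x \<and> f x \<le> 1"
  shows "I f \<le> (LINT x|riesz_measure. f x)"
proof -
  interpret finite_measure riesz_measure by (rule finite_measure_riesz)
  let ?J = "LINT x|riesz_measure. f x"
  have "I f \<le> ?J + I (\<lambda>x. 1) / real (Suc M)" for M
  proof -
    define N where "N = Suc M"
    define c where "c = 1 / real N"
    have c: "c > 0" "real N * c = 1" by (simp_all add: c_def N_def)
    define g where "g k x = max 0 (min (f x - real k * c) c)" for k x
    define a where "a k = measure riesz_measure {x\<in>S. f x > real k * c}" for k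
    have op: "openin (top_of_set S) {x\<in>S. f x > real k * c}" for k
    proof -
      have "openin (top_of_set S) (S \<inter> f -` {real k * c<..})"
        by (rule continuous_openin_preimage_gen[OF f(1)]) simp
      moreover have "S \<inter> f -` {real k * c<..} = {x\<in>S. f x > real k * c}" by auto
      ultimately show ?thesis by simp
    qed
    have meas: "{x\<in>S. f x > real k * c} \<in> sets riesz_measure" for k
      using op sets_riesz openin_borel_sigma by blast
    have g: "continuous_on S (g k)" for k unfolding g_def using f(1) by (intro continuous_intros)
    have fg: "f x = (\<Sum>k<N. g k x)" if "x \<in> S" for x
    proof -
      have "0 \<le> f x" "f x \<le> 1" using f(2) that by blast+
      moreover have "0 \<le> c" using c(1) by simp
      ultimately show ?thesis
        unfolding g_def using layer_sum[of "f x" c N] c(2) by (simp add: min_def)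
    qed
    have g_upper: "I (g k) \<le> c * a k" for k
    proof -
      have "(\<lambda>x. real N * g k x) \<in> below {x\<in>S. f x > real k * c}"
        unfolding below_def
      proof (intro CollectI conjI ballI)
        show "continuous_on S (\<lambda>x. real N * g k x)" using g[of k] by (intro continuous_intros)
        fix x assume "x \<in> S"
        show "0 \<le> real N * g k x" by (simp add: g_def)
        have "real N * g k x \<le> real N * c"
          using c(1) unfolding g_def by (intro mult_left_mono) auto
        then have 1: "real N * g k x \<le> 1" using c(2) by simp
        show "real N * g k x \<le> indicator {x\<in>S. f x > real k * c} x"
        proof (cases "f x > real k * c")
          case True
          then show ?thesis using 1 \<open>x \<in> S\<close> by simp
        next
          case False
          then have "g k x = 0" using c(1) by (simp add: g_def)
          then show ?thesis by simp
        qed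
      qed
      from below_le[OF this] have "ennreal (I (\<lambda>x. real N * g k x)) \<le> ennreal (a k)"
        using emeasure_riesz_open[OF op[of k]] by (simp add: a_def emeasure_eq_measure)
      then have "real N * I (g k) \<le> a k"
        using I_scale[OF g[of k]] by (simp add: ennreal_le_iff a_def)
      then have "c * (real N * I (g k)) \<le> c * a k" using c(1) by (intro mult_left_mono) simp_all
      moreover have "c * (real N * I (g k)) = (real N * c) * I (g k)" by (simp only: ac_simps)
      ultimately show ?thesis using c(2) by simp
    qed
    have g_lower: "c * a (Suc k) \<le> (LINT x|riesz_measure. g k x)" for k
    proof -
      have "c * a (Suc k) = (LINT x|riesz_measure. c * indicator {x\<in>S. f x > real (Suc k) * c} x)"
        using meas[of "Suc k"] by (simp add: a_def)
      also have "\<dots> \<le> (LINT x|riesz_measure. g k x)"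
      proof (rule integral_mono)
        show "integrable riesz_measure (\<lambda>x. c * indicator {x\<in>S. f x > real (Suc k) * c} x)"
          using meas[of "Suc k"] by (intro integrable_mult_right integrable_real_indicator) (simp_all add: emeasure_eq_measure)
        show "integrable riesz_measure (g k)" by (rule continuous_integrable_riesz[OF g])
        fix x
        show "c * indicator {x\<in>S. f x > real (Suc k) * c} x \<le> g k x"
          using c(1) by (simp add: g_def indicator_def algebra_simps)
      qed
      finally show ?thesis .
    qed
    have "I f \<le> I (\<lambda>x. \<Sum>k<N. g k x)"
      using f(1) g fg by (intro I_mono continuous_on_sum) simp_all
    also have "\<dots> = (\<Sum>k<N. I (g k))" using g by (intro I_sum) simp_all
    also have "\<dots> \<le> (\<Sum>k<N. c * a k)" by (intro sum_mono g_upper)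
    also have "\<dots> = (\<Sum>k<N. c * a (Suc k)) + c * (a 0 - a N)"
    proof -
      have "(\<Sum>k<N. a k - a (Suc k)) = a 0 - a N" by (rule sum_lessThan_telescope')
      then have t: "(\<Sum>k<N. a k) = (\<Sum>k<N. a (Suc k)) + (a 0 - a N)" by (simp add: sum_subtractf)
      show ?thesis unfolding sum_distrib_left[symmetric] t by (rule distrib_left)
    qed
    also have "\<dots> \<le> (\<Sum>k<N. (LINT x|riesz_measure. g k x)) + c * I (\<lambda>x. 1)"
    proof (intro add_mono sum_mono g_lower mult_left_mono)
      have "a 0 \<le> measure riesz_measure S"
        unfolding a_def using meas[of 0] space_riesz by (metis (no_types) bounded_measure)
      also have "\<dots> = I (\<lambda>x. 1)" using emeasure_riesz_space I_one_nonneg by (simp add: measure_def)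
      finally show "a 0 - a N \<le> I (\<lambda>x. 1)" unfolding a_def using measure_nonneg[of riesz_measure] by (smt (verit))
    qed (use c in simp)
    also have "(\<Sum>k<N. (LINT x|riesz_measure. g k x)) = (LINT x|riesz_measure. (\<Sum>k<N. g k x))"
      using continuous_integrable_riesz[OF g] by (intro Bochner_Integration.integral_sum[symmetric])
    also have "\<dots> = ?J"
      using fg by (intro Bochner_Integration.integral_cong) (simp_all add: space_riesz)
    finally show ?thesis by (simp add: c_def N_def)
  qed
  moreover have "(\<lambda>M. ?J + I (\<lambda>x. 1) / real (Suc M)) \<longlonglongrightarrow> ?J + 0"
    by (intro tendsto_add tendsto_const LIMSEQ_Suc[OF lim_const_over_n])
  ultimately show ?thesis by (intro LIMSEQ_le_const[of "\<lambda>M. ?J + I (\<lambda>x. 1) / real (Suc M)"]) simp_all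
qed

text \<open>
  The inequality applied to \<open>f\<close> and to \<open>1 - f\<close> gives equality for \<open>f\<close> between \<open>0\<close> and \<open>1\<close>, because the
  total masses agree; a general \<open>f\<close> is rescaled.
\<close>

lemma integral_riesz:
  assumes f: "continuous_on S f"
  shows "(LINT x|riesz_measure. f x) = I f"
proof -
  interpret finite_measure riesz_measure by (rule finite_measure_riesz)
  have one: "(LINT x|riesz_measure. 1) = I (\<lambda>x. 1)"
    using emeasure_riesz_space I_one_nonneg by (simp add: measure_def space_riesz)
  have unit: "(LINT x|riesz_measure. g x) = I g"
    if g: "continuous_on S g" "\<forall>x\<in>S. 0 \<le> g x \<and> g x \<le> 1" for g
  proof (rule antisym)
    have c: "continuous_on S (\<lambda>x. 1 + (-1) * g x)" using g by (intro continuous_intros)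
    have "I (\<lambda>x. 1 + (-1) * g x) \<le> (LINT x|riesz_measure. 1 + (-1) * g x)"
      using g by (intro I_le_integral c) simp
    moreover have "I (\<lambda>x. 1 + (-1) * g x) = I (\<lambda>x. 1) + (-1) * I g"
      using g by (simp only: I_add I_scale continuous_on_const continuous_on_mult)
    moreover have "(LINT x|riesz_measure. 1 + (-1) * g x) = I (\<lambda>x. 1) - (LINT x|riesz_measure. g x)"
      using one continuous_integrable_riesz[OF g(1)] by simp
    ultimately show "(LINT x|riesz_measure. g x) \<le> I g" by simp
    show "I g \<le> (LINT x|riesz_measure. g x)" by (rule I_le_integral[OF g])
  qed
  have "bounded (f ` S)" using compact_continuous_image[OF f compact_S] by (rule compact_imp_bounded)
  then obtain C where C: "C > 0" "\<And>x. x \<in> S \<Longrightarrow> \<bar>f x\<bar> \<le> C" unfolding bounded_pos by force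
  define g where "g x = (1 / 2) * 1 + (1 / (2 * C)) * f x" for x
  have g: "continuous_on S g" unfolding g_def using f by (intro continuous_intros)
  have "0 \<le> g x \<and> g x \<le> 1" if "x \<in> S" for x
    using C(2)[OF that] C(1) unfolding abs_le_iff by (simp add: g_def field_simps)
  then have "(LINT x|riesz_measure. g x) = I g" by (intro unit g) simp
  moreover have "I g = (1 / 2) * I (\<lambda>x. 1) + (1 / (2 * C)) * I f"
    unfolding g_def using f by (simp only: I_add I_scale continuous_on_const continuous_on_mult)
  moreover have "(LINT x|riesz_measure. g x) = (1 / 2) * (LINT x|riesz_measure. 1) + (1 / (2 * C)) * (LINT x|riesz_measure. f x)"
    unfolding g_def using continuous_integrable_riesz[OF f] by simp
  ultimately show ?thesis using one C(1) by simp
qed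

text \<open>
  Outer regularity holds by construction; passing to complements in the compact space \<open>S\<close> turns it into inner
  regularity.
\<close>

lemma regular_riesz:
  assumes "I (\<lambda>x. 1) = 1"
  shows "regular_probability (top_of_set S) riesz_measure"
proof -
  interpret prob_space riesz_measure
    by (rule prob_spaceI) (simp add: space_riesz emeasure_riesz_space assms)
  have "emeasure riesz_measure B = (SUP K\<in>{K. compactin (top_of_set S) K \<and> K \<subseteq> B}. emeasure riesz_measure K)"
    (is "_ = ?R") if B: "B \<in> sets riesz_measure" for B
  proof (rule antisym)
    have BS: "B \<subseteq> S" using sets.sets_into_space[OF B] by (simp add: space_riesz)
    have Cb: "S - B \<in> sets riesz_measure" using sets.compl_sets[OF B] by (simp add: space_riesz)
    show "emeasure riesz_measure B \<le> ?R"
    proof (rule ennreal_le_epsilon)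
      fix \<epsilon> :: real assume \<epsilon>: "0 < \<epsilon>"
      have "S - B \<subseteq> S" "0 < ennreal \<epsilon>" using \<epsilon> by simp_all
      then obtain U where U: "openin (top_of_set S) U" "S - B \<subseteq> U" "vol U \<le> outer (S - B) + ennreal \<epsilon>"
        by (rule outer_approx)
      have US: "U \<in> sets riesz_measure" using openin_borel_sigma[OF U(1)] sets_riesz by blast
      have "closedin (top_of_set S) (S - U)" using U(1) by (intro closedin_diff) auto
      then have K: "compact (S - U)" using compact_S by (rule closedin_compact[rotated])
      then have Kr: "emeasure riesz_measure (S - U) \<le> ?R"
        using U(2) by (intro SUP_upper) (auto simp: compactin_subtopology)
      have KS: "S - U \<in> sets riesz_measure" using compact_borel_sigma[OF Hausdorff_S K] sets_riesz by blast
      have Un: "(S - U) \<union> U = S" "B \<union> (S - B) = S" using openin_imp_subset[OF U(1)] BS by auto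
      have "emeasure riesz_measure B + emeasure riesz_measure (S - B) = emeasure riesz_measure S"
        using plus_emeasure[OF B Cb] Un(2) by simp
      also have "\<dots> \<le> emeasure riesz_measure (S - U) + emeasure riesz_measure U"
        using emeasure_subadditive[OF KS US] Un(1) by simp
      also have "\<dots> \<le> ?R + (outer (S - B) + ennreal \<epsilon>)"
        using Kr U(3) emeasure_riesz_open[OF U(1)] by (intro add_mono) simp_all
      also have "outer (S - B) = emeasure riesz_measure (S - B)" using emeasure_riesz[OF Cb] by simp
      finally have "emeasure riesz_measure (S - B) + emeasure riesz_measure B
          \<le> emeasure riesz_measure (S - B) + (?R + ennreal \<epsilon>)" by (simp add: ac_simps)
      then show "emeasure riesz_measure B \<le> ?R + ennreal \<epsilon>"
        by (simp add: ennreal_add_left_cancel_le emeasure_eq_measure)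
    qed
    show "?R \<le> emeasure riesz_measure B"
      by (rule SUP_least) (use B in \<open>auto intro: emeasure_mono\<close>)
  qed
  then show ?thesis
    unfolding regular_probability_def using sets_riesz prob_space_axioms by blast
qed

text \<open>
  The volume of an open set is defined by the functional alone, and composition with \<open>T\<close> maps competitors for
  \<open>U\<close> to competitors for the preimage of \<open>U\<close>. Open sets form an intersection-stable generator.
\<close>

lemma invariant_riesz:
  assumes T: "continuous_on S T" "T ` S \<subseteq> S" and T': "continuous_on S T'" "T' ` S \<subseteq> S"
    and inv: "\<And>x. x \<in> S \<Longrightarrow> T (T' x) = x" "\<And>x. x \<in> S \<Longrightarrow> T' (T x) = x"
    and IT: "\<And>f. continuous_on S f \<Longrightarrow> I (\<lambda>x. f (T x)) = I f"
  shows "distr riesz_measure riesz_measure T = riesz_measure"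
proof -
  have I_cong: "I f = I g" if "continuous_on S f" "continuous_on S g" "\<And>x. x \<in> S \<Longrightarrow> f x = g x" for f g
    using that by (intro antisym I_mono) simp_all
  have IT': "I (\<lambda>x. f (T' x)) = I f" if f: "continuous_on S f" for f
  proof -
    have c: "continuous_on S (\<lambda>x. f (T' x))"
      by (rule continuous_on_compose2[OF f T'])
    have "I (\<lambda>x. f (T' x)) = I (\<lambda>x. f (T' (T x)))" using IT[OF c] by simp
    also have "\<dots> = I f"
      using inv(2) f continuous_on_compose2[OF c T] by (intro I_cong) simp_all
    finally show ?thesis .
  qed
  have le: "vol U \<le> vol (S \<inter> Q -` U)"
    if Q: "continuous_on S Q" "Q ` S \<subseteq> S" "\<And>f. continuous_on S f \<Longrightarrow> I (\<lambda>x. f (Q x)) = I f" for Q U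
    unfolding vol_def[of U]
  proof (rule SUP_least)
    fix f assume f: "f \<in> below U"
    then have "continuous_on S f" by (simp add: below_def)
    moreover have "(\<lambda>x. f (Q x)) \<in> below (S \<inter> Q -` U)"
      unfolding below_def
    proof (intro CollectI conjI ballI)
      show "continuous_on S (\<lambda>x. f (Q x))" by (rule continuous_on_compose2[OF \<open>continuous_on S f\<close> Q(1,2)])
      fix x assume "x \<in> S"
      then have "Q x \<in> S" using Q(2) by blast
      then have "0 \<le> f (Q x) \<and> f (Q x) \<le> indicator U (Q x)" using f by (simp add: below_def)
      then show "0 \<le> f (Q x)" "f (Q x) \<le> indicator (S \<inter> Q -` U) x"
        using \<open>x \<in> S\<close> by (simp_all add: indicator_def)
    qed
    ultimately show "ennreal (I f) \<le> vol (S \<inter> Q -` U)" using below_le Q(3) by metis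
  qed
  have eq: "vol (S \<inter> T -` U) = vol U" if U: "openin (top_of_set S) U" for U
  proof (rule antisym)
    have "S \<inter> T' -` (S \<inter> T -` U) = U"
      using inv T'(2) openin_imp_subset[OF U] by (auto simp: image_subset_iff)
    then show "vol (S \<inter> T -` U) \<le> vol U" using le[OF T' IT', of "S \<inter> T -` U"] by simp
    show "vol U \<le> vol (S \<inter> T -` U)" by (rule le[OF T IT])
  qed
  have Tm: "T \<in> measurable riesz_measure riesz_measure"
    by (rule measurable_borel_sigma_self[OF T sets_riesz])
  have sub: "{U. openin (top_of_set S) U} \<subseteq> Pow S" using openin_imp_subset by blast
  show ?thesis
  proof (rule measure_eqI_generator_eq[where E = "{U. openin (top_of_set S) U}" and \<Omega> = S and A = "\<lambda>_. S"])
    show "Int_stable {U. openin (top_of_set S) U}" by (auto simp: Int_stable_def)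
    show "{U. openin (top_of_set S) U} \<subseteq> Pow S" by (rule sub)
    fix U assume "U \<in> {U. openin (top_of_set S) U}"
    then have U: "openin (top_of_set S) U" by simp
    then have "openin (top_of_set S) (S \<inter> T -` U)"
      using T by (intro continuous_openin_preimage[where T = S]) auto
    moreover have "U \<in> sets riesz_measure" using U openin_borel_sigma sets_riesz by blast
    moreover have "T -` U \<inter> space riesz_measure = S \<inter> T -` U" by (auto simp: space_riesz)
    ultimately show "emeasure (distr riesz_measure riesz_measure T) U = emeasure riesz_measure U"
      using Tm U eq by (simp add: emeasure_distr emeasure_riesz_open)
  next
    show "emeasure (distr riesz_measure riesz_measure T) S \<noteq> \<infinity>"
      using finite_measure.finite_emeasure_space[OF finite_measure.finite_measure_distr[OF finite_measure_riesz Tm]]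
      by (simp add: space_riesz)
  qed (auto simp: sets_riesz sets_borel_sigma)
qed

end

lemma continuous_in_L2:
  fixes g :: "'a::topological_space \<Rightarrow> complex"
  assumes "compact S" "prob_space m" "sets m = sets (borel_sigma (top_of_set S))" "continuous_on S g"
  shows "g \<in> L2 m"
proof -
  have sp: "space m = S" using sets_eq_imp_space_eq[OF assms(3)] by simp
  have "bounded (g ` S)" using compact_continuous_image[OF assms(4,1)] by (rule compact_imp_bounded)
  then obtain C where "\<And>x. x \<in> S \<Longrightarrow> norm (g x) \<le> C" unfolding bounded_iff by blast
  then have "AE x in m. cmod (g x) \<le> C" by (intro AE_I2) (simp add: sp)
  with continuous_borel_sigma[OF assms(4,3)] show ?thesis
    by (intro L2_bounded prob_space.finite_measure assms(2))
qed

text \<open>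
  A measurable function is a pointwise limit of simple functions that are dominated by a multiple of it.
\<close>

lemma L2_subset_span_indicators: "L2 m \<subseteq> closed_span_L2 m (indicator ` sets m)"
proof
  fix f assume fL: "f \<in> L2 m"
  then have [measurable]: "f \<in> borel_measurable m" by (rule L2_measurable)
  obtain F where F: "\<And>i. simple_function m (F i)" "\<And>x. x \<in> space m \<Longrightarrow> (\<lambda>i. F i x) \<longlonglongrightarrow> f x"
    "\<And>i x. x \<in> space m \<Longrightarrow> dist (F i x) 0 \<le> 2 * dist (f x) 0"
    using borel_measurable_implies_sequence_metric[OF \<open>f \<in> borel_measurable m\<close>, of 0] by blast
  have Fm [measurable]: "F i \<in> borel_measurable m" for i using F(1) by (rule borel_measurable_simple_function)
  have "(\<lambda>i. LINT x|m. (cmod (f x - F i x))\<^sup>2) \<longlonglongrightarrow> (LINT x|m. 0)"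
  proof (rule integral_dominated_convergence)
    show "integrable m (\<lambda>x. 9 * (cmod (f x))\<^sup>2)" using fL by (simp add: L2_def)
    show "AE x in m. (\<lambda>i. (cmod (f x - F i x))\<^sup>2) \<longlonglongrightarrow> 0"
    proof (rule AE_I2)
      fix x assume "x \<in> space m"
      then have "(\<lambda>i. (cmod (f x - F i x))\<^sup>2) \<longlonglongrightarrow> (cmod (f x - f x))\<^sup>2"
        by (intro tendsto_intros F(2))
      then show "(\<lambda>i. (cmod (f x - F i x))\<^sup>2) \<longlonglongrightarrow> 0" by simp
    qed
    show "AE x in m. norm ((cmod (f x - F i x))\<^sup>2) \<le> 9 * (cmod (f x))\<^sup>2" for i
    proof (rule AE_I2)
      fix x assume "x \<in> space m"
      then have "cmod (F i x) \<le> 2 * cmod (f x)" using F(3)[of x i] by simp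
      then have "cmod (f x - F i x) \<le> 3 * cmod (f x)"
        using norm_triangle_ineq4[of "f x" "F i x"] by linarith
      then have "(cmod (f x - F i x))\<^sup>2 \<le> (3 * cmod (f x))\<^sup>2" by (rule power_mono) simp
      then show "norm ((cmod (f x - F i x))\<^sup>2) \<le> 9 * (cmod (f x))\<^sup>2" by (simp add: power_mult_distrib)
    qed
  qed measurable
  then have "(\<lambda>i. norm_L2 m (\<lambda>x. f x - F i x)) \<longlonglongrightarrow> sqrt 0"
    unfolding norm_L2_def by (intro tendsto_real_sqrt) simp
  then have lim: "(\<lambda>i. norm_L2 m (\<lambda>x. f x - F i x)) \<longlonglongrightarrow> 0" by simp
  have "\<exists>g\<in>linear_combinations (indicator ` sets m). norm_L2 m (\<lambda>x. f x - g x) \<le> \<epsilon>" if eps: "\<epsilon> > 0" for \<epsilon>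
  proof -
    obtain i where i: "norm_L2 m (\<lambda>x. f x - F i x) < \<epsilon>"
      using order_tendstoD(2)[OF lim eps] eventually_happens'[OF sequentially_bot] by blast
    define g where "g x = (\<Sum>y\<in>F i ` space m. y * indicator (F i -` {y} \<inter> space m) x)" for x
    have fin: "finite (F i ` space m)" using F(1) by (rule simple_functionD)
    have "g \<in> linear_combinations (indicator ` sets m)"
      unfolding g_def
      by (intro linear_combinations_sum linear_combinations_mem imageI) (rule simple_functionD(2)[OF F(1)])
    moreover have "g x = F i x" if "x \<in> space m" for x
    proof -
      have "g x = (\<Sum>y\<in>F i ` space m. if y = F i x then y else 0)"
        unfolding g_def using that by (intro sum.cong) (auto simp: indicator_def)
      also have "\<dots> = F i x" using that fin by simp
      finally show ?thesis .
    qed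
    then have "norm_L2 m (\<lambda>x. f x - g x) = norm_L2 m (\<lambda>x. f x - F i x)"
      unfolding norm_L2_def by (intro arg_cong[where f = sqrt] Bochner_Integration.integral_cong) simp_all
    ultimately show ?thesis using i by (intro bexI[of _ g]) simp_all
  qed
  with fL show "f \<in> closed_span_L2 m (indicator ` sets m)" by (simp add: closed_span_L2_def)
qed

text \<open>
  An indicator function is approximated by an Urysohn function between a compact subset of \<open>B\<close> and the
  complement of a compact subset of \<open>S - B\<close>; both exist by inner regularity.
\<close>

lemma continuous_dense_L2:
  fixes S :: "'a::topological_space set"
  assumes S: "compact S" and haus: "Hausdorff_space (top_of_set S)" and m: "regular_probability (top_of_set S) m"
  shows "L2 m \<subseteq> closed_span_L2 m {g :: 'a \<Rightarrow> complex. continuous_on S g}"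
proof -
  have sets: "sets m = sets (borel_sigma (top_of_set S))" using m by (simp add: regular_probability_def)
  have inner: "emeasure m B = (SUP K\<in>{K. compactin (top_of_set S) K \<and> K \<subseteq> B}. emeasure m K)"
    if "B \<in> sets m" for B using m that by (simp add: regular_probability_def)
  interpret prob_space m using m by (simp add: regular_probability_def)
  have sp: "space m = S" using sets_eq_imp_space_eq[OF sets] by simp
  have CL: "{g. continuous_on S g} \<subseteq> L2 m" using continuous_in_L2[OF S prob_space_axioms sets] by blast
  have compact_approx: "\<exists>K. compact K \<and> K \<subseteq> B \<and> K \<in> sets m \<and> measure m (B - K) < \<delta>"
    if B: "B \<in> sets m" and \<delta>: "\<delta> > 0" for B \<delta>
  proof -
    have ne: "{K. compactin (top_of_set S) K \<and> K \<subseteq> B} \<noteq> {}" by (auto intro!: exI[of _ "{}"])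
    have "\<exists>K\<in>{K. compactin (top_of_set S) K \<and> K \<subseteq> B}. emeasure m B < emeasure m K + ennreal \<delta>"
      by (rule SUP_approx_ennreal[OF \<delta> ne inner[OF B]]) simp
    then obtain K where K: "compact K" "K \<subseteq> S" "K \<subseteq> B" "emeasure m B < emeasure m K + ennreal \<delta>"
      unfolding compactin_subtopology compactin_euclidean_iff by blast
    have KS: "K \<in> sets m" using compact_borel_sigma[OF haus K(1,2)] sets by simp
    have "measure m B < measure m K + \<delta>"
      using K(4) \<delta> by (simp add: emeasure_eq_measure ennreal_plus[symmetric] ennreal_less_iff del: ennreal_plus)
    then show ?thesis using K KS finite_measure_Diff[OF B KS K(3)] by (intro exI[of _ K]) simp
  qed
  have "indicator B \<in> closed_span_L2 m {g. continuous_on S g}" if B: "B \<in> sets m" for B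
  proof -
    have iL: "(indicator B :: 'a \<Rightarrow> complex) \<in> L2 m"
      using B by (intro L2_bounded[where C = 1]) (auto simp: finite_measure_axioms indicator_def)
    have "\<exists>g\<in>linear_combinations {g. continuous_on S g}. norm_L2 m (\<lambda>x. indicator B x - g x) \<le> \<epsilon>"
      if eps: "\<epsilon> > 0" for \<epsilon>
    proof -
      have d: "\<epsilon>\<^sup>2 / 2 > 0" using eps by simp
      have B': "S - B \<in> sets m" using sets.compl_sets[OF B] sp by simp
      obtain K where K: "compact K" "K \<subseteq> B" "K \<in> sets m" "measure m (B - K) < \<epsilon>\<^sup>2 / 2"
        using compact_approx[OF B d] by blast
      obtain L where L: "compact L" "L \<subseteq> S - B" "L \<in> sets m" "measure m ((S - B) - L) < \<epsilon>\<^sup>2 / 2"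
        using compact_approx[OF B' d] by blast
      have BS: "B \<subseteq> S" using sets.sets_into_space[OF B] sp by simp
      have "closedin (top_of_set S) L" using L(1,2) by (intro compact_closedin haus) auto
      then have op: "openin (top_of_set S) (S - L)" by (simp add: closedin_def)
      have "K \<subseteq> S" "K \<subseteq> S - L" using K(2) L(2) BS by auto
      from compact_Urysohn[OF S haus K(1) this(1) op this(2)]
      obtain g :: "'a \<Rightarrow> real" where g: "continuous_on S g" "\<And>x. 0 \<le> g x" "\<And>x. g x \<le> 1"
        "\<And>x. x \<in> K \<Longrightarrow> g x = 1" "\<And>x. x \<in> S \<Longrightarrow> x \<notin> S - L \<Longrightarrow> g x = 0" by blast
      let ?g = "\<lambda>x. complex_of_real (g x)"
      let ?D = "(B - K) \<union> ((S - B) - L)"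
      have gc: "continuous_on S ?g" using g(1) by (intro continuous_intros)
      have D: "?D \<in> sets m" using B B' K(3) L(3) by auto
      have pw: "(cmod (indicator B x - ?g x))\<^sup>2 \<le> indicator ?D x" if x: "x \<in> S" for x
      proof (cases "x \<in> ?D")
        case True
        have "indicator B x - ?g x = complex_of_real (indicator B x - g x)" by (simp add: indicator_def)
        then have "cmod (indicator B x - ?g x) = \<bar>indicator B x - g x\<bar>" by (simp only: norm_of_real)
        also have "\<dots> \<le> 1" using g(2,3)[of x] by (simp add: indicator_def)
        finally show ?thesis using True by (simp add: power_le_one)
      next
        case False
        then have "(x \<in> K \<and> x \<in> B) \<or> (x \<in> L \<and> x \<notin> B)" using x K(2) L(2) by blast
        then have "indicator B x = ?g x" using g(4,5)[of x] x by auto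
        then show ?thesis by simp
      qed
      have "(LINT x|m. (cmod (indicator B x - ?g x))\<^sup>2) \<le> (LINT x|m. indicator ?D x)"
      proof (rule integral_mono)
        show "integrable m (\<lambda>x. (cmod (indicator B x - ?g x))\<^sup>2)"
          using L2_diff[OF iL] CL gc by (intro L2_integrable) blast
        show "integrable m (\<lambda>x. indicator ?D x :: real)"
          using D by (intro integrable_real_indicator) (simp_all add: emeasure_eq_measure)
      qed (use pw sp in simp)
      also have "\<dots> = measure m ?D" using D by simp
      also have "\<dots> \<le> measure m (B - K) + measure m ((S - B) - L)"
        using B B' K(3) L(3) by (intro measure_Un_le) auto
      also have "\<dots> \<le> \<epsilon>\<^sup>2" using K(4) L(4) by simp
      finally have "norm_L2 m (\<lambda>x. indicator B x - ?g x) \<le> \<epsilon>"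
        using eps by (simp add: norm_L2_def real_le_lsqrt)
      then show ?thesis using gc by (intro bexI[of _ ?g] linear_combinations_mem) simp_all
    qed
    then show ?thesis using iL by (simp add: closed_span_L2_def)
  qed
  then have "indicator ` sets m \<subseteq> closed_span_L2 m {g. continuous_on S g}" by blast
  from closed_span_L2_trans[OF CL this] L2_subset_span_indicators[of m] show ?thesis by blast
qed

section \<open>Uniform boundedness of Radon functionals\<close>

text \<open>
  The gliding hump argument of Sokal, which avoids the Baire category theorem. A functional of norm at
  least \<open>4 ^ n\<close> is made large by a step of length \<open>3 ^ - (n + 1)\<close>; the later steps together are too short to undo
  this, so that at the limit point the functionals are unbounded.
\<close>

lemma uniform_boundedness_subspace:
  fixes V :: "'b::real_normed_vector set" and F :: "('b \<Rightarrow> complex) set"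
  assumes V: "subspace V" "\<And>x :: nat \<Rightarrow> 'b. (\<And>n. x n \<in> V) \<Longrightarrow> Cauchy x \<Longrightarrow> \<exists>X\<in>V. x \<longlonglongrightarrow> X"
    and add: "\<And>l x y. l \<in> F \<Longrightarrow> x \<in> V \<Longrightarrow> y \<in> V \<Longrightarrow> l (x + y) = l x + l y"
    and scale: "\<And>l r x. l \<in> F \<Longrightarrow> x \<in> V \<Longrightarrow> l (r *\<^sub>R x) = of_real r * l x"
    and bdd: "\<And>l. l \<in> F \<Longrightarrow> \<exists>C. \<forall>x\<in>V. cmod (l x) \<le> C * norm x"
    and pw: "\<And>x. x \<in> V \<Longrightarrow> \<exists>C. \<forall>l\<in>F. cmod (l x) \<le> C"
  shows "\<exists>C. \<forall>l\<in>F. \<forall>x\<in>V. cmod (l x) \<le> C * norm x"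
proof (rule ccontr)
  assume unb: "\<nexists>C. \<forall>l\<in>F. \<forall>x\<in>V. cmod (l x) \<le> C * norm x"
  define N where "N l = (SUP x\<in>{x\<in>V. norm x \<le> 1}. cmod (l x))" for l
  have V0: "0 \<in> V" using V(1) by (rule subspace_0)
  have bdd_above: "bdd_above ((\<lambda>x. cmod (l x)) ` {x\<in>V. norm x \<le> 1})" if l: "l \<in> F" for l
  proof -
    obtain C where C: "\<And>x. x \<in> V \<Longrightarrow> cmod (l x) \<le> C * norm x" using bdd[OF l] by blast
    have "cmod (l x) \<le> \<bar>C\<bar>" if "x \<in> V" "norm x \<le> 1" for x
    proof -
      have "cmod (l x) \<le> C * norm x" by (rule C[OF that(1)])
      also have "\<dots> \<le> \<bar>C\<bar> * norm x" by (intro mult_right_mono) simp_all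
      also have "\<dots> \<le> \<bar>C\<bar> * 1" using that(2) by (intro mult_left_mono) simp_all
      finally show ?thesis by simp
    qed
    then show ?thesis by (intro bdd_aboveI[where M = "\<bar>C\<bar>"]) auto
  qed
  have N_ge: "cmod (l x) \<le> N l * norm x" if l: "l \<in> F" and x: "x \<in> V" for l x
  proof (cases "x = 0")
    case True
    then show ?thesis using scale[OF l V0, of 0] by simp
  next
    case False
    have "(1 / norm x) *\<^sub>R x \<in> {x\<in>V. norm x \<le> 1}"
      using False V(1) x by (simp add: subspace_scale)
    then have "cmod (l ((1 / norm x) *\<^sub>R x)) \<le> N l"
      unfolding N_def by (rule cSUP_upper[OF _ bdd_above[OF l]])
    moreover have "cmod (l ((1 / norm x) *\<^sub>R x)) = cmod (l x) / norm x"
      using scale[OF l x, of "1 / norm x"] by (simp add: norm_mult norm_divide)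
    ultimately show ?thesis using False by (simp add: pos_divide_le_eq)
  qed
  have "\<exists>l\<in>F. N l > 4 ^ n" for n
  proof (rule ccontr)
    assume "\<not> (\<exists>l\<in>F. N l > 4 ^ n)"
    then have N_le: "N l \<le> 4 ^ n" if "l \<in> F" for l using that by force
    have "cmod (l x) \<le> 4 ^ n * norm x" if "l \<in> F" "x \<in> V" for l x
      using N_ge[OF that] mult_right_mono[OF N_le[OF that(1)] norm_ge_zero[of x]] by linarith
    with unb show False by blast
  qed
  then obtain l where l: "\<And>n. l n \<in> F" "\<And>n. N (l n) > 4 ^ n" by metis
  have "\<exists>u\<in>{x\<in>V. norm x \<le> 1}. 3 / 4 * N (l n) < cmod (l n u)" for n
  proof -
    have "(0::real) < 4 ^ n" by simp
    then have "3 / 4 * N (l n) < N (l n)" using l(2)[of n] by linarith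
    moreover have "{x \<in> V. norm x \<le> 1} \<noteq> {}" using V0 by auto
    ultimately show ?thesis
      using less_cSUP_iff[of "{x \<in> V. norm x \<le> 1}" "\<lambda>x. cmod (l n x)", OF _ bdd_above[OF l(1)]]
      unfolding N_def by blast
  qed
  then obtain u where u: "\<And>n. u n \<in> V" "\<And>n. norm (u n) \<le> 1" "\<And>n. 3 / 4 * N (l n) < cmod (l n (u n))"
    by (metis (mono_tags, lifting) mem_Collect_eq)
  define r :: "nat \<Rightarrow> real" where "r n = (1 / 3) ^ Suc n" for n
  have r: "r n > 0" for n by (simp add: r_def)
  \<comment> \<open>the step in direction \<open>u n\<close> or \<open>- u n\<close>, whichever makes the functional larger\<close>
  define d where "d n y = (if cmod (l n (y + r n *\<^sub>R u n)) \<ge> cmod (l n (y + (- r n) *\<^sub>R u n))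
      then r n *\<^sub>R u n else (- r n) *\<^sub>R u n)" for n y
  have dV: "d n y \<in> V" for n y unfolding d_def using V(1) u(1) by (simp add: subspace_scale subspace_neg)
  have dn: "norm (d n y) \<le> r n" for n y
    using u(2)[of n] r[of n] by (simp add: d_def mult_left_le)
  \<comment> \<open>one of the two steps keeps the functional large\<close>
  have d_large: "r n * (3 / 4 * N (l n)) \<le> cmod (l n (y + d n y))" if y: "y \<in> V" for n y
  proof -
    let ?p = "l n (y + r n *\<^sub>R u n)" and ?q = "l n (y + (- r n) *\<^sub>R u n)"
    have "?p = l n y + of_real (r n) * l n (u n)"
      using add[OF l(1) y subspace_scale[OF V(1) u(1)]] scale[OF l(1) u(1)] by simp
    moreover have "?q = l n y + of_real (- r n) * l n (u n)"
      using add[OF l(1) y subspace_scale[OF V(1) u(1)], of n "- r n" n] scale[OF l(1) u(1), of n "- r n" n] by simp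
    ultimately have "?p - ?q = 2 * (of_real (r n) * l n (u n))" by (simp add: algebra_simps)
    then have "2 * (r n * cmod (l n (u n))) = cmod (?p - ?q)"
      using r[of n] by (simp add: norm_mult)
    also have "\<dots> \<le> cmod ?p + cmod ?q" by (rule norm_triangle_ineq4)
    finally have "r n * cmod (l n (u n)) \<le> max (cmod ?p) (cmod ?q)" by (simp add: max_def)
    moreover have "max (cmod ?p) (cmod ?q) = cmod (l n (y + d n y))" by (simp add: d_def max_def)
    moreover have "r n * (3 / 4 * N (l n)) \<le> r n * cmod (l n (u n))"
      using r[of n] u(3)[of n] by (intro mult_left_mono) simp_all
    ultimately show ?thesis by linarith
  qed
  define x where "x = rec_nat 0 (\<lambda>n y. y + d n y)"
  have x0: "x 0 = 0" and xS: "x (Suc n) = x n + d n (x n)" for n by (simp_all add: x_def)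
  have xV: "x n \<in> V" for n by (induction n) (simp_all add: x0 xS V0 subspace_add[OF V(1)] dV)
  have step: "norm (x (Suc n + j) - x (Suc n)) \<le> r n / 2 * (1 - (1 / 3) ^ j)" for n j
  proof (induction j)
    case (Suc j)
    have "norm (x (Suc n + Suc j) - x (Suc n))
        \<le> norm (x (Suc n + j) - x (Suc n)) + norm (d (Suc n + j) (x (Suc n + j)))"
      using norm_triangle_ineq[of "x (Suc n + j) - x (Suc n)" "d (Suc n + j) (x (Suc n + j))"]
      by (simp add: xS algebra_simps)
    also have "\<dots> \<le> r n / 2 * (1 - (1 / 3) ^ j) + r (Suc n + j)"
      using Suc dn by (rule add_mono)
    also have "r (Suc n + j) = r n * ((1 / 3) * (1 / 3) ^ j)"
      by (simp add: r_def power_add)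
    finally show ?case by (simp add: algebra_simps)
  qed simp
  have tail': "norm (x (Suc n + j) - x (Suc n)) \<le> r n / 2" for n j
  proof -
    have "r n / 2 * (1 - (1 / 3) ^ j) \<le> r n / 2 * 1" using r[of n] by (intro mult_left_mono) simp_all
    then show ?thesis using step[of n j] by linarith
  qed
  have rlim: "r \<longlonglongrightarrow> 0" unfolding r_def by (rule LIMSEQ_Suc[OF LIMSEQ_power_zero]) simp
  have "Cauchy x"
  proof (rule CauchyI)
    fix e :: real assume "0 < e"
    then obtain n where n: "r n < e"
      using order_tendstoD(2)[OF rlim] eventually_happens'[OF sequentially_bot] by blast
    have "norm (x i - x k) < e" if ik: "Suc n \<le> i" "Suc n \<le> k" for i k
    proof -
      obtain a where a: "i = Suc n + a" using le_Suc_ex[OF ik(1)] by blast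
      obtain b where b: "k = Suc n + b" using le_Suc_ex[OF ik(2)] by blast
      have "norm (x i - x (Suc n)) \<le> r n / 2" "norm (x k - x (Suc n)) \<le> r n / 2"
        unfolding a b by (rule tail')+
      then show ?thesis using norm_triangle_ineq4[of "x i - x (Suc n)" "x k - x (Suc n)"] n by simp
    qed
    then show "\<exists>M. \<forall>m\<ge>M. \<forall>n\<ge>M. norm (x m - x n) < e" by blast
  qed
  then obtain X where XV: "X \<in> V" and xlim: "x \<longlonglongrightarrow> X"
    using V(2)[of x, OF xV] by blast
  have tail: "norm (X - x (Suc n)) \<le> r n / 2" for n
  proof (rule LIMSEQ_le_const2)
    show "(\<lambda>j. norm (x (j + Suc n) - x (Suc n))) \<longlonglongrightarrow> norm (X - x (Suc n))"
      by (intro tendsto_norm tendsto_diff tendsto_const LIMSEQ_ignore_initial_segment xlim)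
    show "\<exists>N. \<forall>j\<ge>N. norm (x (j + Suc n) - x (Suc n)) \<le> r n / 2"
      using tail'[of n] by (simp add: add.commute)
  qed
  have large: "(4 / 3) ^ n / 12 \<le> cmod (l n (X))" for n
  proof -
    let ?z = "X - x (Suc n)"
    have zV: "?z \<in> V" using XV xV by (intro subspace_diff[OF V(1)])
    have "l n (X) = l n (x (Suc n)) + l n ?z"
      using add[OF l(1) xV[of "Suc n"] zV, of n] by simp
    then have "cmod (l n (X)) \<ge> cmod (l n (x (Suc n))) - cmod (l n ?z)"
      by (metis norm_diff_ineq)
    moreover have "cmod (l n (x (Suc n))) \<ge> r n * (3 / 4 * N (l n))"
      using d_large[OF xV[of n]] by (simp add: xS)
    moreover have "cmod (l n ?z) \<le> N (l n) * (r n / 2)"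
    proof -
      have "(0::real) < 4 ^ n" by simp
      then have "0 \<le> N (l n)" using l(2)[of n] by linarith
      then show ?thesis using N_ge[OF l(1) zV] tail[of n] by (meson mult_left_mono order_trans)
    qed
    ultimately have "r n * N (l n) / 4 \<le> cmod (l n (X))" by (simp add: algebra_simps)
    moreover have "r n * 4 ^ n \<le> r n * N (l n)" using r[of n] l(2)[of n] by (intro mult_left_mono) simp_all
    moreover have "r n * 4 ^ n = (4 / 3) ^ n / 3" by (simp add: r_def power_divide)
    ultimately show ?thesis by linarith
  qed
  obtain C where C: "\<And>n. cmod (l n (X)) \<le> C" using pw[OF XV] l(1) by blast
  obtain n where "12 * C < (4 / 3) ^ n" using real_arch_pow[of "4 / 3" "12 * C"] by auto
  then show False using large[of n] C[of n] by linarith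
qed

lemma Cc_continuous: "\<phi> \<in> Cc \<Longrightarrow> continuous_on UNIV \<phi>"
  by (simp add: Cc_def)

lemma Cc_zero_outside: "\<phi> \<in> Cc \<Longrightarrow> x \<notin> closure {x. \<phi> x \<noteq> 0} \<Longrightarrow> \<phi> x = 0"
  by (meson closure_subset mem_Collect_eq subsetD)

lemma CcI:
  fixes \<phi> :: "'g::t2_space \<Rightarrow> complex"
  assumes "continuous_on UNIV \<phi>" "compact K" "\<And>x. x \<notin> K \<Longrightarrow> \<phi> x = 0"
  shows "\<phi> \<in> Cc" "closure {x. \<phi> x \<noteq> 0} \<subseteq> K"
proof -
  show sub: "closure {x. \<phi> x \<noteq> 0} \<subseteq> K"
    using assms(3) compact_imp_closed[OF assms(2)] by (intro closure_minimal) auto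
  have "compact (K \<inter> closure {x. \<phi> x \<noteq> 0})" by (intro compact_Int_closed assms(2) closed_closure)
  moreover have "K \<inter> closure {x. \<phi> x \<noteq> 0} = closure {x. \<phi> x \<noteq> 0}" using sub by blast
  ultimately show "\<phi> \<in> Cc" using assms(1) by (simp add: Cc_def)
qed

lemma Cc_bounded:
  assumes "\<phi> \<in> Cc"
  obtains B where "0 \<le> B" "\<And>x. cmod (\<phi> x) \<le> B"
proof -
  have "compact (\<phi> ` closure {x. \<phi> x \<noteq> 0})"
    using assms by (intro compact_continuous_image) (auto simp: Cc_def intro: continuous_on_subset)
  then have "bounded (\<phi> ` closure {x. \<phi> x \<noteq> 0})" by (rule compact_imp_bounded)
  then obtain B where B: "\<And>x. x \<in> closure {x. \<phi> x \<noteq> 0} \<Longrightarrow> cmod (\<phi> x) \<le> B" "B > 0"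
    unfolding bounded_pos by auto
  have "cmod (\<phi> x) \<le> B" for x
  proof (cases "x \<in> closure {x. \<phi> x \<noteq> 0}")
    case False
    then show ?thesis using Cc_zero_outside[OF assms False] B(2) by simp
  qed (rule B(1))
  with B(2) show ?thesis by (intro that[of B]) auto
qed

lemma radon_add: "\<nu> \<in> radon_measures \<Longrightarrow> \<phi> \<in> Cc \<Longrightarrow> \<psi> \<in> Cc \<Longrightarrow> \<nu> (\<lambda>x. \<phi> x + \<psi> x) = \<nu> \<phi> + \<nu> \<psi>"
  by (simp add: radon_measures_def)

lemma radon_scale: "\<nu> \<in> radon_measures \<Longrightarrow> \<phi> \<in> Cc \<Longrightarrow> \<nu> (\<lambda>x. c * \<phi> x) = c * \<nu> \<phi>"
  by (simp add: radon_measures_def)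

lemma radon_bound:
  fixes \<nu> :: "('g::t2_space \<Rightarrow> complex) \<Rightarrow> complex"
  assumes "\<nu> \<in> radon_measures" "compact K"
  obtains C where "0 \<le> C" "\<And>\<phi> B. continuous_on UNIV \<phi> \<Longrightarrow> (\<And>x. x \<notin> K \<Longrightarrow> \<phi> x = 0) \<Longrightarrow>
      (\<And>x. cmod (\<phi> x) \<le> B) \<Longrightarrow> cmod (\<nu> \<phi>) \<le> C * B"
proof -
  obtain C where C: "\<And>\<phi>. \<phi> \<in> Cc \<Longrightarrow> closure {x. \<phi> x \<noteq> 0} \<subseteq> K \<Longrightarrow> cmod (\<nu> \<phi>) \<le> C * (SUP x. cmod (\<phi> x))"
  proof -
    have "\<forall>K. compact K \<longrightarrow> (\<exists>C. \<forall>\<phi>\<in>Cc. closure {x. \<phi> x \<noteq> 0} \<subseteq> K \<longrightarrow>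
        cmod (\<nu> \<phi>) \<le> C * (SUP x. cmod (\<phi> x)))"
      using assms(1) unfolding radon_measures_def mem_Collect_eq by (elim conjE)
    then obtain C where "\<forall>\<phi>\<in>Cc. closure {x. \<phi> x \<noteq> 0} \<subseteq> K \<longrightarrow> cmod (\<nu> \<phi>) \<le> C * (SUP x. cmod (\<phi> x))"
      using assms(2) by meson
    then show thesis by (intro that[of C]) simp
  qed
  show ?thesis
  proof (rule that[of "\<bar>C\<bar>"])
    fix \<phi> :: "'g \<Rightarrow> complex" and B
    assume \<phi>: "continuous_on UNIV \<phi>" "\<And>x. x \<notin> K \<Longrightarrow> \<phi> x = 0" "\<And>x. cmod (\<phi> x) \<le> B"
    have "cmod (\<nu> \<phi>) \<le> C * (SUP x. cmod (\<phi> x))" by (intro C CcI[OF \<phi>(1) assms(2) \<phi>(2)])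
    also have "\<dots> \<le> \<bar>C\<bar> * (SUP x. cmod (\<phi> x))"
    proof (rule mult_right_mono)
      have "cmod (\<phi> undefined) \<le> (SUP x. cmod (\<phi> x))"
        using \<phi>(3) by (intro cSUP_upper bdd_aboveI[where M = B]) auto
      then show "0 \<le> (SUP x. cmod (\<phi> x))" by (rule order_trans[OF norm_ge_zero])
    qed simp
    also have "\<dots> \<le> \<bar>C\<bar> * B" using \<phi>(3) by (intro mult_left_mono cSUP_least) auto
    finally show "cmod (\<nu> \<phi>) \<le> \<bar>C\<bar> * B" .
  qed simp
qed

lemma radon_diff:
  assumes "\<nu> \<in> radon_measures" "\<phi> \<in> Cc" "\<psi> \<in> Cc" "(\<lambda>x. (-1) * \<psi> x) \<in> Cc"
  shows "\<nu> (\<lambda>x. \<phi> x - \<psi> x) = \<nu> \<phi> - \<nu> \<psi>"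
  using radon_add[OF assms(1,2,4)] radon_scale[OF assms(1,3), of "-1"] by simp

text \<open>
  The continuous functions supported in \<open>K\<close> form a complete subspace of the bounded continuous functions,
  to which the uniform boundedness principle applies.
\<close>

lemma radon_uniform_bound:
  fixes F :: "(('g::t2_space \<Rightarrow> complex) \<Rightarrow> complex) set"
  assumes F: "F \<subseteq> radon_measures" and K: "compact K"
    and pw: "\<And>\<phi>. \<phi> \<in> Cc \<Longrightarrow> \<exists>C. \<forall>\<nu>\<in>F. cmod (\<nu> \<phi>) \<le> C"
  shows "\<exists>C. \<forall>\<nu>\<in>F. \<forall>\<phi>\<in>Cc. closure {x. \<phi> x \<noteq> 0} \<subseteq> K \<longrightarrow> cmod (\<nu> \<phi>) \<le> C * (SUP x. cmod (\<phi> x))"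
proof -
  define V where "V = PiC UNIV (\<lambda>x. if x \<in> K then UNIV else {0::complex})"
  define G where "G = (\<lambda>\<nu> f. \<nu> (apply_bcontfun f)) ` F"
  have memV: "f \<in> V \<longleftrightarrow> (\<forall>x. x \<notin> K \<longrightarrow> apply_bcontfun f x = 0)" for f :: "'g \<Rightarrow>\<^sub>C complex"
    unfolding V_def mem_PiC_iff by (simp add: Pi_iff)
  have cV: "\<exists>X\<in>V. f \<longlonglongrightarrow> X" if f: "\<And>n. f n \<in> V" "Cauchy f" for f :: "nat \<Rightarrow> 'g \<Rightarrow>\<^sub>C complex"
  proof -
    from f(2) obtain g where g: "uniform_limit UNIV f g sequentially"
      using uniformly_convergent_eq_cauchy[of "\<lambda>_. True" f]
      unfolding Cauchy_def uniform_limit_sequentially_iff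
      by (metis dist_fun_lt_imp_dist_val_lt)
    from uniform_limit_bcontfunE[OF g sequentially_bot]
    obtain h where h: "g = apply_bcontfun h" "f \<longlonglongrightarrow> h" by metis
    have "apply_bcontfun h x = 0" if "x \<notin> K" for x
    proof -
      have "(\<lambda>n. f n x) \<longlonglongrightarrow> h x" using tendsto_uniform_limitI[OF g] h(1) by simp
      moreover have "(\<lambda>n. f n x) = (\<lambda>n. 0)" using f(1) that memV by blast
      ultimately show ?thesis by (simp add: LIMSEQ_const_iff)
    qed
    then show ?thesis using h(2) memV by blast
  qed
  have sV: "subspace V"
    by (intro subspaceI) (simp_all add: memV plus_bcontfun.rep_eq scaleR_bcontfun.rep_eq zero_bcontfun.rep_eq)
  have VC: "apply_bcontfun f \<in> Cc" if "f \<in> V" for f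
    using that K by (intro CcI(1)[of _ K]) (simp_all add: memV)
  have "\<exists>C. \<forall>l\<in>G. \<forall>f\<in>V. cmod (l f) \<le> C * norm f"
  proof (rule uniform_boundedness_subspace[OF sV cV])
    fix l and f g :: "'g \<Rightarrow>\<^sub>C complex" assume l: "l \<in> G" and fg: "f \<in> V" "g \<in> V"
    from l obtain \<nu> where \<nu>: "\<nu> \<in> F" "l = (\<lambda>f. \<nu> (apply_bcontfun f))" unfolding G_def by (rule imageE)
    show "l (f + g) = l f + l g"
      unfolding \<nu>(2) plus_bcontfun.rep_eq using F \<nu>(1) by (intro radon_add VC fg) (rule subsetD)
  next
    fix l and r :: real and f :: "'g \<Rightarrow>\<^sub>C complex" assume l: "l \<in> G" and f: "f \<in> V"
    from l obtain \<nu> where \<nu>: "\<nu> \<in> F" "l = (\<lambda>f. \<nu> (apply_bcontfun f))" unfolding G_def by (rule imageE)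
    show "l (r *\<^sub>R f) = of_real r * l f"
      unfolding \<nu>(2) scaleR_bcontfun.rep_eq scaleR_conv_of_real
      using F \<nu>(1) by (intro radon_scale VC f) (rule subsetD)
  next
    fix l assume "l \<in> G"
    then obtain \<nu> where \<nu>: "\<nu> \<in> F" "l = (\<lambda>f. \<nu> (apply_bcontfun f))" by (auto simp: G_def)
    then have "\<nu> \<in> radon_measures" using F by blast
    from radon_bound[OF this K] obtain C where C: "\<And>\<phi> B. continuous_on UNIV \<phi> \<Longrightarrow> (\<And>x. x \<notin> K \<Longrightarrow> \<phi> x = 0) \<Longrightarrow>
      (\<And>x. cmod (\<phi> x) \<le> B) \<Longrightarrow> cmod (\<nu> \<phi>) \<le> C * B" by metis
    have "cmod (l f) \<le> C * norm f" if "f \<in> V" for f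
      unfolding \<nu>(2) using that by (intro C norm_bounded) (simp_all add: memV)
    then show "\<exists>C. \<forall>f\<in>V. cmod (l f) \<le> C * norm f" by blast
  next
    fix f :: "'g \<Rightarrow>\<^sub>C complex" assume "f \<in> V"
    then show "\<exists>C. \<forall>l\<in>G. cmod (l f) \<le> C" using pw[OF VC] by (auto simp: G_def)
  qed
  then obtain C where C: "\<And>\<nu> f. \<nu> \<in> F \<Longrightarrow> f \<in> V \<Longrightarrow> cmod (\<nu> (apply_bcontfun f)) \<le> C * norm f"
    by (auto simp: G_def)
  have "cmod (\<nu> \<phi>) \<le> \<bar>C\<bar> * (SUP x. cmod (\<phi> x))"
    if \<nu>: "\<nu> \<in> F" and \<phi>: "\<phi> \<in> Cc" "closure {x. \<phi> x \<noteq> 0} \<subseteq> K" for \<nu> \<phi>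
  proof -
    obtain B where B: "\<And>x. cmod (\<phi> x) \<le> B" using Cc_bounded[OF \<phi>(1)] by metis
    have bc: "\<phi> \<in> bcontfun" using Cc_continuous[OF \<phi>(1)] B by (rule bcontfun_normI)
    define f where "f = Bcontfun \<phi>"
    have f: "apply_bcontfun f = \<phi>" unfolding f_def by (rule Bcontfun_inverse[OF bc])
    have "f \<in> V" unfolding memV f using Cc_zero_outside[OF \<phi>(1)] \<phi>(2) by blast
    then have "cmod (\<nu> \<phi>) \<le> C * norm f" using C[OF \<nu>] f by metis
    also have "\<dots> \<le> \<bar>C\<bar> * norm f" by (intro mult_right_mono) simp_all
    also have "\<dots> \<le> \<bar>C\<bar> * (SUP x. cmod (\<phi> x))"
    proof (intro mult_left_mono norm_bound)
      fix x
      show "norm (apply_bcontfun f x) \<le> (SUP x. cmod (\<phi> x))"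
        unfolding f using B by (intro cSUP_upper bdd_aboveI[where M = B]) auto
    qed simp
    finally show ?thesis .
  qed
  then show ?thesis by blast
qed

section \<open>The hull as a compact subset of a function space\<close>

text \<open>
  Functions on \<open>I\<close>, coded as functions with a fixed value outside \<open>I\<close>, form a subspace of the full product:
  both topologies are determined by continuity of the coordinates in \<open>I\<close>. So the vague topology is a subspace
  topology of the function type, and the theory of topological type classes is available.
\<close>

lemma product_topology_extensional:
  "product_topology (\<lambda>_. euclidean) I = top_of_set (extensional I :: ('i \<Rightarrow> 'b::topological_space) set)"
    (is "?P = ?E")
proof -
  have tsP: "topspace ?P = extensional I" by (auto simp: PiE_def)
  have 1: "continuous_map ?P ?E (\<lambda>x. x)"
  proof -
    have "continuous_map ?P (product_topology (\<lambda>_. euclidean) UNIV) (\<lambda>x. x)"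
    proof (subst continuous_map_componentwise_UNIV, rule allI)
      fix k
      show "continuous_map ?P euclidean (\<lambda>x. x k)"
      proof (cases "k \<in> I")
        case True
        then show ?thesis by (rule continuous_map_product_projection)
      next
        case False
        have "continuous_map ?P (euclidean :: 'b topology) (\<lambda>x. undefined)" by simp
        moreover have "undefined = x k" if "x \<in> topspace ?P" for x
          using that False unfolding tsP by (rule extensional_arb[symmetric])
        ultimately show ?thesis by (rule continuous_map_eq)
      qed
    qed
    then have "continuous_map ?P euclidean (\<lambda>x. x)" by (simp only: euclidean_product_topology)
    then show ?thesis unfolding continuous_map_in_subtopology using tsP by simp
  qed
  have 2: "continuous_map ?E ?P (\<lambda>x. x)"
    unfolding continuous_map_componentwise
  proof (intro conjI ballI)
    show "(\<lambda>x. x) ` topspace ?E \<subseteq> extensional I" by simp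
    fix k
    show "continuous_map ?E euclidean (\<lambda>x. x k)"
      unfolding continuous_map_iff_continuous
      by (rule continuous_on_subset[OF continuous_on_product_coordinates subset_UNIV])
  qed
  show ?thesis
  proof (rule topology_eq[THEN iffD2], intro allI iffI)
    fix U assume U: "openin ?P U"
    then have "openin ?E {x \<in> topspace ?E. x \<in> U}" using 2 by (rule openin_continuous_map_preimage[rotated])
    moreover have "{x \<in> topspace ?E. x \<in> U} = U" using openin_subset[OF U] tsP by auto
    ultimately show "openin ?E U" by simp
  next
    fix U assume U: "openin ?E U"
    then have "openin ?P {x \<in> topspace ?P. x \<in> U}" using 1 by (rule openin_continuous_map_preimage[rotated])
    moreover have "{x \<in> topspace ?P. x \<in> U} = U" using openin_subset[OF U] tsP by auto
    ultimately show "openin ?P U" by simp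
  qed
qed

lemma vague_topology_top_of_set:
  "vague_topology = top_of_set (radon_measures :: (('g::topological_space \<Rightarrow> complex) \<Rightarrow> complex) set)"
proof -
  have "radon_measures \<subseteq> (extensional Cc :: (('g::topological_space \<Rightarrow> complex) \<Rightarrow> complex) set)"
    unfolding radon_measures_def by blast
  then show ?thesis
    unfolding vague_topology_def product_topology_extensional subtopology_subtopology
    by (simp only: Int_absorb1)
qed

lemma Hausdorff_space_fun:
  "Hausdorff_space (top_of_set (S :: ('i \<Rightarrow> 'b::t2_space) set))"
proof (rule Hausdorff_space_subtopology)
  have "Hausdorff_space (euclidean :: 'b topology)"
    unfolding Hausdorff_space_def using hausdorff by (auto simp: disjnt_def)
  then have "Hausdorff_space (product_topology (\<lambda>_::'i. euclidean :: 'b topology) UNIV)"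
    by (simp add: Hausdorff_space_product_topology)
  then show "Hausdorff_space (euclidean :: ('i \<Rightarrow> 'b) topology)" by (simp only: euclidean_product_topology)
qed

lemma continuous_shift: "continuous_on UNIV (\<phi> :: 'g::topological_ab_group_add \<Rightarrow> complex) \<Longrightarrow> continuous_on UNIV (\<lambda>s. \<phi> (s + t))"
  by (rule continuous_on_compose2[of UNIV \<phi>]) (auto intro!: continuous_intros)

lemma compact_minus_set:
  fixes K :: "'g::topological_ab_group_add set"
  assumes "compact K" "compact L"
  shows "compact ((\<lambda>(k, l). k - l) ` (K \<times> L))"
  using assms by (intro compact_continuous_image compact_Times)
    (auto intro!: continuous_intros simp: split_beta)

lemma Cc_shift:
  fixes \<phi> :: "'g::{topological_ab_group_add, t2_space} \<Rightarrow> complex"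
  assumes "\<phi> \<in> Cc"
  shows "(\<lambda>s. \<phi> (s + t)) \<in> Cc"
proof (rule CcI(1)[OF continuous_shift[OF Cc_continuous[OF assms]]])
  let ?S = "closure {x. \<phi> x \<noteq> 0}"
  have "compact ?S" using assms by (simp add: Cc_def)
  then show "compact ((\<lambda>(k, l). k - l) ` (?S \<times> {t}))" by (intro compact_minus_set) simp_all
  fix x assume "x \<notin> (\<lambda>(k, l). k - l) ` (?S \<times> {t})"
  then have "x + t \<notin> ?S" by force
  then show "\<phi> (x + t) = 0" by (rule Cc_zero_outside[OF assms])
qed

lemma Cc_reflect:
  fixes \<phi> :: "'g::{topological_ab_group_add, t2_space} \<Rightarrow> complex"
  assumes "\<phi> \<in> Cc"
  shows "(\<lambda>s. \<phi> (- s)) \<in> Cc"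
proof (rule CcI(1))
  let ?S = "closure {x. \<phi> x \<noteq> 0}"
  show "continuous_on UNIV (\<lambda>s. \<phi> (- s))"
    by (rule continuous_on_compose2[OF Cc_continuous[OF assms]]) (auto intro!: continuous_intros)
  have "compact ?S" using assms by (simp add: Cc_def)
  then show "compact (uminus ` ?S)" by (intro compact_continuous_image) (auto intro!: continuous_intros)
  fix x assume "x \<notin> uminus ` ?S"
  then have "- x \<notin> ?S" by force
  then show "\<phi> (- x) = 0" by (rule Cc_zero_outside[OF assms])
qed

lemma translate_apply: "\<phi> \<in> Cc \<Longrightarrow> translate t \<nu> \<phi> = \<nu> (\<lambda>s. \<phi> (s + t))"
  by (simp add: translate_def)

lemma translate_translate:
  fixes \<nu> :: "('g::{topological_ab_group_add, t2_space} \<Rightarrow> complex) \<Rightarrow> complex"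
  shows "translate s (translate t \<nu>) = translate (s + t) \<nu>"
proof
  fix \<phi> :: "'g \<Rightarrow> complex"
  show "translate s (translate t \<nu>) \<phi> = translate (s + t) \<nu> \<phi>"
  proof (cases "\<phi> \<in> Cc")
    case True
    have "translate s (translate t \<nu>) \<phi> = \<nu> (\<lambda>r. \<phi> ((r + t) + s))"
      by (simp only: translate_apply[OF True] translate_apply[OF Cc_shift[OF True]])
    then show ?thesis by (simp add: translate_apply[OF True] add.assoc add.commute[of s t])
  qed (simp add: translate_def)
qed

lemma translate_0:
  fixes \<nu> :: "('g::{topological_ab_group_add, t2_space} \<Rightarrow> complex) \<Rightarrow> complex"
  assumes "\<nu> \<in> extensional Cc"
  shows "translate 0 \<nu> = \<nu>"
proof
  fix \<phi>
  show "translate 0 \<nu> \<phi> = \<nu> \<phi>"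
    using extensional_arb[OF assms, of \<phi>] by (cases "\<phi> \<in> Cc") (simp_all add: translate_def)
qed

lemma continuous_translate:
  fixes t :: "'g::{topological_ab_group_add, t2_space}"
  shows "continuous_on UNIV (translate t :: (('g \<Rightarrow> complex) \<Rightarrow> complex) \<Rightarrow> _)"
proof (rule continuous_on_coordinatewise_then_product)
  fix \<phi> :: "'g \<Rightarrow> complex"
  show "continuous_on UNIV (\<lambda>\<nu>. translate t \<nu> \<phi>)"
    by (cases "\<phi> \<in> Cc") (simp_all add: translate_def continuous_on_product_coordinates)
qed

lemma radon_translate:
  fixes \<nu> :: "('g::{topological_ab_group_add, t2_space} \<Rightarrow> complex) \<Rightarrow> complex"
  assumes \<nu>: "\<nu> \<in> radon_measures"
  shows "translate t \<nu> \<in> radon_measures"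
  unfolding radon_measures_def mem_Collect_eq
proof (intro conjI allI ballI impI)
  show "translate t \<nu> \<in> extensional Cc" by (simp add: translate_def)
next
  fix \<phi> \<psi> :: "'g \<Rightarrow> complex" assume c: "\<phi> \<in> Cc" "\<psi> \<in> Cc"
  have "(\<lambda>x. \<phi> x + \<psi> x) \<in> Cc"
  proof (rule CcI(1))
    show "continuous_on UNIV (\<lambda>x. \<phi> x + \<psi> x)" using c by (intro continuous_intros Cc_continuous)
    show "compact (closure {x. \<phi> x \<noteq> 0} \<union> closure {x. \<psi> x \<noteq> 0})" using c by (intro compact_Un) (simp_all add: Cc_def)
    fix x assume "x \<notin> closure {x. \<phi> x \<noteq> 0} \<union> closure {x. \<psi> x \<noteq> 0}"
    then have "\<phi> x = 0" "\<psi> x = 0" using Cc_zero_outside[OF c(1), of x] Cc_zero_outside[OF c(2), of x] by blast+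
    then show "\<phi> x + \<psi> x = 0" by (simp only: add_0)
  qed
  then show "translate t \<nu> (\<lambda>x. \<phi> x + \<psi> x) = translate t \<nu> \<phi> + translate t \<nu> \<psi>"
    using radon_add[OF \<nu> Cc_shift[OF c(1), of t] Cc_shift[OF c(2), of t]] c by (simp add: translate_apply)
next
  fix \<phi> :: "'g \<Rightarrow> complex" and a assume c: "\<phi> \<in> Cc"
  have "(\<lambda>x. a * \<phi> x) \<in> Cc"
  proof (rule CcI(1))
    show "continuous_on UNIV (\<lambda>x. a * \<phi> x)" using c by (intro continuous_intros Cc_continuous)
    show "compact (closure {x. \<phi> x \<noteq> 0})" using c by (simp add: Cc_def)
    fix x assume "x \<notin> closure {x. \<phi> x \<noteq> 0}"
    then have "\<phi> x = 0" by (rule Cc_zero_outside[OF c])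
    then show "a * \<phi> x = 0" by (simp only: mult_zero_right)
  qed
  then show "translate t \<nu> (\<lambda>x. a * \<phi> x) = a * translate t \<nu> \<phi>"
    using radon_scale[OF \<nu> Cc_shift[OF c, of t]] c by (simp add: translate_apply)
next
  fix K :: "'g set" assume K: "compact K"
  have K': "compact ((\<lambda>(k, l). k - l) ` (K \<times> {t}))" using K by (intro compact_minus_set) simp_all
  obtain C where C: "0 \<le> C" "\<And>\<phi> B. continuous_on UNIV \<phi> \<Longrightarrow> (\<And>x. x \<notin> (\<lambda>(k, l). k - l) ` (K \<times> {t}) \<Longrightarrow> \<phi> x = 0) \<Longrightarrow>
      (\<And>x. cmod (\<phi> x) \<le> B) \<Longrightarrow> cmod (\<nu> \<phi>) \<le> C * B"
    using radon_bound[OF \<nu> K'] by metis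
  have "cmod (translate t \<nu> \<phi>) \<le> C * (SUP x. cmod (\<phi> x))" if \<phi>: "\<phi> \<in> Cc" "closure {x. \<phi> x \<noteq> 0} \<subseteq> K" for \<phi>
    unfolding translate_apply[OF \<phi>(1)]
  proof (rule C(2))
    show "continuous_on UNIV (\<lambda>s. \<phi> (s + t))" by (rule continuous_shift[OF Cc_continuous[OF \<phi>(1)]])
    show "\<phi> (x + t) = 0" if x: "x \<notin> (\<lambda>(k, l). k - l) ` (K \<times> {t})" for x
    proof -
      have "x + t \<notin> K" using x by force
      then show ?thesis using \<phi> Cc_zero_outside by blast
    qed
    obtain B where "\<And>x. cmod (\<phi> x) \<le> B" using Cc_bounded[OF \<phi>(1)] by metis
    then show "cmod (\<phi> (x + t)) \<le> (SUP x. cmod (\<phi> x))" for x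
      by (intro cSUP_upper bdd_aboveI[where M = B]) auto
  qed
  then show "\<exists>C. \<forall>\<phi>\<in>Cc. closure {x. \<phi> x \<noteq> 0} \<subseteq> K \<longrightarrow> cmod (translate t \<nu> \<phi>) \<le> C * (SUP x. cmod (\<phi> x))"
    by blast
qed

lemma orbit_bounded:
  fixes \<mu> :: "('g::{topological_ab_group_add, t2_space} \<Rightarrow> complex) \<Rightarrow> complex"
  assumes "\<mu> \<in> translation_bounded_measures" and \<phi>: "\<phi> \<in> Cc"
  shows "\<exists>C. \<forall>t. cmod (translate t \<mu> \<phi>) \<le> C"
proof -
  have "bounded (range (mconv \<mu> (\<lambda>s. \<phi> (- s))))"
    using assms Cc_reflect[OF \<phi>] by (simp add: translation_bounded_measures_def)
  then obtain C where C: "\<And>t. cmod (mconv \<mu> (\<lambda>s. \<phi> (- s)) t) \<le> C" unfolding bounded_iff by auto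
  have "translate t \<mu> \<phi> = mconv \<mu> (\<lambda>s. \<phi> (- s)) (- t)" for t
    by (simp add: translate_apply[OF \<phi>] mconv_def add.commute)
  then show ?thesis using C by metis
qed

text \<open>
  The closure is taken among all functions on functions. It coincides with the hull because all its elements
  are Radon measures (\<open>orbit_closure_radon\<close>).
\<close>

definition orbit_closure :: "(('g::topological_ab_group_add \<Rightarrow> complex) \<Rightarrow> complex) \<Rightarrow> (('g \<Rightarrow> complex) \<Rightarrow> complex) set"
  where "orbit_closure \<mu> = closure (range (\<lambda>t. translate t \<mu>))"

text \<open>
  Linearity is a closed condition. So is a bound on the functions supported in \<open>K\<close>, and the
  uniform boundedness principle provides one bound for all translates of \<open>\<mu>\<close>; this is where translation boundedness
  enters.
\<close>

lemma orbit_closure_radon: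
  fixes \<mu> :: "('g::{topological_ab_group_add, t2_space} \<Rightarrow> complex) \<Rightarrow> complex"
  assumes \<mu>: "\<mu> \<in> translation_bounded_measures"
  shows "orbit_closure \<mu> \<subseteq> radon_measures"
proof
  let ?O = "range (\<lambda>t. translate t \<mu>)"
  have O: "?O \<subseteq> radon_measures"
    using \<mu> radon_translate by (auto simp: translation_bounded_measures_def)
  have ev [continuous_intros]: "continuous_on UNIV (\<lambda>\<nu> :: ('g \<Rightarrow> complex) \<Rightarrow> complex. \<nu> \<phi>)" for \<phi>
    by (rule continuous_on_product_coordinates)
  have transfer: "P \<nu>" if \<nu>: "\<nu> \<in> orbit_closure \<mu>" and P: "closed {\<nu>. P \<nu>}" "\<And>t. P (translate t \<mu>)" for P \<nu>
  proof -
    have "closure ?O \<subseteq> {\<nu>. P \<nu>}" using P by (intro closure_minimal) auto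
    then show ?thesis using \<nu> unfolding orbit_closure_def by blast
  qed
  fix \<nu> assume \<nu>: "\<nu> \<in> orbit_closure \<mu>"
  show "\<nu> \<in> radon_measures"
    unfolding radon_measures_def mem_Collect_eq
  proof (intro conjI allI ballI impI)
    show "\<nu> \<in> extensional Cc"
      unfolding extensional_def mem_Collect_eq
    proof (intro allI impI)
      fix \<phi> :: "'g \<Rightarrow> complex" assume n: "\<phi> \<notin> Cc"
      show "\<nu> \<phi> = undefined"
        by (rule transfer[OF \<nu>]) (auto intro!: closed_Collect_eq continuous_intros simp: translate_def n)
    qed
  next
    fix \<phi> \<psi> :: "'g \<Rightarrow> complex" assume c: "\<phi> \<in> Cc" "\<psi> \<in> Cc"
    show "\<nu> (\<lambda>x. \<phi> x + \<psi> x) = \<nu> \<phi> + \<nu> \<psi>"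
    proof (rule transfer[OF \<nu>])
      show "closed {\<nu> :: ('g \<Rightarrow> complex) \<Rightarrow> complex. \<nu> (\<lambda>x. \<phi> x + \<psi> x) = \<nu> \<phi> + \<nu> \<psi>}"
        by (rule closed_Collect_eq[OF ev continuous_on_add[OF ev ev]])
      show "translate t \<mu> (\<lambda>x. \<phi> x + \<psi> x) = translate t \<mu> \<phi> + translate t \<mu> \<psi>" for t
        using O c by (intro radon_add) auto
    qed
  next
    fix \<phi> :: "'g \<Rightarrow> complex" and a assume c: "\<phi> \<in> Cc"
    show "\<nu> (\<lambda>x. a * \<phi> x) = a * \<nu> \<phi>"
    proof (rule transfer[OF \<nu>])
      show "closed {\<nu>. \<nu> (\<lambda>x. a * \<phi> x) = a * \<nu> \<phi>}"
        by (intro closed_Collect_eq continuous_intros)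
      show "translate t \<mu> (\<lambda>x. a * \<phi> x) = a * translate t \<mu> \<phi>" for t
        using O c by (intro radon_scale) auto
    qed
  next
    fix K :: "'g set" assume K: "compact K"
    have "\<exists>C. \<forall>\<nu>\<in>?O. \<forall>\<phi>\<in>Cc. closure {x. \<phi> x \<noteq> 0} \<subseteq> K \<longrightarrow> cmod (\<nu> \<phi>) \<le> C * (SUP x. cmod (\<phi> x))"
    proof (rule radon_uniform_bound[OF O K])
      fix \<phi> :: "'g \<Rightarrow> complex" assume "\<phi> \<in> Cc"
      then show "\<exists>C. \<forall>\<nu>\<in>?O. cmod (\<nu> \<phi>) \<le> C" using orbit_bounded[OF \<mu>] by blast
    qed
    then obtain C where C: "\<And>t \<phi>. \<phi> \<in> Cc \<Longrightarrow> closure {x. \<phi> x \<noteq> 0} \<subseteq> K \<Longrightarrow>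
        cmod (translate t \<mu> \<phi>) \<le> C * (SUP x. cmod (\<phi> x))" by blast
    have "cmod (\<nu> \<phi>) \<le> C * (SUP x. cmod (\<phi> x))" if \<phi>: "\<phi> \<in> Cc" "closure {x. \<phi> x \<noteq> 0} \<subseteq> K" for \<phi>
      by (rule transfer[OF \<nu>]) (intro closed_Collect_le continuous_intros, rule C[OF \<phi>])
    then show "\<exists>C. \<forall>\<phi>\<in>Cc. closure {x. \<phi> x \<noteq> 0} \<subseteq> K \<longrightarrow> cmod (\<nu> \<phi>) \<le> C * (SUP x. cmod (\<phi> x))"
      by blast
  qed
qed

lemma orbit_closure_bounded:
  fixes \<mu> :: "('g::{topological_ab_group_add, t2_space} \<Rightarrow> complex) \<Rightarrow> complex"
  assumes \<mu>: "\<mu> \<in> translation_bounded_measures"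
  obtains b where "\<And>\<phi> t. \<phi> \<in> Cc \<Longrightarrow> cmod (translate t \<mu> \<phi>) \<le> b \<phi>"
  using orbit_bounded[OF \<mu>] by metis

text \<open>
  Tychonoff's theorem: the orbit lies in a product of discs.
\<close>

lemma compact_orbit_closure:
  fixes \<mu> :: "('g::{topological_ab_group_add, t2_space} \<Rightarrow> complex) \<Rightarrow> complex"
  assumes \<mu>: "\<mu> \<in> translation_bounded_measures"
  shows "compact (orbit_closure \<mu>)"
proof -
  obtain b where b: "\<And>\<phi> t. \<phi> \<in> Cc \<Longrightarrow> cmod (translate t \<mu> \<phi>) \<le> b \<phi>"
    using orbit_closure_bounded[OF \<mu>] by metis
  define R where "R \<phi> = (if \<phi> \<in> Cc then cball 0 (b \<phi>) else {undefined :: complex})" for \<phi> :: "'g \<Rightarrow> complex"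
  have "compactin (product_topology (\<lambda>_. euclidean) UNIV) (PiE UNIV R)"
    unfolding compactin_PiE by (auto simp: R_def)
  then have R: "compact (PiE UNIV R)" by (simp add: euclidean_product_topology)
  have "closedin (product_topology (\<lambda>_. euclidean) UNIV) (PiE UNIV R)"
    unfolding closedin_product_topology by (simp add: R_def)
  then have Rcl: "closed (PiE UNIV R)" by (simp add: euclidean_product_topology)
  have "range (\<lambda>t. translate t \<mu>) \<subseteq> PiE UNIV R"
    using b by (auto simp: R_def translate_def PiE_def Pi_def)
  then have "orbit_closure \<mu> \<subseteq> PiE UNIV R"
    unfolding orbit_closure_def by (intro closure_minimal Rcl)
  then have "PiE UNIV R \<inter> orbit_closure \<mu> = orbit_closure \<mu>" by blast
  then show ?thesis using compact_Int_closed[OF R, of "orbit_closure \<mu>"] by (simp add: orbit_closure_def)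
qed

lemma measure_hull_eq:
  fixes \<mu> :: "('g::{topological_ab_group_add, t2_space} \<Rightarrow> complex) \<Rightarrow> complex"
  assumes \<mu>: "\<mu> \<in> translation_bounded_measures"
  shows "measure_hull \<mu> = top_of_set (orbit_closure \<mu>)"
proof -
  let ?O = "range (\<lambda>t. translate t \<mu>)"
  have sub: "orbit_closure \<mu> \<subseteq> radon_measures" by (rule orbit_closure_radon[OF \<mu>])
  moreover have "?O \<subseteq> orbit_closure \<mu>" unfolding orbit_closure_def by (rule closure_subset)
  ultimately have "?O \<subseteq> radon_measures" by blast
  then have "radon_measures \<inter> ?O = ?O" by blast
  then have "vague_topology closure_of ?O = radon_measures \<inter> orbit_closure \<mu>"
    unfolding vague_topology_top_of_set closure_of_subtopology by (simp add: orbit_closure_def)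
  also have "\<dots> = orbit_closure \<mu>" using sub by blast
  finally show ?thesis
    unfolding measure_hull_def vague_topology_top_of_set subtopology_subtopology
    using sub by (simp add: Int_absorb1)
qed

lemma translate_orbit_closure:
  fixes \<mu> :: "('g::{topological_ab_group_add, t2_space} \<Rightarrow> complex) \<Rightarrow> complex"
  shows "translate t ` orbit_closure \<mu> \<subseteq> orbit_closure \<mu>"
proof -
  have "translate t ` closure (range (\<lambda>s. translate s \<mu>)) \<subseteq> closure (range (\<lambda>s. translate s \<mu>))"
  proof (rule image_closure_subset)
    show "continuous_on (closure (range (\<lambda>s. translate s \<mu>))) (translate t)"
      by (rule continuous_on_subset[OF continuous_translate subset_UNIV])
    have "translate t (translate s \<mu>) \<in> range (\<lambda>s. translate s \<mu>)" for s
      unfolding translate_translate by blast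
    then show "translate t ` range (\<lambda>s. translate s \<mu>) \<subseteq> closure (range (\<lambda>s. translate s \<mu>))"
      using closure_subset by blast
  qed simp
  then show ?thesis by (simp add: orbit_closure_def)
qed

text \<open>
  For \<open>t\<close> in a compact neighbourhood of \<open>t0\<close> all the translates of \<open>\<phi>\<close> are supported in one compact
  set, on which they converge uniformly as \<open>t\<close> tends to \<open>t0\<close>; the functional is bounded there.
\<close>

lemma continuous_orbit_coordinate:
  fixes \<mu> :: "('g::{topological_ab_group_add, t2_space} \<Rightarrow> complex) \<Rightarrow> complex"
  assumes lc: "locally_compact_space (euclidean :: 'g topology)"
    and \<mu>: "\<mu> \<in> radon_measures" and \<phi>: "\<phi> \<in> Cc"
  shows "continuous_on UNIV (\<lambda>t. translate t \<mu> \<phi>)"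
  unfolding continuous_on_def
proof (intro ballI tendstoI)
  fix t0 :: 'g and \<epsilon> :: real assume \<epsilon>: "0 < \<epsilon>"
  obtain U L where U: "open U" "t0 \<in> U" "compact L" "U \<subseteq> L"
  proof -
    have "\<forall>x :: 'g. \<exists>U L. open U \<and> compact L \<and> x \<in> U \<and> U \<subseteq> L"
      using lc unfolding locally_compact_space_def by simp
    then show thesis using that by blast
  qed
  let ?S = "closure {x. \<phi> x \<noteq> 0}"
  define K where "K = (\<lambda>(k, l). k - l) ` (?S \<times> L)"
  have K: "compact K" unfolding K_def using \<phi> U(3) by (intro compact_minus_set) (simp_all add: Cc_def)
  have zero: "\<phi> (x + t) = 0" if xt: "x \<notin> K" "t \<in> L" for x t
  proof -
    have "x + t \<notin> ?S"
    proof
      assume "x + t \<in> ?S"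
      then have "(\<lambda>(k, l). k - l) (x + t, t) \<in> K" unfolding K_def using xt(2) by (intro imageI) simp
      with xt(1) show False by simp
    qed
    then show ?thesis by (rule Cc_zero_outside[OF \<phi>])
  qed
  obtain C where C: "0 \<le> C" "\<And>\<phi> B. continuous_on UNIV \<phi> \<Longrightarrow> (\<And>x. x \<notin> K \<Longrightarrow> \<phi> x = 0) \<Longrightarrow>
      (\<And>x. cmod (\<phi> x) \<le> B) \<Longrightarrow> cmod (\<mu> \<phi>) \<le> C * B"
    using radon_bound[OF \<mu> K] by metis
  define e where "e = \<epsilon> / (2 * (C + 1))"
  have e: "0 < e" using C(1) \<epsilon> by (simp add: e_def)
  have "C * e \<le> (C + 1) * e" using e by (intro mult_right_mono) simp_all
  also have "(C + 1) * e = \<epsilon> / 2"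
  proof -
    have "C + 1 \<noteq> 0" using C(1) by linarith
    then show ?thesis unfolding e_def by (simp only: times_divide_eq_right mult.commute[of 2 "C + 1"] mult_divide_mult_cancel_left if_False simp_thms)
  qed
  finally have Ce: "C * e < \<epsilon>" using \<epsilon> by linarith
  have "continuous_on (UNIV \<times> K) (\<lambda>p. \<phi> (snd p + fst p))"
    by (rule continuous_on_compose2[OF Cc_continuous[OF \<phi>]]) (auto intro!: continuous_intros)
  from continuous_on_prod_compactE[OF this K UNIV_I e]
  obtain X where X: "t0 \<in> X" "open X" "\<And>t s. t \<in> X \<Longrightarrow> s \<in> K \<Longrightarrow> dist (\<phi> (s + t)) (\<phi> (s + t0)) \<le> e"
    by (metis Int_UNIV_right fst_conv snd_conv)
  have "dist (translate t \<mu> \<phi>) (translate t0 \<mu> \<phi>) < \<epsilon>" if t: "t \<in> X \<inter> U" for t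
  proof -
    have tL: "t \<in> L" "t0 \<in> L" "t \<in> X" using t U by auto
    have neg: "(\<lambda>s. (-1) * \<phi> (s + t0)) \<in> Cc"
    proof (rule CcI(1)[OF _ K])
      show "continuous_on UNIV (\<lambda>s. (-1) * \<phi> (s + t0))"
        by (intro continuous_on_mult continuous_on_const continuous_shift Cc_continuous \<phi>)
    qed (simp add: zero[OF _ tL(2)])
    have "translate t \<mu> \<phi> - translate t0 \<mu> \<phi> = \<mu> (\<lambda>s. \<phi> (s + t) - \<phi> (s + t0))"
      using radon_diff[OF \<mu> Cc_shift[OF \<phi>] Cc_shift[OF \<phi>] neg] by (simp add: translate_apply[OF \<phi>])
    also have "cmod \<dots> \<le> C * e"
    proof (rule C(2))
      show "continuous_on UNIV (\<lambda>s. \<phi> (s + t) - \<phi> (s + t0))"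
        by (intro continuous_on_diff continuous_shift Cc_continuous \<phi>)
      show "\<phi> (x + t) - \<phi> (x + t0) = 0" if "x \<notin> K" for x
        by (simp add: zero[OF that tL(1)] zero[OF that tL(2)])
      show "cmod (\<phi> (x + t) - \<phi> (x + t0)) \<le> e" for x
      proof (cases "x \<in> K")
        case True
        then show ?thesis using X(3)[OF tL(3) True] by (simp add: dist_norm)
      next
        case False
        then show ?thesis using zero[OF False tL(1)] zero[OF False tL(2)] e by simp
      qed
    qed
    finally show ?thesis using Ce by (simp add: dist_norm)
  qed
  then show "\<forall>\<^sub>F t in at t0 within UNIV. dist (translate t \<mu> \<phi>) (translate t0 \<mu> \<phi>) < \<epsilon>"
    unfolding eventually_at_topological using X(1,2) U(1,2)
    by (intro exI[of _ "X \<inter> U"]) (auto intro: open_Int)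
qed

lemma continuous_orbit:
  fixes \<mu> :: "('g::{topological_ab_group_add, t2_space} \<Rightarrow> complex) \<Rightarrow> complex"
  assumes "locally_compact_space (euclidean :: 'g topology)" "\<mu> \<in> radon_measures"
  shows "continuous_on UNIV (\<lambda>t. translate t \<mu>)"
proof (rule continuous_on_coordinatewise_then_product)
  fix \<phi> :: "'g \<Rightarrow> complex"
  show "continuous_on UNIV (\<lambda>t. translate t \<mu> \<phi>)"
    using continuous_orbit_coordinate[OF assms]
    by (cases "\<phi> \<in> Cc") (simp_all add: translate_def)
qed

section \<open>Averages along a van Hove sequence\<close>

lemma uniform_measure_integral:
  fixes f :: "'a \<Rightarrow> 'b::{banach, second_countable_topology}"
  assumes "S \<in> sets M" "emeasure M S \<noteq> 0" "emeasure M S \<noteq> \<infinity>" "f \<in> borel_measurable M"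
  shows "(LINT x|uniform_measure M S. f x) = (1 / measure M S) *\<^sub>R (LINT x:S|M. f x)"
proof -
  have pos: "measure M S > 0" using assms(2,3) by (simp add: measure_def enn2real_positive_iff less_top zero_less_iff_neq_zero)
  have em: "emeasure M S = ennreal (measure M S)" using assms(3) by (simp add: emeasure_eq_ennreal_measure)
  have "uniform_measure M S = density M (\<lambda>x. ennreal (indicator S x / measure M S))"
    unfolding uniform_measure_def
  proof (rule arg_cong[where f = "density M"], rule ext)
    fix x
    show "indicator S x / emeasure M S = ennreal (indicator S x / measure M S)"
      using pos unfolding em by (cases "x \<in> S") (simp_all add: divide_ennreal[symmetric])
  qed
  then have "(LINT x|uniform_measure M S. f x) = (LINT x|M. (indicator S x / measure M S) *\<^sub>R f x)"
    using assms(1,4) by (simp add: integral_density)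
  also have "\<dots> = (LINT x|M. (1 / measure M S) *\<^sub>R (indicator S x *\<^sub>R f x))" by simp
  also have "\<dots> = (1 / measure M S) *\<^sub>R (LINT x:S|M. f x)"
    unfolding set_lebesgue_integral_def by (rule integral_scaleR_right)
  finally show ?thesis .
qed

locale van_Hove_sequence =
  fixes haar :: "'g::{topological_ab_group_add, t2_space} measure" and A :: "nat \<Rightarrow> 'g set"
  assumes haar: "haar_measure haar" and van_Hove: "van_Hove haar A"
begin

text \<open>
  As a probability measure, so that \<open>inner_L2 (avg n)\<close> and \<open>norm_L2 (avg n)\<close> are the inner product and the
  norm whose limits define the Besicovitch geometry.
\<close>

definition avg :: "nat \<Rightarrow> 'g measure" where "avg n = uniform_measure haar (A n)"

text \<open>
  All functions on the group that occur below are orbit functions or trigonometric polynomials, so that continuity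
  can take the place of measurability.
\<close>

definition Cb :: "('g \<Rightarrow> complex) set" where
  "Cb = {h. continuous_on UNIV h \<and> bounded (range h)}"

lemma sets_haar: "sets haar = sets borel"
  using haar unfolding haar_measure_def by (rule conjunct1)

lemma measurable_haar: "h \<in> borel_measurable borel \<Longrightarrow> h \<in> borel_measurable haar"
  using measurable_cong_sets[OF sets_haar refl] by blast

lemma space_haar: "space haar = UNIV"
  using sets_eq_imp_space_eq[OF sets_haar] by simp

lemma open_A: "open (A n)" and compact_A: "compact (closure (A n))" and measure_A: "measure haar (A n) > 0"
proof -
  have "\<forall>n. open (A n) \<and> compact (closure (A n)) \<and> measure haar (A n) > 0"
    using van_Hove unfolding van_Hove_def by (rule conjunct1)
  then show "open (A n)" "compact (closure (A n))" "measure haar (A n) > 0" by simp_all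
qed

lemma van_Hove_boundary:
  "compact K \<Longrightarrow> (\<lambda>n. measure haar (vH_boundary K (A n)) / measure haar (A n)) \<longlonglongrightarrow> 0"
  using van_Hove unfolding van_Hove_def by simp

lemma A_sets: "A n \<in> sets haar"
  using open_A sets_haar by simp

lemma finite_compact: "compact K \<Longrightarrow> emeasure haar K \<noteq> \<infinity>"
  using haar unfolding haar_measure_def by (metis less_irrefl)

lemma emeasure_mono_compact: "compact K \<Longrightarrow> S \<subseteq> K \<Longrightarrow> emeasure haar S \<noteq> \<infinity>"
proof -
  assume K: "compact K" "S \<subseteq> K"
  then have "K \<in> sets haar" using sets_haar borel_compact by blast
  then have "emeasure haar S \<le> emeasure haar K" using K(2) by (rule emeasure_mono[rotated])
  then show ?thesis using finite_compact[OF K(1)] by (metis infinity_ennreal_def top.extremum_uniqueI)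
qed

lemma finite_A: "emeasure haar (A n) \<noteq> \<infinity>" by (rule emeasure_mono_compact[OF compact_A closure_subset])

lemma nonzero_A: "emeasure haar (A n) \<noteq> 0"
  using measure_A[of n] by (metis enn2real_0 less_irrefl measure_def)

lemma prob_space_avg: "prob_space (avg n)"
  unfolding avg_def by (rule prob_space_uniform_measure[OF nonzero_A finite_A])

lemma finite_measure_avg: "finite_measure (avg n)"
  by (rule prob_space.finite_measure[OF prob_space_avg])

lemma sets_avg: "sets (avg n) = sets borel"
  using sets_haar by (simp add: avg_def)

lemma measurable_avg: "h \<in> borel_measurable borel \<Longrightarrow> h \<in> borel_measurable (avg n)"
  using measurable_cong_sets[OF sets_avg refl] by blast

lemma integral_avg:
  fixes h :: "'g \<Rightarrow> 'b::{banach, second_countable_topology}"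
  assumes "h \<in> borel_measurable borel"
  shows "(LINT t|avg n. h t) = (1 / measure haar (A n)) *\<^sub>R (LINT t:A n|haar. h t)"
  unfolding avg_def by (rule uniform_measure_integral[OF A_sets nonzero_A finite_A measurable_haar[OF assms]])

lemma Cb_measurable: "h \<in> Cb \<Longrightarrow> h \<in> borel_measurable borel"
  unfolding Cb_def by (intro borel_measurable_continuous_onI) blast

lemma Cb_L2: "h \<in> Cb \<Longrightarrow> h \<in> L2 (avg n)"
proof -
  assume h: "h \<in> Cb"
  then obtain C where "\<And>t. norm (h t) \<le> C" unfolding Cb_def bounded_iff by blast
  then show ?thesis
    by (intro L2_bounded[OF finite_measure_avg measurable_avg[OF Cb_measurable[OF h]]] AE_I2)
qed

lemma Cb_const: "(\<lambda>t. c) \<in> Cb" by (simp add: Cb_def)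

lemma Cb_add: "f \<in> Cb \<Longrightarrow> g \<in> Cb \<Longrightarrow> (\<lambda>t. f t + g t) \<in> Cb"
  unfolding Cb_def by (auto intro: continuous_on_add bounded_plus_comp)

lemma Cb_mult: "f \<in> Cb \<Longrightarrow> g \<in> Cb \<Longrightarrow> (\<lambda>t. f t * g t) \<in> Cb"
proof -
  assume fg: "f \<in> Cb" "g \<in> Cb"
  obtain C where C: "\<And>t. norm (f t) \<le> C" using fg(1) unfolding Cb_def bounded_iff by blast
  obtain D where D: "\<And>t. norm (g t) \<le> D" using fg(2) unfolding Cb_def bounded_iff by blast
  have "norm (f t * g t) \<le> C * D" for t
    unfolding norm_mult by (intro mult_mono C D norm_ge_zero order_trans[OF norm_ge_zero C])
  then have "bounded (range (\<lambda>t. f t * g t))" unfolding bounded_iff by blast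
  then show ?thesis using fg unfolding Cb_def by (auto intro: continuous_on_mult)
qed

lemma Cb_scale: "f \<in> Cb \<Longrightarrow> (\<lambda>t. c * f t) \<in> Cb" by (rule Cb_mult[OF Cb_const])

lemma Cb_diff: "f \<in> Cb \<Longrightarrow> g \<in> Cb \<Longrightarrow> (\<lambda>t. f t - g t) \<in> Cb"
  using Cb_add[of f "\<lambda>t. (-1) * g t"] Cb_scale[of g "-1"] by simp

lemma Cb_cnj: "f \<in> Cb \<Longrightarrow> (\<lambda>t. cnj (f t)) \<in> Cb"
  unfolding Cb_def bounded_iff by (auto intro: continuous_on_cnj)

lemma Cb_sum: "(\<And>i. i \<in> S \<Longrightarrow> f i \<in> Cb) \<Longrightarrow> (\<lambda>t. \<Sum>i\<in>S. c i * f i t) \<in> Cb"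
  by (induction S rule: infinite_finite_induct) (simp_all add: Cb_const Cb_add Cb_scale)

lemma Cb_shift: "f \<in> Cb \<Longrightarrow> (\<lambda>s. f (s + t)) \<in> Cb"
proof -
  assume f: "f \<in> Cb"
  have "continuous_on UNIV (\<lambda>s. f (s + t))"
  proof -
    have cf: "continuous_on UNIV f" using f by (simp add: Cb_def)
    have cs: "continuous_on UNIV (\<lambda>s. s + t)" by (intro continuous_intros)
    show ?thesis by (rule continuous_on_compose2[OF cf cs subset_UNIV])
  qed
  moreover have "bounded (range (\<lambda>s. f (s + t)))"
    by (rule bounded_subset[of "range f"]) (use f in \<open>auto simp: Cb_def\<close>)
  ultimately show ?thesis by (simp add: Cb_def)
qed

lemma dual_Cb: "\<xi> \<in> dual_group \<Longrightarrow> \<xi> \<in> Cb"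
  unfolding dual_group_def Cb_def bounded_iff by auto

lemma trig_Cb: "p \<in> linear_combinations dual_group \<Longrightarrow> p \<in> Cb"
proof -
  assume "p \<in> linear_combinations dual_group"
  then obtain S c where S: "S \<subseteq> dual_group" and p: "p = (\<lambda>x. \<Sum>e\<in>S. c e * e x)"
    unfolding linear_combinations_def by blast
  have "e \<in> Cb" if "e \<in> S" for e using dual_Cb S that by blast
  then show ?thesis unfolding p by (rule Cb_sum)
qed

lemma distr_haar: "distr haar haar ((+) t) = haar"
proof (rule measure_eqI)
  have m: "(+) t \<in> measurable haar haar"
  proof -
    have "(+) t \<in> borel_measurable borel"
      by (intro borel_measurable_continuous_onI continuous_intros)
    then show ?thesis using measurable_cong_sets[OF sets_haar sets_haar] by blast
  qed
  fix B assume "B \<in> sets (distr haar haar ((+) t))"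
  then have B: "B \<in> sets haar" by simp
  have "emeasure (distr haar haar ((+) t)) B = emeasure haar ((+) t -` B)"
    using emeasure_distr[OF m B] by (simp add: space_haar)
  also have "(+) t -` B = (+) (- t) ` B"
  proof (intro set_eqI iffI)
    fix x assume "x \<in> (+) t -` B"
    then have "- t + (t + x) \<in> (+) (- t) ` B" by (intro imageI) simp
    then show "x \<in> (+) (- t) ` B" by simp
  qed auto
  also have "emeasure haar \<dots> = emeasure haar B"
    using haar B sets_haar unfolding haar_measure_def by blast
  finally show "emeasure (distr haar haar ((+) t)) B = emeasure haar B" .
qed simp

lemma measure_shift: "B \<in> sets borel \<Longrightarrow> measure haar ((+) t ` B) = measure haar B"
  using haar unfolding haar_measure_def measure_def by metis

text \<open>
  The part of the translate of \<open>A n\<close> by \<open>t\<close> outside \<open>A n\<close> lies in the van Hove boundary for the compact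
  set \<open>{t}\<close>. The other half of the symmetric difference has the same measure, since \<open>A n\<close> and its translate have the same finite
  measure.
\<close>

lemma Folner:
  "(\<lambda>n. measure haar ((+) t ` A n - A n) / measure haar (A n)) \<longlonglongrightarrow> 0"
proof (rule tendsto_sandwich[where f = "\<lambda>_. 0"])
  show "(\<lambda>n. measure haar (vH_boundary {t} (A n)) / measure haar (A n)) \<longlonglongrightarrow> 0"
    by (rule van_Hove_boundary) simp
  have le: "measure haar ((+) t ` A n - A n) \<le> measure haar (vH_boundary {t} (A n))" for n
  proof -
    have sh: "{a + k |a k. a \<in> A n \<and> k \<in> {t}} = (+) t ` A n"
      by (auto simp: image_iff add.commute)
    have vim: "{x - k |x k. x \<in> closure (- A n) \<and> k \<in> {t}} = (\<lambda>x. x + t) -` closure (- A n)"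
    proof (intro set_eqI iffI)
      fix y assume "y \<in> (\<lambda>x. x + t) -` closure (- A n)"
      then show "y \<in> {x - k |x k. x \<in> closure (- A n) \<and> k \<in> {t}}"
        by (intro CollectI exI[of _ "y + t"] exI[of _ t]) simp
    qed auto
    have bd: "vH_boundary {t} (A n)
        = closure ((+) t ` A n - A n) \<union> ((\<lambda>x. x + t) -` closure (- A n) \<inter> closure (A n))"
      unfolding vH_boundary_def sh vim ..
    have "closed ((\<lambda>x. x + t) -` closure (- A n))"
      by (intro closed_vimage closed_closure continuous_intros)
    then have "closed (vH_boundary {t} (A n))"
      unfolding bd by (intro closed_Un closed_Int closed_closure)
    then have sets: "vH_boundary {t} (A n) \<in> sets haar" using sets_haar by simp
    have cK: "compact ((+) t ` closure (A n))"
      by (intro compact_continuous_image compact_A continuous_intros)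
    have "(+) t ` A n - A n \<subseteq> (+) t ` closure (A n)" using closure_subset by blast
    then have "closure ((+) t ` A n - A n) \<subseteq> (+) t ` closure (A n)"
      by (rule closure_minimal[OF _ compact_imp_closed[OF cK]])
    then have "vH_boundary {t} (A n) \<subseteq> (+) t ` closure (A n) \<union> closure (A n)" unfolding bd by blast
    then have fin: "emeasure haar (vH_boundary {t} (A n)) \<noteq> \<infinity>"
      by (rule emeasure_mono_compact[OF compact_Un[OF cK compact_A]])
    have "(+) t ` A n - A n \<subseteq> vH_boundary {t} (A n)" 
      unfolding bd using closure_subset[of "(+) t ` A n - A n"] by blast
    then show ?thesis
      using sets fin
      unfolding measure_def by (intro enn2real_mono emeasure_mono) (simp_all add: less_top)
  qed
  show "\<forall>\<^sub>F n in sequentially. measure haar ((+) t ` A n - A n) / measure haar (A n)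
      \<le> measure haar (vH_boundary {t} (A n)) / measure haar (A n)"
    using le by (intro always_eventually allI divide_right_mono) simp_all
  show "\<forall>\<^sub>F n in sequentially. 0 \<le> measure haar ((+) t ` A n - A n) / measure haar (A n)"
    by (intro always_eventually allI divide_nonneg_nonneg measure_nonneg)
qed (rule tendsto_const)

text \<open>
  The two averages are integrals of \<open>h\<close> over \<open>A n\<close> and over its translate. Their difference only sees the
  symmetric difference of the two sets.
\<close>

lemma avg_shift:
  assumes h: "h \<in> Cb"
  shows "(\<lambda>n. (LINT s|avg n. h (s + t)) - (LINT s|avg n. h s)) \<longlonglongrightarrow> 0"
proof -
  obtain C where C: "\<And>s. cmod (h s) \<le> C" using h unfolding Cb_def bounded_iff by blast
  have C0: "0 \<le> C" using order_trans[OF norm_ge_zero C] .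
  have hm [measurable]: "h \<in> borel_measurable haar" by (rule measurable_haar[OF Cb_measurable[OF h]])
  have le: "cmod ((LINT s|avg n. h (s + t)) - (LINT s|avg n. h s))
      \<le> 2 * C * (measure haar ((+) t ` A n - A n) / measure haar (A n))" for n
  proof -
    let ?A = "A n" and ?B = "(+) t ` A n"
    have op: "open ?B"
    proof -
      have "?B = (\<lambda>x. x - t) -` A n"
      proof (intro set_eqI iffI)
        fix x assume "x \<in> (\<lambda>x. x - t) -` A n"
        then have "t + (x - t) \<in> ?B" by (intro imageI) simp
        then show "x \<in> ?B" by simp
      qed auto
      then show ?thesis using open_vimage[OF open_A[of n], of "\<lambda>x. x - t"] by (simp add: continuous_intros)
    qed
    have B [measurable]: "?B \<in> sets haar" using op sets_haar by simp
    have A [measurable]: "?A \<in> sets haar" by (rule A_sets)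
    have cB: "compact ((+) t ` closure (A n))"
      by (intro compact_continuous_image compact_A continuous_intros)
    have finB: "emeasure haar ?B \<noteq> \<infinity>"
      by (rule emeasure_mono_compact[OF cB]) (use closure_subset in blast)
    have mB: "measure haar ?B = measure haar ?A" by (rule measure_shift) (simp add: open_A)
    have "(LINT s:?A|haar. h (s + t)) = (LINT s|haar. indicator ?B (t + s) *\<^sub>R h (t + s))"
      unfolding set_lebesgue_integral_def
      by (intro Bochner_Integration.integral_cong refl) (auto simp: indicator_def add.commute)
    also have "\<dots> = (LINT s|distr haar haar ((+) t). indicator ?B s *\<^sub>R h s)"
    proof (rule integral_distr[symmetric])
      have "(+) t \<in> borel_measurable borel" by (intro borel_measurable_continuous_onI continuous_intros)
      then show "(+) t \<in> measurable haar haar" using measurable_cong_sets[OF sets_haar sets_haar] by blast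
      show "(\<lambda>s. indicator ?B s *\<^sub>R h s) \<in> borel_measurable haar" by measurable
    qed
    also have "\<dots> = (LINT s:?B|haar. h s)" unfolding distr_haar set_lebesgue_integral_def ..
    finally have sh: "(LINT s:?A|haar. h (s + t)) = (LINT s:?B|haar. h s)" .
    have int: "set_integrable haar S h" if S: "S \<in> sets haar" "emeasure haar S \<noteq> \<infinity>" for S
    proof -
      have "integrable haar (\<lambda>s. C * indicator S s)"
        using S by (intro integrable_mult_right integrable_real_indicator) (simp_all add: less_top)
      then show ?thesis
        unfolding set_integrable_def
      proof (rule Bochner_Integration.integrable_bound)
        show "(\<lambda>s. indicator S s *\<^sub>R h s) \<in> borel_measurable haar" using S(1) by measurable
        show "AE s in haar. norm (indicator S s *\<^sub>R h s) \<le> norm (C * indicator S s)"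
          using C C0 by (intro AE_I2) (simp add: indicator_def)
      qed
    qed
    have fD: "emeasure haar (?B - ?A) \<noteq> \<infinity>" "emeasure haar (?A - ?B) \<noteq> \<infinity>" "emeasure haar (?A \<inter> ?B) \<noteq> \<infinity>"
      using emeasure_mono_compact[OF cB, of "?B - ?A"] emeasure_mono_compact[OF compact_A[of n], of "?A - ?B"]
        emeasure_mono_compact[OF compact_A[of n], of "?A \<inter> ?B"] closure_subset[of "A n"] by blast+
    have bound: "cmod (LINT s:S|haar. h s) \<le> C * measure haar S"
      if S: "S \<in> sets haar" "emeasure haar S \<noteq> \<infinity>" for S
    proof -
      have "cmod (LINT s:S|haar. h s) \<le> (LINT s|haar. norm (indicator S s *\<^sub>R h s))"
        unfolding set_lebesgue_integral_def by (rule integral_norm_bound)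
      also have "\<dots> \<le> (LINT s|haar. C * indicator S s)"
      proof (rule integral_mono)
        show "integrable haar (\<lambda>s. norm (indicator S s *\<^sub>R h s))"
          using int[OF S] unfolding set_integrable_def by (rule integrable_norm)
        show "integrable haar (\<lambda>s. C * indicator S s)"
          using S by (intro integrable_mult_right integrable_real_indicator) (simp_all add: less_top)
        show "norm (indicator S s *\<^sub>R h s) \<le> C * indicator S s" for s
          using C[of s] C0 by (simp add: indicator_def)
      qed
      also have "\<dots> = C * measure haar S" using S(1) by simp
      finally show ?thesis .
    qed
    have split: "(LINT s:S|haar. h s) = (LINT s:S - S'|haar. h s) + (LINT s:S \<inter> S'|haar. h s)"
      if "S \<in> sets haar" "S' \<in> sets haar" "emeasure haar (S - S') \<noteq> \<infinity>" "emeasure haar (S \<inter> S') \<noteq> \<infinity>" for S S'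
    proof -
      have "(LINT s:(S - S') \<union> (S \<inter> S')|haar. h s) = (LINT s:S - S'|haar. h s) + (LINT s:S \<inter> S'|haar. h s)"
        using that by (intro set_integral_Un int) auto
      moreover have "(S - S') \<union> (S \<inter> S') = S" by blast
      ultimately show ?thesis by simp
    qed
    have mD: "measure haar (?A - ?B) = measure haar (?B - ?A)"
      using measure_Diff[OF finite_A[of n] A, of "?A \<inter> ?B"] measure_Diff[OF finB B, of "?B \<inter> ?A"] mB A B
      by (simp add: Int_commute Diff_Int)
    have "(LINT s:?B|haar. h s) - (LINT s:?A|haar. h s) = (LINT s:?B - ?A|haar. h s) - (LINT s:?A - ?B|haar. h s)"
      using split[OF B A fD(1)] split[OF A B fD(2) fD(3)] fD(3) by (simp add: Int_commute)
    then have "cmod ((LINT s:?B|haar. h s) - (LINT s:?A|haar. h s))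
        \<le> cmod (LINT s:?B - ?A|haar. h s) + cmod (LINT s:?A - ?B|haar. h s)"
      by (simp only: norm_triangle_ineq4)
    also have "\<dots> \<le> C * measure haar (?B - ?A) + C * measure haar (?A - ?B)"
      using A B fD by (intro add_mono bound) auto
    also have "\<dots> = 2 * C * measure haar (?B - ?A)" unfolding mD by simp
    finally have main: "cmod ((LINT s:?B|haar. h s) - (LINT s:?A|haar. h s)) \<le> 2 * C * measure haar (?B - ?A)" .
    have "(LINT s|avg n. h (s + t)) - (LINT s|avg n. h s)
        = (1 / measure haar ?A) *\<^sub>R ((LINT s:?B|haar. h s) - (LINT s:?A|haar. h s))"
      using integral_avg[OF Cb_measurable[OF Cb_shift[OF h, of t]], of n] integral_avg[OF Cb_measurable[OF h], of n]
      unfolding sh by (simp only: scaleR_diff_right)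
    then have "cmod ((LINT s|avg n. h (s + t)) - (LINT s|avg n. h s))
        = (1 / measure haar ?A) * cmod ((LINT s:?B|haar. h s) - (LINT s:?A|haar. h s))"
      using measure_A[of n] by (simp only: norm_scaleR) simp
    also have "\<dots> \<le> (1 / measure haar ?A) * (2 * C * measure haar (?B - ?A))"
      using main measure_A[of n] by (intro mult_left_mono) simp_all
    finally show ?thesis by simp
  qed
  have "(\<lambda>n. 2 * C * (measure haar ((+) t ` A n - A n) / measure haar (A n))) \<longlonglongrightarrow> 0"
    using tendsto_mult_left[OF Folner, of "2 * C" t] by (simp only: mult_zero_right)
  then show ?thesis by (rule Lim_null_comparison[OF always_eventually[OF allI[OF le]]])
qed

lemma dual_mult: "\<xi> \<in> dual_group \<Longrightarrow> \<eta> \<in> dual_group \<Longrightarrow> (\<lambda>t. \<xi> t * \<eta> t) \<in> dual_group"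
  unfolding dual_group_def by (auto simp: norm_mult intro: continuous_on_mult)

lemma dual_cnj: "\<xi> \<in> dual_group \<Longrightarrow> (\<lambda>t. cnj (\<xi> t)) \<in> dual_group"
  unfolding dual_group_def by (auto intro: continuous_on_cnj)

lemma dual_one: "(\<lambda>t. 1) \<in> dual_group"
  unfolding dual_group_def by simp

lemma dual_norm: "\<xi> \<in> dual_group \<Longrightarrow> cmod (\<xi> t) = 1"
  and dual_add: "\<xi> \<in> dual_group \<Longrightarrow> \<xi> (s + t) = \<xi> s * \<xi> t"
  unfolding dual_group_def by blast+

lemma dual_cnj_mult: "\<xi> \<in> dual_group \<Longrightarrow> \<xi> t * cnj (\<xi> t) = 1" "\<xi> \<in> dual_group \<Longrightarrow> cnj (\<xi> t) * \<xi> t = 1"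
  using dual_norm[of \<xi> t] complex_norm_square[of "\<xi> t"] by (simp_all add: mult.commute)

text \<open>
  Translation by \<open>t\<close> multiplies the average of \<open>\<xi>\<close> by \<open>\<xi> t\<close> but does not change its limit.
\<close>

lemma avg_character:
  assumes \<xi>: "\<xi> \<in> dual_group" and ne: "\<xi> t \<noteq> 1"
  shows "(\<lambda>n. LINT s|avg n. \<xi> s) \<longlonglongrightarrow> 0"
proof -
  have "(\<lambda>n. (LINT s|avg n. \<xi> (s + t)) - (LINT s|avg n. \<xi> s)) \<longlonglongrightarrow> 0" by (rule avg_shift[OF dual_Cb[OF \<xi>]])
  moreover have "(LINT s|avg n. \<xi> (s + t)) - (LINT s|avg n. \<xi> s) = (\<xi> t - 1) * (LINT s|avg n. \<xi> s)" for n
    by (simp add: dual_add[OF \<xi>] algebra_simps)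
  ultimately have "(\<lambda>n. (\<xi> t - 1) * (LINT s|avg n. \<xi> s)) \<longlonglongrightarrow> 0" by simp
  then have "(\<lambda>n. (1 / (\<xi> t - 1)) * ((\<xi> t - 1) * (LINT s|avg n. \<xi> s))) \<longlonglongrightarrow> (1 / (\<xi> t - 1)) * 0"
    by (rule tendsto_mult_left)
  then show ?thesis using ne by simp
qed

lemma orthogonal_characters:
  assumes "\<xi> \<in> dual_group" "\<eta> \<in> dual_group"
  shows "(\<lambda>n. inner_L2 (avg n) \<xi> \<eta>) \<longlonglongrightarrow> (if \<xi> = \<eta> then 1 else 0)"
proof (cases "\<xi> = \<eta>")
  case True
  have "inner_L2 (avg n) \<xi> \<eta> = 1" for n
    unfolding inner_L2_def True dual_cnj_mult(1)[OF assms(2)] using prob_space.prob_space[OF prob_space_avg]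
    by simp
  then show ?thesis using True by simp
next
  case False
  then obtain t where t: "\<xi> t \<noteq> \<eta> t" by blast
  have "\<xi> t * cnj (\<eta> t) \<noteq> 1"
  proof
    assume "\<xi> t * cnj (\<eta> t) = 1"
    then have "\<xi> t * (cnj (\<eta> t) * \<eta> t) = \<eta> t" by (simp only: mult.assoc[symmetric] mult_1_left)
    then show False using t dual_cnj_mult(2)[OF assms(2)] by simp
  qed
  from avg_character[OF dual_mult[OF assms(1) dual_cnj[OF assms(2)]] this] show ?thesis
    using False by (simp add: inner_L2_def)
qed

text \<open>
  The upper bound \<open>besicovitch_norm haar A h \<le> r\<close> in terms of real inequalities that hold eventually
  (see \<open>besicovitch_norm_le_iff\<close>).
\<close>

definition besicovitch_le :: "('g \<Rightarrow> complex) \<Rightarrow> real \<Rightarrow> bool" where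
  "besicovitch_le h r \<longleftrightarrow> (\<forall>\<delta>>r. \<forall>\<^sub>F n in sequentially. norm_L2 (avg n) h < \<delta>)"

lemma norm_L2_avg:
  assumes "h \<in> borel_measurable borel"
  shows "norm_L2 (avg n) h = sqrt (1 / measure haar (A n) * (LINT t:A n|haar. (cmod (h t))\<^sup>2))"
  using integral_avg[of "\<lambda>t. (cmod (h t))\<^sup>2" n] assms by (simp add: norm_L2_def)

lemma besicovitch_norm_le_iff:
  assumes "h \<in> borel_measurable borel"
  shows "besicovitch_norm haar A h \<le> ereal r \<longleftrightarrow> besicovitch_le h r"
proof -
  have "besicovitch_norm haar A h \<le> ereal r \<longleftrightarrow>
      (\<forall>y>ereal r. \<forall>\<^sub>F n in sequentially. ereal (norm_L2 (avg n) h) < y)"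
    unfolding besicovitch_norm_def norm_L2_avg[OF assms] by (rule Limsup_le_iff)
  also have "\<dots> \<longleftrightarrow> besicovitch_le h r"
    unfolding besicovitch_le_def
  proof (intro iffI allI impI)
    fix \<delta> assume *: "\<forall>y>ereal r. \<forall>\<^sub>F n in sequentially. ereal (norm_L2 (avg n) h) < y" and "r < \<delta>"
    then show "\<forall>\<^sub>F n in sequentially. norm_L2 (avg n) h < \<delta>" using *[rule_format, of "ereal \<delta>"] by simp
  next
    fix y assume *: "\<forall>\<delta>>r. \<forall>\<^sub>F n in sequentially. norm_L2 (avg n) h < \<delta>" and y: "ereal r < y"
    show "\<forall>\<^sub>F n in sequentially. ereal (norm_L2 (avg n) h) < y"
    proof (cases y)
      case (real \<delta>)
      then show ?thesis using * y by simp
    qed (use y in simp_all)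
  qed
  finally show ?thesis .
qed

lemma besicovitch_le_mono: "besicovitch_le h r \<Longrightarrow> r \<le> s \<Longrightarrow> besicovitch_le h s"
  unfolding besicovitch_le_def by simp

lemma besicovitch_le_less: "besicovitch_le h r \<Longrightarrow> r < \<delta> \<Longrightarrow> \<forall>\<^sub>F n in sequentially. norm_L2 (avg n) h < \<delta>"
  unfolding besicovitch_le_def by blast

lemma besicovitch_leI: "(\<And>\<delta>. r < \<delta> \<Longrightarrow> \<forall>\<^sub>F n in sequentially. norm_L2 (avg n) h < \<delta>) \<Longrightarrow> besicovitch_le h r"
  unfolding besicovitch_le_def by blast

lemma besicovitch_le_add:
  assumes "f \<in> Cb" "g \<in> Cb" "besicovitch_le f r" "besicovitch_le g s"
  shows "besicovitch_le (\<lambda>t. f t + g t) (r + s)"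
proof (rule besicovitch_leI)
  fix \<delta> assume "r + s < \<delta>"
  define d where "d = (\<delta> - r - s) / 2"
  have d: "r < r + d" "s < s + d" "(r + d) + (s + d) = \<delta>" using \<open>r + s < \<delta>\<close> by (simp_all add: d_def)
  show "\<forall>\<^sub>F n in sequentially. norm_L2 (avg n) (\<lambda>t. f t + g t) < \<delta>"
    using besicovitch_le_less[OF assms(3) d(1)] besicovitch_le_less[OF assms(4) d(2)]
  proof eventually_elim
    case (elim n)
    then show ?case using norm_L2_triangle[OF Cb_L2[OF assms(1), of n] Cb_L2[OF assms(2), of n]] d(3) by linarith
  qed
qed

lemma besicovitch_le_bounded_mult:
  assumes f: "f \<in> Cb" and C: "\<And>t. cmod (f t) \<le> C" and g: "g \<in> Cb" "besicovitch_le g r" and r: "0 \<le> r"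
  shows "besicovitch_le (\<lambda>t. f t * g t) (C * r)"
proof (rule besicovitch_leI)
  fix \<delta> assume \<delta>: "C * r < \<delta>"
  have C0: "0 \<le> C" using order_trans[OF norm_ge_zero C] .
  have le: "norm_L2 (avg n) (\<lambda>t. f t * g t) \<le> C * norm_L2 (avg n) g" for n
  proof -
    have "(LINT t|avg n. (cmod (f t * g t))\<^sup>2) \<le> (LINT t|avg n. C\<^sup>2 * (cmod (g t))\<^sup>2)"
    proof (rule integral_mono)
      show "integrable (avg n) (\<lambda>t. (cmod (f t * g t))\<^sup>2)" by (rule L2_integrable[OF Cb_L2[OF Cb_mult[OF f g(1)]]])
      show "integrable (avg n) (\<lambda>t. C\<^sup>2 * (cmod (g t))\<^sup>2)" by (intro integrable_mult_right L2_integrable[OF Cb_L2[OF g(1)]])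
      show "(cmod (f t * g t))\<^sup>2 \<le> C\<^sup>2 * (cmod (g t))\<^sup>2" for t
        unfolding norm_mult power_mult_distrib by (intro mult_right_mono power_mono C) simp_all
    qed
    also have "\<dots> = (C * norm_L2 (avg n) g)\<^sup>2" by (simp add: power_mult_distrib norm_L2_sq)
    finally have "(norm_L2 (avg n) (\<lambda>t. f t * g t))\<^sup>2 \<le> (C * norm_L2 (avg n) g)\<^sup>2" by (simp add: norm_L2_sq)
    then show ?thesis by (rule power2_le_imp_le) (simp add: C0)
  qed
  define d where "d = (\<delta> - C * r) / (C + 1)"
  have d: "0 < d" using \<delta> C0 by (simp add: d_def)
  have "C * d \<le> (C + 1) * d" using d by (intro mult_right_mono) simp_all
  also have "(C + 1) * d = \<delta> - C * r" using C0 by (simp add: d_def)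
  finally have Cd: "C * (r + d) \<le> \<delta>" by (simp add: distrib_left)
  have "r < r + d" using d by simp
  from besicovitch_le_less[OF g(2) this] show "\<forall>\<^sub>F n in sequentially. norm_L2 (avg n) (\<lambda>t. f t * g t) < \<delta>"
  proof eventually_elim
    case (elim n)
    show ?case
    proof (cases "C = 0")
      case True
      then show ?thesis using le[of n] \<delta> by simp
    next
      case False
      then have "C * norm_L2 (avg n) g < C * (r + d)" using elim C0 by (intro mult_strict_left_mono) simp_all
      then show ?thesis using le[of n] Cd by linarith
    qed
  qed
qed

lemma besicovitch_le_scale: "g \<in> Cb \<Longrightarrow> besicovitch_le g r \<Longrightarrow> 0 \<le> r \<Longrightarrow> besicovitch_le (\<lambda>t. c * g t) (cmod c * r)"
  by (rule besicovitch_le_bounded_mult[OF Cb_const]) simp_all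

lemma besicovitch_le_sup: "(\<And>t. cmod (h t) \<le> r) \<Longrightarrow> h \<in> Cb \<Longrightarrow> besicovitch_le h r"
proof (rule besicovitch_leI)
  fix \<delta> assume h: "\<And>t. cmod (h t) \<le> r" "h \<in> Cb" "r < \<delta>"
  have "norm_L2 (avg n) h \<le> r" for n
    using h(1) order_trans[OF norm_ge_zero h(1)]
    by (intro norm_L2_bounded[OF prob_space_avg measurable_avg[OF Cb_measurable[OF h(2)]]] AE_I2)
  then show "\<forall>\<^sub>F n in sequentially. norm_L2 (avg n) h < \<delta>" using h(3) by (intro always_eventually allI) (rule le_less_trans)
qed

text \<open>
  The average of \<open>\<bar>h\<bar>\<^sup>2\<close> is asymptotically invariant under translations.
\<close>

lemma besicovitch_le_shift:
  assumes h: "h \<in> Cb" "besicovitch_le h r" and r: "0 \<le> r"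
  shows "besicovitch_le (\<lambda>s. h (s + t)) r"
proof (rule besicovitch_leI)
  fix \<delta> assume \<delta>: "r < \<delta>"
  define \<delta>' where "\<delta>' = (r + \<delta>) / 2"
  have \<delta>': "r < \<delta>'" "\<delta>' < \<delta>" "0 \<le> \<delta>'" using \<delta> r by (simp_all add: \<delta>'_def)
  define k where "k s = h s * cnj (h s)" for s
  have k: "k \<in> Cb" unfolding k_def by (intro Cb_mult Cb_cnj h)
  have kn: "(LINT s|avg n. k s) = of_real ((norm_L2 (avg n) h)\<^sup>2)" for n
    unfolding k_def using inner_L2_self[of "avg n" h] by (simp add: inner_L2_def)
  have kns: "(LINT s|avg n. k (s + t)) = of_real ((norm_L2 (avg n) (\<lambda>s. h (s + t)))\<^sup>2)" for n
    unfolding k_def using inner_L2_self[of "avg n" "\<lambda>s. h (s + t)"] by (simp add: inner_L2_def)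
  have "\<delta>'\<^sup>2 < \<delta>\<^sup>2" using \<delta>' by (intro power_strict_mono) simp_all
  then have "0 < \<delta>\<^sup>2 - \<delta>'\<^sup>2" by simp
  from tendstoD[OF avg_shift[OF k, of t] this]
  have "\<forall>\<^sub>F n in sequentially. cmod ((LINT s|avg n. k (s + t)) - (LINT s|avg n. k s)) < \<delta>\<^sup>2 - \<delta>'\<^sup>2"
    by (simp add: dist_norm)
  with besicovitch_le_less[OF h(2) \<delta>'(1)] show "\<forall>\<^sub>F n in sequentially. norm_L2 (avg n) (\<lambda>s. h (s + t)) < \<delta>"
  proof eventually_elim
    case (elim n)
    have "(LINT s|avg n. k (s + t)) - (LINT s|avg n. k s)
        = of_real ((norm_L2 (avg n) (\<lambda>s. h (s + t)))\<^sup>2 - (norm_L2 (avg n) h)\<^sup>2)"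
      by (simp add: kn kns)
    then have "\<bar>(norm_L2 (avg n) (\<lambda>s. h (s + t)))\<^sup>2 - (norm_L2 (avg n) h)\<^sup>2\<bar> < \<delta>\<^sup>2 - \<delta>'\<^sup>2"
      using elim(2) by (simp only: norm_of_real)
    moreover have "(norm_L2 (avg n) h)\<^sup>2 < \<delta>'\<^sup>2" using elim(1) by (intro power_strict_mono) simp_all
    ultimately have "(norm_L2 (avg n) (\<lambda>s. h (s + t)))\<^sup>2 < \<delta>\<^sup>2" by linarith
    then show ?case by (rule power_less_imp_less_base) (use \<delta> r in simp)
  qed
qed

end

section \<open>Besicovitch almost periodic continuous functions\<close>

context van_Hove_sequence
begin

text \<open>
  The continuous functions in \<open>Bap2\<close> (see \<open>BAP_iff_Bap2\<close>).
\<close>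

definition BAP :: "('g \<Rightarrow> complex) set" where
  "BAP = {h \<in> Cb. \<forall>\<epsilon>>0. \<exists>p\<in>linear_combinations dual_group. besicovitch_le (\<lambda>t. h t - p t) \<epsilon>}"

lemma BAP_Cb: "h \<in> BAP \<Longrightarrow> h \<in> Cb"
  by (simp add: BAP_def)

lemma BAP_approx:
  assumes "h \<in> BAP" "0 < \<epsilon>"
  obtains p where "p \<in> linear_combinations dual_group" "besicovitch_le (\<lambda>t. h t - p t) \<epsilon>"
  using assms unfolding BAP_def by blast

lemma BAP_iff_Bap2: "h \<in> Cb \<Longrightarrow> h \<in> BAP \<longleftrightarrow> h \<in> Bap2 haar A"
proof -
  assume h: "h \<in> Cb"
  have "besicovitch_norm haar A (\<lambda>t. h t - p t) \<le> ereal \<epsilon> \<longleftrightarrow> besicovitch_le (\<lambda>t. h t - p t) \<epsilon>"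
    if "p \<in> linear_combinations dual_group" for p \<epsilon>
    by (rule besicovitch_norm_le_iff[OF Cb_measurable[OF Cb_diff[OF h trig_Cb[OF that]]]])
  moreover have "bounded (range h)" using h by (simp add: Cb_def)
  ultimately show ?thesis using h Cb_measurable[OF h] by (simp add: BAP_def Bap2_def)
qed

lemma trig_mult:
  assumes "p \<in> linear_combinations dual_group" "q \<in> linear_combinations (dual_group :: ('g \<Rightarrow> complex) set)"
  shows "(\<lambda>t. p t * q t) \<in> linear_combinations dual_group"
proof -
  obtain S c where S: "finite S" "S \<subseteq> dual_group" "p = (\<lambda>x. \<Sum>e\<in>S. c e * e x)"
    using assms(1) unfolding linear_combinations_def by blast
  obtain R d where R: "finite R" "R \<subseteq> dual_group" "q = (\<lambda>x. \<Sum>f\<in>R. d f * f x)"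
    using assms(2) unfolding linear_combinations_def by blast
  have "(\<lambda>x. \<Sum>f\<in>R. d f * (e x * f x)) \<in> linear_combinations dual_group" if "e \<in> S" for e
  proof (rule linear_combinations_sum)
    fix f assume "f \<in> R"
    then have "(\<lambda>x. e x * f x) \<in> dual_group" using that S(2) R(2) dual_mult by blast
    then show "(\<lambda>x. e x * f x) \<in> linear_combinations dual_group" by (rule linear_combinations_mem)
  qed
  then have "(\<lambda>x. \<Sum>e\<in>S. c e * (\<Sum>f\<in>R. d f * (e x * f x))) \<in> linear_combinations dual_group"
    by (rule linear_combinations_sum)
  moreover have "p x * q x = (\<Sum>e\<in>S. c e * (\<Sum>f\<in>R. d f * (e x * f x)))" for x
  proof -
    have "p x * q x = (\<Sum>e\<in>S. (c e * e x) * (\<Sum>f\<in>R. d f * f x))"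
      unfolding S(3) R(3) by (rule sum_distrib_right)
    also have "\<dots> = (\<Sum>e\<in>S. c e * (\<Sum>f\<in>R. d f * (e x * f x)))"
      by (intro sum.cong refl) (simp add: sum_distrib_left ac_simps)
    finally show ?thesis .
  qed
  ultimately show ?thesis by simp
qed

lemma trig_cnj:
  assumes "p \<in> linear_combinations (dual_group :: ('g \<Rightarrow> complex) set)"
  shows "(\<lambda>t. cnj (p t)) \<in> linear_combinations dual_group"
proof -
  obtain S c where S: "finite S" "S \<subseteq> dual_group" "p = (\<lambda>x. \<Sum>e\<in>S. c e * e x)"
    using assms(1) unfolding linear_combinations_def by blast
  have "(\<lambda>x. \<Sum>e\<in>S. cnj (c e) * cnj (e x)) \<in> linear_combinations dual_group"
    using S(2) by (intro linear_combinations_sum linear_combinations_mem dual_cnj) (rule subsetD)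
  then show ?thesis unfolding S(3) by simp
qed

lemma BAP_trig: "p \<in> linear_combinations dual_group \<Longrightarrow> p \<in> BAP"
  unfolding BAP_def mem_Collect_eq
proof (intro conjI allI impI bexI)
  fix \<epsilon> :: real assume "0 < \<epsilon>" "p \<in> linear_combinations dual_group"
  then show "besicovitch_le (\<lambda>t. p t - p t) \<epsilon>" by (intro besicovitch_le_sup) (simp_all add: Cb_const)
qed (simp_all add: trig_Cb)

lemma BAP_dual: "\<xi> \<in> dual_group \<Longrightarrow> \<xi> \<in> BAP"
  by (rule BAP_trig[OF linear_combinations_mem])

lemma BAP_const: "(\<lambda>t. c) \<in> BAP"
  using BAP_trig[OF linear_combinations_scale[OF linear_combinations_mem[OF dual_one]], of c] by simp

lemma BAP_limit:
  assumes h: "h \<in> Cb" and app: "\<And>\<epsilon>. 0 < \<epsilon> \<Longrightarrow> \<exists>k\<in>BAP. besicovitch_le (\<lambda>t. h t - k t) \<epsilon>"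
  shows "h \<in> BAP"
  unfolding BAP_def mem_Collect_eq
proof (intro conjI allI impI h)
  fix \<epsilon> :: real assume "0 < \<epsilon>"
  then have e: "0 < \<epsilon> / 2" by simp
  obtain k where k: "k \<in> BAP" "besicovitch_le (\<lambda>t. h t - k t) (\<epsilon> / 2)" using app[OF e] by blast
  obtain p where p: "p \<in> linear_combinations dual_group" "besicovitch_le (\<lambda>t. k t - p t) (\<epsilon> / 2)"
    using BAP_approx[OF k(1) e] by blast
  have "besicovitch_le (\<lambda>t. (h t - k t) + (k t - p t)) (\<epsilon> / 2 + \<epsilon> / 2)"
    by (intro besicovitch_le_add Cb_diff h BAP_Cb[OF k(1)] trig_Cb[OF p(1)] k(2) p(2))
  then have "besicovitch_le (\<lambda>t. h t - p t) \<epsilon>" by simp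
  then show "\<exists>p\<in>linear_combinations dual_group. besicovitch_le (\<lambda>t. h t - p t) \<epsilon>" using p(1) by blast
qed

lemma BAP_add:
  assumes "f \<in> BAP" "g \<in> BAP"
  shows "(\<lambda>t. f t + g t) \<in> BAP"
proof (rule BAP_limit[OF Cb_add[OF BAP_Cb[OF assms(1)] BAP_Cb[OF assms(2)]]])
  fix \<epsilon> :: real assume "0 < \<epsilon>"
  then have e: "0 < \<epsilon> / 2" by simp
  obtain p where p: "p \<in> linear_combinations dual_group" "besicovitch_le (\<lambda>t. f t - p t) (\<epsilon> / 2)"
    using BAP_approx[OF assms(1) e] by blast
  obtain q where q: "q \<in> linear_combinations dual_group" "besicovitch_le (\<lambda>t. g t - q t) (\<epsilon> / 2)"
    using BAP_approx[OF assms(2) e] by blast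
  have "besicovitch_le (\<lambda>t. (f t - p t) + (g t - q t)) (\<epsilon> / 2 + \<epsilon> / 2)"
    by (intro besicovitch_le_add Cb_diff BAP_Cb assms trig_Cb p q)
  then have "besicovitch_le (\<lambda>t. (f t + g t) - (p t + q t)) \<epsilon>" by (simp add: algebra_simps)
  moreover have "(\<lambda>t. p t + q t) \<in> BAP" by (rule BAP_trig[OF linear_combinations_add[OF p(1) q(1)]])
  ultimately show "\<exists>k\<in>BAP. besicovitch_le (\<lambda>t. f t + g t - k t) \<epsilon>" by (intro bexI[of _ "\<lambda>t. p t + q t"])
qed

lemma Cb_bound:
  assumes "f \<in> Cb"
  shows "\<exists>C>0. \<forall>t. cmod (f t) \<le> C"
proof -
  have "bounded (range f)" using assms by (simp add: Cb_def)
  then show ?thesis unfolding bounded_pos by blast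
qed

text \<open>
  In \<open>f g - p q = f (g - q) + q (f - p)\<close> the polynomial \<open>q\<close> is chosen first, and then \<open>p\<close> with an accuracy
  that depends on the bound of \<open>q\<close>.
\<close>

lemma BAP_mult:
  assumes "f \<in> BAP" "g \<in> BAP"
  shows "(\<lambda>t. f t * g t) \<in> BAP"
proof (rule BAP_limit[OF Cb_mult[OF BAP_Cb[OF assms(1)] BAP_Cb[OF assms(2)]]])
  fix \<epsilon> :: real assume \<epsilon>: "0 < \<epsilon>"
  obtain C where C: "0 < C" "\<And>t. cmod (f t) \<le> C"
    using Cb_bound[OF BAP_Cb[OF assms(1)]] by blast
  have e: "0 < \<epsilon> / 2 / C" using \<epsilon> C by simp
  obtain q where q: "q \<in> linear_combinations dual_group" "besicovitch_le (\<lambda>t. g t - q t) (\<epsilon> / 2 / C)"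
    using BAP_approx[OF assms(2) e] by blast
  obtain D where D: "0 < D" "\<And>t. cmod (q t) \<le> D"
    using Cb_bound[OF trig_Cb[OF q(1)]] by blast
  have e': "0 < \<epsilon> / 2 / D" using \<epsilon> D by simp
  obtain p where p: "p \<in> linear_combinations dual_group" "besicovitch_le (\<lambda>t. f t - p t) (\<epsilon> / 2 / D)"
    using BAP_approx[OF assms(1) e'] by blast
  have "besicovitch_le (\<lambda>t. f t * (g t - q t)) (C * (\<epsilon> / 2 / C))"
    using e by (intro besicovitch_le_bounded_mult Cb_diff BAP_Cb assms C(2) trig_Cb q) simp
  moreover have "besicovitch_le (\<lambda>t. q t * (f t - p t)) (D * (\<epsilon> / 2 / D))"
    using e' by (intro besicovitch_le_bounded_mult Cb_diff BAP_Cb assms D(2) trig_Cb p q(1)) simp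
  ultimately have "besicovitch_le (\<lambda>t. f t * (g t - q t) + q t * (f t - p t)) (C * (\<epsilon> / 2 / C) + D * (\<epsilon> / 2 / D))"
    by (intro besicovitch_le_add Cb_mult Cb_diff BAP_Cb assms trig_Cb p(1) q(1))
  moreover have "C * (\<epsilon> / 2 / C) + D * (\<epsilon> / 2 / D) = \<epsilon>" using C(1) D(1) by simp
  moreover have "f t * (g t - q t) + q t * (f t - p t) = f t * g t - p t * q t" for t by (simp add: algebra_simps)
  ultimately have "besicovitch_le (\<lambda>t. f t * g t - p t * q t) \<epsilon>" by simp
  moreover have "(\<lambda>t. p t * q t) \<in> BAP" by (rule BAP_trig[OF trig_mult[OF p(1) q(1)]])
  ultimately show "\<exists>k\<in>BAP. besicovitch_le (\<lambda>t. f t * g t - k t) \<epsilon>" by (intro bexI[of _ "\<lambda>t. p t * q t"])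
qed

lemma BAP_scale: "f \<in> BAP \<Longrightarrow> (\<lambda>t. c * f t) \<in> BAP"
  by (rule BAP_mult[OF BAP_const])

lemma besicovitch_le_cnj: "besicovitch_le (\<lambda>t. cnj (h t)) r \<longleftrightarrow> besicovitch_le h r"
  by (simp add: besicovitch_le_def norm_L2_def)

lemma BAP_cnj:
  assumes "f \<in> BAP"
  shows "(\<lambda>t. cnj (f t)) \<in> BAP"
proof (rule BAP_limit[OF Cb_cnj[OF BAP_Cb[OF assms]]])
  fix \<epsilon> :: real assume "0 < \<epsilon>"
  then obtain p where p: "p \<in> linear_combinations dual_group" "besicovitch_le (\<lambda>t. f t - p t) \<epsilon>"
    using BAP_approx[OF assms] by blast
  have "besicovitch_le (\<lambda>t. cnj (f t) - cnj (p t)) \<epsilon>" using p(2) besicovitch_le_cnj[of "\<lambda>t. f t - p t"] by simp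
  then show "\<exists>k\<in>BAP. besicovitch_le (\<lambda>t. cnj (f t) - k t) \<epsilon>"
    by (rule bexI[OF _ BAP_trig[OF trig_cnj[OF p(1)]]])
qed

lemma avg_norm_le:
  assumes "f \<in> Cb" "g \<in> Cb"
  shows "cmod (inner_L2 (avg n) f g) \<le> norm_L2 (avg n) f * norm_L2 (avg n) g"
  by (rule Cauchy_Schwarz_L2[OF Cb_L2[OF assms(1)] Cb_L2[OF assms(2)]])

lemma norm_L2_one: "norm_L2 (avg n) (\<lambda>t. 1) = 1"
  using prob_space.prob_space[OF prob_space_avg, of n] by (simp add: norm_L2_def)

lemma norm_L2_dual: "\<xi> \<in> dual_group \<Longrightarrow> norm_L2 (avg n) \<xi> = 1"
  using prob_space.prob_space[OF prob_space_avg, of n] by (simp add: norm_L2_def dual_norm[of \<xi>])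

lemma avg_le_norm:
  assumes "f \<in> Cb"
  shows "cmod (LINT t|avg n. f t) \<le> norm_L2 (avg n) f"
  using avg_norm_le[OF assms Cb_const[of 1], of n] by (simp add: inner_L2_def norm_L2_one)

lemma integrable_Cb: "f \<in> Cb \<Longrightarrow> integrable (avg n) f"
  using L2_integrable_prod[OF Cb_L2[of f n] Cb_L2[OF Cb_const[of 1], of n]] by simp

lemma avg_diff: "f \<in> Cb \<Longrightarrow> g \<in> Cb \<Longrightarrow>
    (LINT t|avg n. f t - g t) = (LINT t|avg n. f t) - (LINT t|avg n. g t)"
  by (intro Bochner_Integration.integral_diff integrable_Cb)

lemma trig_mean:
  assumes "p \<in> linear_combinations dual_group"
  shows "convergent (\<lambda>n. LINT t|avg n. p t)"
proof -
  obtain S c where S: "finite S" "S \<subseteq> dual_group" "p = (\<lambda>x. \<Sum>e\<in>S. c e * e x)"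
    using assms(1) unfolding linear_combinations_def by blast
  have "(LINT t|avg n. p t) = (\<Sum>e\<in>S. c e * inner_L2 (avg n) e (\<lambda>t. 1))" for n
  proof -
    have "(LINT t|avg n. p t) = inner_L2 (avg n) p (\<lambda>t. 1)" by (simp add: inner_L2_def)
    also have "\<dots> = (\<Sum>e\<in>S. c e * inner_L2 (avg n) e (\<lambda>t. 1))"
      unfolding S(3) using S(2) by (intro inner_L2_sum_left S(1) Cb_L2 Cb_const) (rule dual_Cb, rule subsetD)
    finally show ?thesis .
  qed
  moreover have "(\<lambda>n. \<Sum>e\<in>S. c e * inner_L2 (avg n) e (\<lambda>t. 1)) \<longlonglongrightarrow> (\<Sum>e\<in>S. c e * (if e = (\<lambda>t. 1) then 1 else 0))"
    using S(2) by (intro tendsto_sum tendsto_mult_left orthogonal_characters dual_one) (rule subsetD)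
  ultimately show ?thesis unfolding convergent_def by auto
qed

text \<open>
  Trigonometric polynomials have means, and averages depend continuously on the function in the Besicovitch
  seminorm.
\<close>

lemma BAP_mean:
  assumes h: "h \<in> BAP"
  shows "convergent (\<lambda>n. LINT t|avg n. h t)"
proof (rule Cauchy_convergent, rule metric_CauchyI)
  fix \<epsilon> :: real assume \<epsilon>: "0 < \<epsilon>"
  then have e: "0 < \<epsilon> / 4" by simp
  obtain p where p: "p \<in> linear_combinations dual_group" "besicovitch_le (\<lambda>t. h t - p t) (\<epsilon> / 4)"
    using BAP_approx[OF h e] by blast
  have "\<epsilon> / 4 < \<epsilon> / 3" "0 < \<epsilon> / 3" using \<epsilon> by simp_all
  obtain N where N: "\<And>n. n \<ge> N \<Longrightarrow> norm_L2 (avg n) (\<lambda>t. h t - p t) < \<epsilon> / 3"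
    using besicovitch_le_less[OF p(2) \<open>\<epsilon> / 4 < \<epsilon> / 3\<close>] unfolding eventually_sequentially by blast
  have "Cauchy (\<lambda>n. LINT t|avg n. p t)" by (rule convergent_Cauchy[OF trig_mean[OF p(1)]])
  then obtain M where M: "\<And>m n. m \<ge> M \<Longrightarrow> n \<ge> M \<Longrightarrow> dist (LINT t|avg m. p t) (LINT t|avg n. p t) < \<epsilon> / 3"
    using \<open>0 < \<epsilon> / 3\<close> unfolding Cauchy_def by meson
  have near: "dist (LINT t|avg n. h t) (LINT t|avg n. p t) < \<epsilon> / 3" if "n \<ge> N" for n
    using avg_le_norm[OF Cb_diff[OF BAP_Cb[OF h] trig_Cb[OF p(1)]], of n] N[OF that]
      avg_diff[OF BAP_Cb[OF h] trig_Cb[OF p(1)], of n] by (simp add: dist_norm)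
  have "dist (LINT t|avg m. h t) (LINT t|avg n. h t) < \<epsilon>" if mn: "m \<ge> max M N" "n \<ge> max M N" for m n
  proof -
    have "dist (LINT t|avg m. h t) (LINT t|avg n. h t)
        \<le> dist (LINT t|avg m. h t) (LINT t|avg m. p t)
          + (dist (LINT t|avg m. p t) (LINT t|avg n. p t) + dist (LINT t|avg n. h t) (LINT t|avg n. p t))"
      using dist_triangle[of "LINT t|avg m. h t" "LINT t|avg n. h t" "LINT t|avg m. p t"]
        dist_triangle[of "LINT t|avg m. p t" "LINT t|avg n. h t" "LINT t|avg n. p t"]
        dist_commute[of "LINT t|avg n. h t" "LINT t|avg n. p t"] by linarith
    moreover have "m \<ge> M" "m \<ge> N" "n \<ge> M" "n \<ge> N" using mn by simp_all
    ultimately show ?thesis using near[of m] near[of n] M[of m n] by linarith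
  qed
  then show "\<exists>M. \<forall>m\<ge>M. \<forall>n\<ge>M. dist (LINT t|avg m. h t) (LINT t|avg n. h t) < \<epsilon>" by blast
qed

definition mean :: "('g \<Rightarrow> complex) \<Rightarrow> complex" where
  "mean h = lim (\<lambda>n. LINT t|avg n. h t)"

lemma mean_LIMSEQ: "h \<in> BAP \<Longrightarrow> (\<lambda>n. LINT t|avg n. h t) \<longlonglongrightarrow> mean h"
  unfolding mean_def using BAP_mean by (simp only: convergent_LIMSEQ_iff)

lemma mean_shift:
  assumes "h \<in> BAP" "(\<lambda>s. h (s + t)) \<in> BAP"
  shows "mean (\<lambda>s. h (s + t)) = mean h"
proof -
  have "(\<lambda>n. (LINT s|avg n. h (s + t)) - (LINT s|avg n. h s)) \<longlonglongrightarrow> mean (\<lambda>s. h (s + t)) - mean h"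
    by (intro tendsto_diff mean_LIMSEQ assms)
  from LIMSEQ_unique[OF this avg_shift[OF BAP_Cb[OF assms(1)]]] show ?thesis by simp
qed

text \<open>
  In the limit the characters are orthonormal, so the distance of \<open>h\<close> to a trigonometric polynomial is computed
  by completing the square.
\<close>

lemma trig_distance:
  assumes h: "h \<in> Cb" and H: "(\<lambda>n. (norm_L2 (avg n) h)\<^sup>2) \<longlonglongrightarrow> H"
    and S: "finite S" and \<xi>: "\<And>i. i \<in> S \<Longrightarrow> \<xi> i \<in> dual_group" and inj: "inj_on \<xi> S"
    and a: "\<And>i. i \<in> S \<Longrightarrow> (\<lambda>n. inner_L2 (avg n) h (\<xi> i)) \<longlonglongrightarrow> a i"
  shows "(\<lambda>n. (norm_L2 (avg n) (\<lambda>t. h t - (\<Sum>i\<in>S. c i * \<xi> i t)))\<^sup>2)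
    \<longlonglongrightarrow> H - (\<Sum>i\<in>S. (cmod (a i))\<^sup>2) + (\<Sum>i\<in>S. (cmod (a i - c i))\<^sup>2)"
proof -
  have orth: "(\<lambda>n. inner_L2 (avg n) (\<xi> i) (\<xi> j)) \<longlonglongrightarrow> (if i = j then 1 else 0)" if "i \<in> S" "j \<in> S" for i j
  proof -
    have "\<xi> i = \<xi> j \<longleftrightarrow> i = j" using inj that by (rule inj_on_eq_iff)
    then show ?thesis using orthogonal_characters[OF \<xi>[OF that(1)] \<xi>[OF that(2)]] by simp
  qed
  have "(\<lambda>n. (norm_L2 (avg n) h)\<^sup>2 - 2 * Re (\<Sum>i\<in>S. cnj (c i) * inner_L2 (avg n) h (\<xi> i))
      + Re (\<Sum>i\<in>S. \<Sum>j\<in>S. c i * cnj (c j) * inner_L2 (avg n) (\<xi> i) (\<xi> j)))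
    \<longlonglongrightarrow> H - 2 * Re (\<Sum>i\<in>S. cnj (c i) * a i)
      + Re (\<Sum>i\<in>S. \<Sum>j\<in>S. c i * cnj (c j) * (if i = j then 1 else 0))"
    by (intro tendsto_add tendsto_diff H tendsto_mult_left tendsto_Re tendsto_sum a orth)
  moreover have "H - 2 * Re (\<Sum>i\<in>S. cnj (c i) * a i)
      + Re (\<Sum>i\<in>S. \<Sum>j\<in>S. c i * cnj (c j) * (if i = j then 1 else 0))
    = H - (\<Sum>i\<in>S. (cmod (a i))\<^sup>2) + (\<Sum>i\<in>S. (cmod (a i - c i))\<^sup>2)"
    unfolding double_sum_orthonormal[OF S] by (rule complete_square[OF S])
  moreover have "(norm_L2 (avg n) (\<lambda>t. h t - (\<Sum>i\<in>S. c i * \<xi> i t)))\<^sup>2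
      = (norm_L2 (avg n) h)\<^sup>2 - 2 * Re (\<Sum>i\<in>S. cnj (c i) * inner_L2 (avg n) h (\<xi> i))
      + Re (\<Sum>i\<in>S. \<Sum>j\<in>S. c i * cnj (c j) * inner_L2 (avg n) (\<xi> i) (\<xi> j))" for n
    by (intro norm_L2_diff_comb_sq Cb_L2 h S dual_Cb \<xi>)
  ultimately show ?thesis by (simp only:)
qed

text \<open>
  The midpoint of two distinct points of the unit circle lies inside the disc.
\<close>

lemma cmod_half_one_plus:
  assumes "cmod w = 1" "w \<noteq> 1"
  shows "cmod ((1 + w) / 2) < 1"
proof -
  have "(Re w)\<^sup>2 + (Im w)\<^sup>2 = 1" using assms(1) by (metis cmod_power2 power_one)
  moreover have "Re w < 1"
  proof (rule ccontr)
    assume "\<not> Re w < 1"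
    moreover have "Re w \<le> 1" using complex_Re_le_cmod[of w] assms(1) by simp
    ultimately have "Re w = 1" by simp
    then have "Im w = 0" using \<open>(Re w)\<^sup>2 + (Im w)\<^sup>2 = 1\<close> by simp
    with \<open>Re w = 1\<close> have "w = 1" by (simp add: complex_eq_iff)
    with assms(2) show False by simp
  qed
  ultimately have "(1 + Re w)\<^sup>2 + (Im w)\<^sup>2 < 4" by (simp add: power2_sum)
  then have "(cmod (1 + w))\<^sup>2 < 2\<^sup>2" by (simp add: cmod_power2)
  then have "cmod (1 + w) < 2" by (rule power_less_imp_less_base) simp
  then show ?thesis by (simp add: norm_divide)
qed

text \<open>
  The operator \<open>h \<mapsto> (h + cnj (\<xi> t) * h(\<cdot> + t)) / 2\<close> is a contraction for the Besicovitch seminorm. It fixes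
  \<open>\<xi>\<close> and multiplies a character \<open>\<eta>\<close> by a number of modulus less than \<open>1\<close> if \<open>\<eta> t \<noteq> \<xi> t\<close>. Iterating it removes one
  frequency of \<open>S\<close> after the other, at an arbitrarily small cost; the strict inequality \<open>r < r'\<close> leaves room for these
  costs.
\<close>

lemma isolate_frequency:
  fixes V :: "('g \<Rightarrow> complex) set"
  assumes V: "V \<subseteq> Cb" and closed: "\<And>h a b t. h \<in> V \<Longrightarrow> (\<lambda>s. a * h s + b * h (s + t)) \<in> V"
    and \<xi>: "\<xi> \<in> dual_group"
    and S: "finite S" "S \<subseteq> dual_group - {\<xi>}"
  shows "h \<in> V \<Longrightarrow> 0 \<le> r \<Longrightarrow> r < r' \<Longrightarrow> besicovitch_le (\<lambda>s. h s - (a * \<xi> s + (\<Sum>\<eta>\<in>S. c \<eta> * \<eta> s))) r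
    \<Longrightarrow> \<exists>h'\<in>V. besicovitch_le (\<lambda>s. h' s - a * \<xi> s) r'"
  using S
proof (induction S arbitrary: h r c rule: finite_induct)
  case empty
  then show ?case by (intro bexI[of _ h]) (simp_all add: besicovitch_le_mono)
next
  case (insert \<eta> S)
  have \<eta>: "\<eta> \<in> dual_group" "\<eta> \<noteq> \<xi>" and Sd: "S \<subseteq> dual_group - {\<xi>}" using insert.prems by auto
  obtain t where t: "\<eta> t \<noteq> \<xi> t" using \<eta>(2) by blast
  define z where "z \<theta> = (1 + cnj (\<xi> t) * \<theta> t) / 2" for \<theta> :: "'g \<Rightarrow> complex"
  have z\<xi>: "z \<xi> = 1" by (simp add: z_def dual_cnj_mult(2)[OF \<xi>])
  have "cmod (cnj (\<xi> t) * \<eta> t) = 1" using dual_norm[OF \<xi>] dual_norm[OF \<eta>(1)] by (simp add: norm_mult)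
  moreover have "cnj (\<xi> t) * \<eta> t \<noteq> 1"
  proof
    assume "cnj (\<xi> t) * \<eta> t = 1"
    then have "\<xi> t * cnj (\<xi> t) * \<eta> t = \<xi> t" by (simp only: mult.assoc mult_1_right)
    then show False using t dual_cnj_mult(1)[OF \<xi>] by simp
  qed
  ultimately have z\<eta>: "cmod (z \<eta>) < 1" unfolding z_def by (rule cmod_half_one_plus)
  \<comment> \<open>one averaging step multiplies the coefficient of \<open>\<theta>\<close> by \<open>z \<theta>\<close>\<close>
  have iterate: "\<exists>k\<in>V. besicovitch_le (\<lambda>s. k s - (a * \<xi> s + (\<Sum>\<theta>\<in>insert \<eta> S. (c \<theta> * z \<theta> ^ N) * \<theta> s))) r" for N
  proof (induction N)
    case 0
    then show ?case using insert.prems by (intro bexI[of _ h]) simp_all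
  next
    case (Suc N)
    then obtain k where k: "k \<in> V"
      "besicovitch_le (\<lambda>s. k s - (a * \<xi> s + (\<Sum>\<theta>\<in>insert \<eta> S. (c \<theta> * z \<theta> ^ N) * \<theta> s))) r" by blast
    define q where "q s = a * \<xi> s + (\<Sum>\<theta>\<in>insert \<eta> S. (c \<theta> * z \<theta> ^ N) * \<theta> s)" for s
    define f where "f s = k s - q s" for s
    have q: "q \<in> Cb"
      unfolding q_def using insert.prems \<xi> by (intro Cb_add Cb_scale Cb_sum dual_Cb) auto
    have f: "f \<in> Cb" unfolding f_def using k(1) V by (intro Cb_diff q) (rule subsetD)
    have fr: "besicovitch_le f r" using k(2) by (simp add: f_def[abs_def] q_def)
    have "besicovitch_le (\<lambda>s. (1 / 2) * f s + (cnj (\<xi> t) / 2) * f (s + t)) (cmod (1 / 2) * r + cmod (cnj (\<xi> t) / 2) * r)"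
      by (intro besicovitch_le_add besicovitch_le_scale Cb_scale Cb_shift f fr besicovitch_le_shift insert.prems(2))
    moreover have "cmod (1 / 2) * r + cmod (cnj (\<xi> t) / 2) * r = r"
      using dual_norm[OF \<xi>, of t] by (simp add: norm_divide)
    ultimately have 1: "besicovitch_le (\<lambda>s. (1 / 2) * f s + (cnj (\<xi> t) / 2) * f (s + t)) r" by simp
    define k' where "k' s = (1 / 2) * k s + (cnj (\<xi> t) / 2) * k (s + t)" for s
    have k': "k' \<in> V" unfolding k'_def by (rule closed[OF k(1)])
    have char: "(1 / 2) * \<theta> s + (cnj (\<xi> t) / 2) * \<theta> (s + t) = z \<theta> * \<theta> s" if "\<theta> \<in> dual_group" for \<theta> s
      by (simp add: dual_add[OF that] z_def field_simps)
    have "(1 / 2) * q s + (cnj (\<xi> t) / 2) * q (s + t)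
        = a * \<xi> s + (\<Sum>\<theta>\<in>insert \<eta> S. (c \<theta> * z \<theta> ^ Suc N) * \<theta> s)" for s
    proof -
      have "(1 / 2) * q s + (cnj (\<xi> t) / 2) * q (s + t)
          = a * ((1 / 2) * \<xi> s + (cnj (\<xi> t) / 2) * \<xi> (s + t))
            + (\<Sum>\<theta>\<in>insert \<eta> S. (c \<theta> * z \<theta> ^ N) * ((1 / 2) * \<theta> s + (cnj (\<xi> t) / 2) * \<theta> (s + t)))"
        unfolding q_def distrib_left sum.distrib sum_distrib_left by (simp only: ac_simps)
      also have "\<dots> = a * \<xi> s + (\<Sum>\<theta>\<in>insert \<eta> S. (c \<theta> * z \<theta> ^ Suc N) * \<theta> s)"
      proof (intro arg_cong2[where f = "(+)"] sum.cong refl)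
        show "a * ((1 / 2) * \<xi> s + (cnj (\<xi> t) / 2) * \<xi> (s + t)) = a * \<xi> s"
          unfolding char[OF \<xi>] z\<xi> by simp
        fix \<theta> assume "\<theta> \<in> insert \<eta> S"
        then have "\<theta> \<in> dual_group" using insert.prems by blast
        from char[OF this] show "(c \<theta> * z \<theta> ^ N) * ((1 / 2) * \<theta> s + (cnj (\<xi> t) / 2) * \<theta> (s + t))
            = (c \<theta> * z \<theta> ^ Suc N) * \<theta> s" by (simp only: power_Suc ac_simps)
      qed
      finally show ?thesis .
    qed
    then have "(1 / 2) * f s + (cnj (\<xi> t) / 2) * f (s + t)
        = k' s - (a * \<xi> s + (\<Sum>\<theta>\<in>insert \<eta> S. (c \<theta> * z \<theta> ^ Suc N) * \<theta> s))" for s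
      unfolding f_def k'_def right_diff_distrib by (metis (no_types, lifting) add_diff_add)
    with 1 have "besicovitch_le (\<lambda>s. k' s - (a * \<xi> s + (\<Sum>\<theta>\<in>insert \<eta> S. (c \<theta> * z \<theta> ^ Suc N) * \<theta> s))) r" by simp
    with k' show ?case by blast
  qed
  define d where "d = (r' - r) / 2"
  have "0 < d" unfolding d_def using insert.prems(3) by simp
  moreover have "r + d < r'" unfolding d_def using insert.prems(3) by (simp add: field_simps)
  ultimately have d: "0 < d" "r + d < r'" .
  have "(\<lambda>N. cmod (c \<eta>) * cmod (z \<eta>) ^ N) \<longlonglongrightarrow> cmod (c \<eta>) * 0"
    using z\<eta> by (intro tendsto_mult_left LIMSEQ_power_zero) simp
  then have "(\<lambda>N. cmod (c \<eta>) * cmod (z \<eta>) ^ N) \<longlonglongrightarrow> 0" by (simp only: mult_zero_right)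
  from order_tendstoD(2)[OF this d(1)] obtain N where N: "cmod (c \<eta>) * cmod (z \<eta>) ^ N < d"
    using eventually_happens'[OF sequentially_bot] by blast
  obtain k where k: "k \<in> V"
    "besicovitch_le (\<lambda>s. k s - (a * \<xi> s + (\<Sum>\<theta>\<in>insert \<eta> S. (c \<theta> * z \<theta> ^ N) * \<theta> s))) r" using iterate by blast
  have BC1: "(\<lambda>s. k s - (a * \<xi> s + (\<Sum>\<theta>\<in>insert \<eta> S. (c \<theta> * z \<theta> ^ N) * \<theta> s))) \<in> Cb"
  proof (rule Cb_diff)
    show "k \<in> Cb" using k(1) V by blast
    show "(\<lambda>s. a * \<xi> s + (\<Sum>\<theta>\<in>insert \<eta> S. (c \<theta> * z \<theta> ^ N) * \<theta> s)) \<in> Cb"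
      using insert.prems \<xi> by (intro Cb_add Cb_scale Cb_sum dual_Cb) auto
  qed
  have "besicovitch_le (\<lambda>s. (c \<eta> * z \<eta> ^ N) * \<eta> s) d"
  proof (rule besicovitch_le_sup)
    show "cmod ((c \<eta> * z \<eta> ^ N) * \<eta> s) \<le> d" for s
      using N dual_norm[OF \<eta>(1)] by (simp add: norm_mult norm_power)
    show "(\<lambda>s. (c \<eta> * z \<eta> ^ N) * \<eta> s) \<in> Cb" by (intro Cb_scale dual_Cb \<eta>(1))
  qed
  from besicovitch_le_add[OF BC1 Cb_scale[OF dual_Cb[OF \<eta>(1)]] k(2) this]
  have "besicovitch_le (\<lambda>s. k s - (a * \<xi> s + (\<Sum>\<theta>\<in>S. (c \<theta> * z \<theta> ^ N) * \<theta> s))) (r + d)"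
    using insert.hyps by (simp add: algebra_simps)
  from insert.IH[OF k(1) _ d(2) this Sd] show ?case using insert.prems(2) d(1) by simp
qed

end

section \<open>Eigenfunctions and orbits of a measure-preserving action\<close>

locale measure_preserving_action =
  fixes T :: "'g::{topological_ab_group_add, t2_space} \<Rightarrow> 'x \<Rightarrow> 'x" and m :: "'x measure"
  assumes prob: "prob_space m" and T_meas: "T t \<in> measurable m m" and T_distr: "distr m m (T t) = m"
begin

lemma integral_T:
  fixes f :: "'x \<Rightarrow> 'b::{banach, second_countable_topology}"
  assumes "f \<in> borel_measurable m"
  shows "(LINT x|m. f (T t x)) = (LINT x|m. f x)"
  using integral_distr[OF T_meas assms, of t] by (simp add: T_distr)

lemma measurable_T: "f \<in> borel_measurable m \<Longrightarrow> (\<lambda>x. f (T t x)) \<in> borel_measurable m"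
  using measurable_compose[OF T_meas] .

lemma L2_T:
  assumes "f \<in> L2 m"
  shows "(\<lambda>x. f (T t x)) \<in> L2 m"
proof -
  have "(\<lambda>x. (cmod (f x))\<^sup>2) \<in> borel_measurable m" using L2_measurable[OF assms] by measurable
  then have "integrable m (\<lambda>x. (cmod (f (T t x)))\<^sup>2)"
    using integrable_distr_eq[OF T_meas, of "\<lambda>x. (cmod (f x))\<^sup>2" t] L2_integrable[OF assms]
    by (simp add: T_distr)
  then show ?thesis using measurable_T[OF L2_measurable[OF assms]] by (simp add: L2_def)
qed

lemma norm_T:
  assumes "f \<in> L2 m"
  shows "norm_L2 m (\<lambda>x. f (T t x)) = norm_L2 m f"
proof -
  have "(\<lambda>x. (cmod (f x))\<^sup>2) \<in> borel_measurable m" using L2_measurable[OF assms] by measurable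
  from integral_T[OF this, of t] show ?thesis by (simp add: norm_L2_def)
qed

lemma inner_T:
  assumes "f \<in> L2 m" "g \<in> L2 m"
  shows "inner_L2 m (\<lambda>x. f (T t x)) (\<lambda>x. g (T t x)) = inner_L2 m f g"
proof -
  have "(\<lambda>x. f x * cnj (g x)) \<in> borel_measurable m"
    using L2_measurable[OF assms(1)] L2_measurable[OF assms(2)] by measurable
  from integral_T[OF this, of t] show ?thesis by (simp add: inner_L2_def)
qed

lemma inner_cong_AE:
  assumes "f \<in> L2 m" "f' \<in> L2 m" "g \<in> L2 m" "g' \<in> L2 m" "AE x in m. f x = f' x" "AE x in m. g x = g' x"
  shows "inner_L2 m f g = inner_L2 m f' g'"
  unfolding inner_L2_def
proof (rule integral_cong_AE)
  show "AE x in m. f x * cnj (g x) = f' x * cnj (g' x)" using assms(5,6) by eventually_elim simp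
  show "(\<lambda>x. f x * cnj (g x)) \<in> borel_measurable m"
    using L2_measurable[OF assms(1)] L2_measurable[OF assms(3)] by measurable
  show "(\<lambda>x. f' x * cnj (g' x)) \<in> borel_measurable m"
    using L2_measurable[OF assms(2)] L2_measurable[OF assms(4)] by measurable
qed

lemma eigenspaceD: "f \<in> eigenspace T m \<xi> \<Longrightarrow> f \<in> L2 m" "f \<in> eigenspace T m \<xi> \<Longrightarrow> AE x in m. f (T t x) = \<xi> t * f x"
  by (simp_all add: eigenspace_def)

text \<open>
  Invariance of the measure multiplies the inner product by \<open>\<xi> t * cnj (\<eta> t)\<close>, which differs from \<open>1\<close> for
  some \<open>t\<close>.
\<close>

lemma eigenspaces_orthogonal:
  assumes f: "f \<in> eigenspace T m \<xi>" and g: "g \<in> eigenspace T m \<eta>"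
    and \<xi>: "\<xi> \<in> dual_group" and \<eta>: "\<eta> \<in> dual_group" and ne: "\<xi> \<noteq> \<eta>"
  shows "inner_L2 m f g = 0"
proof -
  obtain t where t: "\<xi> t \<noteq> \<eta> t" using ne by blast
  have fL: "f \<in> L2 m" and gL: "g \<in> L2 m" using f g by (simp_all add: eigenspaceD)
  have "inner_L2 m f g = inner_L2 m (\<lambda>x. f (T t x)) (\<lambda>x. g (T t x))" by (rule inner_T[OF fL gL, symmetric])
  also have "\<dots> = inner_L2 m (\<lambda>x. \<xi> t * f x) (\<lambda>x. \<eta> t * g x)"
    by (intro inner_cong_AE L2_T L2_scale fL gL eigenspaceD(2)[OF f] eigenspaceD(2)[OF g])
  also have "\<dots> = (\<xi> t * cnj (\<eta> t)) * inner_L2 m f g"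
  proof -
    have "inner_L2 m (\<lambda>x. \<xi> t * f x) (\<lambda>x. \<eta> t * g x) = (LINT x|m. (\<xi> t * cnj (\<eta> t)) * (f x * cnj (g x)))"
      unfolding inner_L2_def by (simp add: ac_simps)
    then show ?thesis unfolding inner_L2_def by (simp only: integral_mult_right_zero)
  qed
  finally have "inner_L2 m f g * (1 - \<xi> t * cnj (\<eta> t)) = 0" by (simp add: algebra_simps)
  moreover have "\<xi> t * cnj (\<eta> t) \<noteq> 1"
  proof
    assume "\<xi> t * cnj (\<eta> t) = 1"
    then have "\<xi> t * (cnj (\<eta> t) * \<eta> t) = \<eta> t" by (simp only: mult.assoc[symmetric] mult_1_left)
    moreover have "cnj (\<eta> t) * \<eta> t = 1"
    proof -
      have "cmod (\<eta> t) = 1" using \<eta> by (simp add: dual_group_def)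
      then show ?thesis using complex_norm_square[of "\<eta> t"] by (simp add: mult.commute)
    qed
    ultimately show False using t by simp
  qed
  ultimately show ?thesis by simp
qed

lemma eigenfunction_unique:
  assumes "eigenfunction T m \<xi> f" "eigenfunction T m \<eta> f"
  shows "\<xi> = \<eta>"
proof (rule ccontr)
  assume "\<xi> \<noteq> \<eta>"
  then have "inner_L2 m f f = 0" using assms unfolding eigenfunction_def by (blast intro: eigenspaces_orthogonal)
  then have "norm_L2 m f = 0" by (simp add: inner_L2_self)
  moreover have "f \<in> L2 m" using assms(1) by (simp add: eigenfunction_def eigenspace_def)
  ultimately have "AE x in m. f x = 0" by (simp add: norm_L2_eq_0)
  with assms(1) show False by (simp add: eigenfunction_def)
qed

text \<open>
  Used both for closed spans of eigenfunctions and for the limit that defines an eigenfunction: approximate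
  eigenfunctions that converge in \<open>L2\<close> have an eigenfunction as limit.
\<close>

lemma eigen_relation_closed:
  assumes g: "g \<in> L2 m" and c: "cmod c = 1"
    and app: "\<And>\<epsilon>. 0 < \<epsilon> \<Longrightarrow> \<exists>h\<in>L2 m. norm_L2 m (\<lambda>x. g x - h x) \<le> \<epsilon> \<and> norm_L2 m (\<lambda>x. h (T t x) - c * h x) \<le> \<epsilon>"
  shows "AE x in m. g (T t x) = c * g x"
proof -
  let ?d = "\<lambda>x. g (T t x) - c * g x"
  have dL: "?d \<in> L2 m" by (intro L2_diff L2_T L2_scale g)
  have "norm_L2 m ?d \<le> 0 + \<epsilon>" if \<epsilon>: "0 < \<epsilon>" for \<epsilon>
  proof -
    have e: "0 < \<epsilon> / 3" using \<epsilon> by simp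
    obtain h where h: "h \<in> L2 m" "norm_L2 m (\<lambda>x. g x - h x) \<le> \<epsilon> / 3"
      "norm_L2 m (\<lambda>x. h (T t x) - c * h x) \<le> \<epsilon> / 3" using app[OF e] by blast
    have ghL: "(\<lambda>x. g x - h x) \<in> L2 m" by (rule L2_diff[OF g h(1)])
    have "norm_L2 m ?d \<le> norm_L2 m (\<lambda>x. g (T t x) - h (T t x)) + norm_L2 m (\<lambda>x. h (T t x) - c * g x)"
      by (intro norm_L2_triangle_diff L2_T L2_scale g h(1))
    also have "norm_L2 m (\<lambda>x. h (T t x) - c * g x)
        \<le> norm_L2 m (\<lambda>x. h (T t x) - c * h x) + norm_L2 m (\<lambda>x. c * h x - c * g x)"
      by (intro norm_L2_triangle_diff L2_T L2_scale g h(1))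
    also have "norm_L2 m (\<lambda>x. g (T t x) - h (T t x)) = norm_L2 m (\<lambda>x. g x - h x)"
      using norm_T[OF ghL] .
    also have "norm_L2 m (\<lambda>x. c * h x - c * g x) = norm_L2 m (\<lambda>x. g x - h x)"
      using norm_L2_scale[of m c "\<lambda>x. h x - g x"] c norm_L2_commute[of m h g] by (simp add: right_diff_distrib)
    finally show ?thesis using h by simp
  qed
  then have "norm_L2 m ?d \<le> 0" by (rule field_le_epsilon)
  then have "norm_L2 m ?d = 0" using norm_L2_nonneg[of m ?d] by linarith
  then have "AE x in m. ?d x = 0" using norm_L2_eq_0[OF dL] by blast
  then show ?thesis by eventually_elim simp
qed

lemma eigenspace_diff_scale:
  assumes "f \<in> eigenspace T m \<xi>" "g \<in> eigenspace T m \<xi>"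
  shows "(\<lambda>x. f x - c * g x) \<in> eigenspace T m \<xi>"
  unfolding eigenspace_def mem_Collect_eq
proof (intro conjI allI)
  show "(\<lambda>x. f x - c * g x) \<in> L2 m" by (intro L2_diff L2_scale eigenspaceD(1)[OF assms(1)] eigenspaceD(1)[OF assms(2)])
  fix t
  show "AE x in m. f (T t x) - c * g (T t x) = \<xi> t * (f x - c * g x)"
    using eigenspaceD(2)[OF assms(1), of t] eigenspaceD(2)[OF assms(2), of t]
    by eventually_elim (simp add: algebra_simps)
qed

lemma const_L2: "(\<lambda>x. c) \<in> L2 m"
  by (rule L2_bounded[OF prob_space.finite_measure[OF prob], where C = "cmod c"]) simp_all

lemma const_eigenspace: "(\<lambda>x. c) \<in> eigenspace T m (\<lambda>t. 1)"
  by (simp add: eigenspace_def const_L2)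

lemma AE_not_False: "\<not> (AE x in m. False)"
  using prob_space.AE_False[OF prob] by simp

end

lemma invariant_measure_preserving:
  assumes "invariant_probability X T m"
  shows "measure_preserving_action T m"
proof (rule measure_preserving_action.intro)
  have "regular_probability X m" using assms unfolding invariant_probability_def by (rule conjunct1)
  then show "prob_space m" unfolding regular_probability_def by (rule conjunct1)
  have "\<forall>t. T t \<in> measurable m m \<and> distr m m (T t) = m"
    using assms unfolding invariant_probability_def by (rule conjunct2)
  then show "T t \<in> measurable m m" "distr m m (T t) = m" for t by simp_all
qed

text \<open>
  A compact system with a distinguished orbit. Continuity of the action is split into continuity of each
  homeomorphism \<open>T t\<close> and continuity of the orbit map of \<open>x0\<close>.
\<close>

locale orbit_system = van_Hove_sequence haar A
  for haar :: "'g::{topological_ab_group_add, t2_space} measure" and A :: "nat \<Rightarrow> 'g set" +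
  fixes C :: "'x::topological_space set" and T :: "'g \<Rightarrow> 'x \<Rightarrow> 'x" and x0 :: 'x
  assumes compact_C: "compact C" and Hausdorff_C: "Hausdorff_space (top_of_set C)"
    and T_cont: "continuous_on C (T t)" and T_maps: "T t ` C \<subseteq> C"
    and T_add: "x \<in> C \<Longrightarrow> T (s + t) x = T s (T t x)" and T_0: "x \<in> C \<Longrightarrow> T 0 x = x"
    and x0: "x0 \<in> C" and orbit_cont: "continuous_on UNIV (\<lambda>t. T t x0)"
begin

definition orb :: "('x \<Rightarrow> complex) \<Rightarrow> 'g \<Rightarrow> complex" where "orb f t = f (T t x0)"

lemma orbit_in: "T t x0 \<in> C"
  using T_maps x0 by blast

lemma orb_Cb:
  assumes "continuous_on C f"
  shows "orb f \<in> Cb"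
proof -
  have "continuous_on UNIV (\<lambda>t. f (T t x0))"
    by (rule continuous_on_compose2[OF assms orbit_cont]) (use orbit_in in blast)
  moreover have "bounded (f ` C)" using compact_continuous_image[OF assms compact_C] by (rule compact_imp_bounded)
  then have "bounded (range (\<lambda>t. f (T t x0)))" by (rule bounded_subset) (use orbit_in in blast)
  ultimately show ?thesis by (simp add: Cb_def orb_def[abs_def])
qed

lemma continuous_T: "continuous_on C f \<Longrightarrow> continuous_on C (\<lambda>x. f (T t x))"
  by (rule continuous_on_compose2[OF _ T_cont T_maps])

lemma orb_T: "orb (\<lambda>x. f (T t x)) s = orb f (s + t)"
  unfolding orb_def using T_add[OF x0, of t s] by (simp add: add.commute)

lemma inner_avg_eq:
  assumes "continuous_on C f" "\<xi> \<in> Cb"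
  shows "(LINT t:A n|haar. f (T t x0) * cnj (\<xi> t)) / of_real (measure haar (A n)) = inner_L2 (avg n) (orb f) \<xi>"
proof -
  have "(\<lambda>t. orb f t * cnj (\<xi> t)) \<in> Cb" by (intro Cb_mult Cb_cnj orb_Cb assms)
  from integral_avg[OF Cb_measurable[OF this], of n] show ?thesis
    unfolding inner_L2_def by (simp add: orb_def scaleR_conv_of_real)
qed

end

section \<open>From Wiener--Wintner points to almost periodic orbits\<close>

context orbit_system
begin

text \<open>
  The Fourier--Bohr polynomial of \<open>orb f\<close> over a finite part of the basis is as close to \<open>orb f\<close> as the projection of
  \<open>f\<close> to that part is close to \<open>f\<close>.
\<close>

lemma Wiener_Wintner_imp_BAP:
  assumes erg: "ergodic (top_of_set C) T m" and pp: "pure_point_spectrum T m"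
    and ww: "wiener_wintner_point haar A (top_of_set C) T m x0" and f: "continuous_on C f"
  shows "orb f \<in> BAP"
proof -
  have inv: "invariant_probability (top_of_set C) T m" using erg unfolding ergodic_def by (rule conjunct1)
  have reg: "regular_probability (top_of_set C) m" using inv unfolding invariant_probability_def by (rule conjunct1)
  have sets: "sets m = sets (borel_sigma (top_of_set C))"
    using reg unfolding regular_probability_def by (elim conjE)
  interpret M: measure_preserving_action T m by (rule invariant_measure_preserving[OF inv])
  have const: "\<exists>c. AE x in m. k x = c"
    if "k \<in> borel_measurable m" "\<And>t. AE x in m. k (T t x) = k x" for k :: "'x \<Rightarrow> complex"
    using erg that unfolding ergodic_def by blast
  have contL: "g \<in> L2 m" if "continuous_on C g" for g :: "'x \<Rightarrow> complex"
    by (rule continuous_in_L2[OF compact_C M.prob sets that])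
  obtain B where B: "B \<subseteq> L2 m" "\<forall>e\<in>B. \<exists>\<xi>. eigenfunction T m \<xi> e"
    "\<forall>\<xi>\<in>eigenvalues T m. orthonormal_basis_L2 m {e \<in> B. eigenfunction T m \<xi> e} (eigenspace T m \<xi>)"
    "\<forall>f e \<xi>. continuous_map (top_of_set C) euclidean f \<and> e \<in> B \<and> eigenfunction T m \<xi> e \<longrightarrow>
           (\<lambda>n. (LINT t:A n|haar. f (T t x0) * cnj (\<xi> t)) / of_real (measure haar (A n)))
             \<longlonglongrightarrow> inner_L2 m f e"
    using ww unfolding wiener_wintner_point_def by blast
  obtain freq where freq: "\<And>e. e \<in> B \<Longrightarrow> eigenfunction T m (freq e) e" using B(2) by metis
  have freq_dual: "freq e \<in> dual_group" and eE: "e \<in> eigenspace T m (freq e)" and eL: "e \<in> L2 m" if "e \<in> B" for e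
    using freq[OF that] by (simp_all add: eigenfunction_def eigenspace_def)
  have lim: "(\<lambda>n. inner_L2 (avg n) (orb g) \<xi>) \<longlonglongrightarrow> inner_L2 m g e"
    if g: "continuous_on C g" and e: "e \<in> B" "eigenfunction T m \<xi> e" for g e \<xi>
  proof -
    have "\<xi> \<in> Cb" using e(2) by (intro dual_Cb) (simp add: eigenfunction_def)
    then show ?thesis
      using B(4)[rule_format, of g e \<xi>] g e by (simp add: inner_avg_eq continuous_map_iff_continuous)
  qed
  have ONB: "orthonormal_basis_L2 m {e \<in> B. eigenfunction T m \<xi> e} (eigenspace T m \<xi>)"
    if "eigenfunction T m \<xi> k" for \<xi> k
    using B(3) that unfolding eigenvalues_def by blast
  have norm1: "inner_L2 m e e = 1" if e: "e \<in> B" for e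
    using ONB[OF freq[OF e]] freq[OF e] e unfolding orthonormal_basis_L2_def by force
  \<comment> \<open>for two eigenfunctions of one frequency, \<open>e * cnj e'\<close> is invariant, hence constant by ergodicity\<close>
  have prod_const: "AE x in m. e x * cnj (e' x) = inner_L2 m e e'"
    if e: "e \<in> eigenspace T m \<xi>" and e': "e' \<in> eigenspace T m \<xi>" and \<xi>: "\<xi> \<in> dual_group" for e e' \<xi>
  proof -
    have "\<exists>c. AE x in m. e x * cnj (e' x) = c"
    proof (rule const)
      show "(\<lambda>x. e x * cnj (e' x)) \<in> borel_measurable m"
        using L2_measurable[OF M.eigenspaceD(1)[OF e]] L2_measurable[OF M.eigenspaceD(1)[OF e']] by measurable
      fix t
      show "AE x in m. e (T t x) * cnj (e' (T t x)) = e x * cnj (e' x)"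
        using M.eigenspaceD(2)[OF e, of t] M.eigenspaceD(2)[OF e', of t]
      proof eventually_elim
        case (elim x)
        have "\<xi> t * e x * cnj (\<xi> t * e' x) = (\<xi> t * cnj (\<xi> t)) * (e x * cnj (e' x))" by simp
        then show ?case unfolding elim dual_cnj_mult(1)[OF \<xi>] by simp
      qed
    qed
    then obtain c where c: "AE x in m. e x * cnj (e' x) = c" by blast
    have "inner_L2 m e e' = (LINT x|m. c)"
      unfolding inner_L2_def
    proof (rule integral_cong_AE[OF _ _ c])
      show "(\<lambda>x. e x * cnj (e' x)) \<in> borel_measurable m"
        using L2_measurable[OF M.eigenspaceD(1)[OF e]] L2_measurable[OF M.eigenspaceD(1)[OF e']] by measurable
    qed simp
    then show ?thesis using c prob_space.prob_space[OF M.prob] by simp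
  qed
  have inj: "inj_on freq B"
  proof (rule inj_onI, rule ccontr)
    fix e e' assume e: "e \<in> B" "e' \<in> B" "freq e = freq e'" "e \<noteq> e'"
    have "e' \<in> eigenspace T m (freq e)" "eigenfunction T m (freq e) e'" using eE[OF e(2)] freq[OF e(2)] e(3) by simp_all
    then have "inner_L2 m e e' = 0"
      using ONB[OF freq[OF e(1)]] freq[OF e(1)] e unfolding orthonormal_basis_L2_def by force
    with prod_const[OF eE[OF e(1)] \<open>e' \<in> eigenspace T m (freq e)\<close> freq_dual[OF e(1)]]
    have "AE x in m. e x * cnj (e' x) = 0" by simp
    with prod_const[OF eE[OF e(1)] eE[OF e(1)] freq_dual[OF e(1)]] prod_const[OF eE[OF e(2)] eE[OF e(2)] freq_dual[OF e(2)]]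
    \<comment> \<open>both factors have modulus \<open>1\<close>, so their product does not vanish\<close>
    have "AE x in m. False"
    proof eventually_elim
      case (elim x)
      then show ?case using norm1[OF e(1)] norm1[OF e(2)] by auto
    qed
    with M.AE_not_False show False by simp
  qed
  have orthB: "inner_L2 m e e' = (if e = e' then 1 else 0)" if "e \<in> B" "e' \<in> B" for e e'
  proof (cases "e = e'")
    case True
    then show ?thesis using norm1 that by simp
  next
    case False
    then have "freq e \<noteq> freq e'" using inj_on_eq_iff[OF inj that] by simp
    from M.eigenspaces_orthogonal[OF eE[OF that(1)] eE[OF that(2)] freq_dual[OF that(1)] freq_dual[OF that(2)] this]
    show ?thesis using False by simp
  qed
  \<comment> \<open>the eigenfunction of the trivial character is the constant \<open>1\<close>\<close>
  have one_eig: "eigenfunction T m (\<lambda>t. 1) (\<lambda>x. 1)"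
    unfolding eigenfunction_def using dual_one M.const_eigenspace[of 1] M.AE_not_False by simp
  obtain e1 where e1: "e1 \<in> B" "eigenfunction T m (\<lambda>t. 1) e1"
  proof (rule ccontr)
    assume "\<not> thesis"
    \<comment> \<open>the closed span of the empty set consists of null functions\<close>
    then have emp: "{e \<in> B. eigenfunction T m (\<lambda>t. 1) e} = {}" using that by blast
    have "closed_span_L2 m {} = eigenspace T m (\<lambda>t. 1)"
      using ONB[OF one_eig] unfolding emp orthonormal_basis_L2_def by (elim conjE)
    then have "(\<lambda>x. 1) \<in> closed_span_L2 m {}" using M.const_eigenspace[of 1] by simp
    then obtain g where "g \<in> linear_combinations {}" "norm_L2 m (\<lambda>x. 1 - g x) \<le> 1 / 2"
      unfolding closed_span_L2_def by (auto dest!: spec[of _ "1 / 2"])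
    then have "norm_L2 m (\<lambda>x. 1) \<le> 1 / 2" by (simp add: linear_combinations_def)
    then show False using prob_space.prob_space[OF M.prob] by (simp add: norm_L2_def)
  qed
  have e1L: "e1 \<in> L2 m" by (rule eL[OF e1(1)])
  have c1: "continuous_on C (\<lambda>x. 1 :: complex)" by (rule continuous_on_const)
  have "(\<lambda>n. inner_L2 (avg n) (orb (\<lambda>x. 1)) (\<lambda>t. 1)) \<longlonglongrightarrow> inner_L2 m (\<lambda>x. 1) e1"
    by (rule lim[OF c1 e1])
  moreover have "inner_L2 (avg n) (orb (\<lambda>x. 1)) (\<lambda>t. 1) = 1" for n
    using prob_space.prob_space[OF prob_space_avg, of n] by (simp add: inner_L2_def orb_def)
  ultimately have i1: "inner_L2 m (\<lambda>x. 1) e1 = 1" by (simp add: LIMSEQ_const_iff)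
  have "e1 \<in> eigenspace T m (\<lambda>t. 1)" using e1(2) by (simp add: eigenfunction_def)
  from prod_const[OF M.const_eigenspace[of 1] this dual_one] i1
  have "AE x in m. cnj (e1 x) = 1" by simp
  then have e1_one: "AE x in m. e1 x = 1" by eventually_elim (metis complex_cnj_cnj complex_cnj_one)
  have mean_lim: "(\<lambda>n. LINT t|avg n. orb g t) \<longlonglongrightarrow> (LINT x|m. g x)" if g: "continuous_on C g" for g
  proof -
    have "inner_L2 m g e1 = inner_L2 m g (\<lambda>x. 1)"
      by (intro M.inner_cong_AE contL g e1L M.const_L2 e1_one) simp
    then show ?thesis using lim[OF g e1] by (simp add: inner_L2_def)
  qed
  have norm_lim: "(\<lambda>n. (norm_L2 (avg n) (orb f))\<^sup>2) \<longlonglongrightarrow> (norm_L2 m f)\<^sup>2"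
  proof -
    have "continuous_on C (\<lambda>x. f x * cnj (f x))" using f by (intro continuous_intros)
    from mean_lim[OF this]
    have "(\<lambda>n. inner_L2 (avg n) (orb f) (orb f)) \<longlonglongrightarrow> inner_L2 m f f"
      by (simp add: inner_L2_def orb_def)
    then have "(\<lambda>n. Re (inner_L2 (avg n) (orb f) (orb f))) \<longlonglongrightarrow> Re (inner_L2 m f f)" by (rule tendsto_Re)
    then show ?thesis by (simp only: inner_L2_self Re_complex_of_real)
  qed
  have fL: "f \<in> L2 m" by (rule contL[OF f])
  have "{k. \<exists>\<xi>. eigenfunction T m \<xi> k} \<subseteq> closed_span_L2 m B"
  proof
    fix k assume "k \<in> {k. \<exists>\<xi>. eigenfunction T m \<xi> k}"
    then obtain \<xi> where k: "eigenfunction T m \<xi> k" by blast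
    have "k \<in> eigenspace T m \<xi>" using k by (simp add: eigenfunction_def)
    then have "k \<in> closed_span_L2 m {e \<in> B. eigenfunction T m \<xi> e}"
      using ONB[OF k] by (simp add: orthonormal_basis_L2_def)
    moreover have "linear_combinations {e \<in> B. eigenfunction T m \<xi> e} \<subseteq> linear_combinations B"
      unfolding linear_combinations_def by blast
    ultimately show "k \<in> closed_span_L2 m B" unfolding closed_span_L2_def by blast
  qed
  from closed_span_L2_trans[OF B(1) this] pp have fB: "f \<in> closed_span_L2 m B"
    using fL unfolding pure_point_spectrum_def by blast
  show ?thesis
    unfolding BAP_def mem_Collect_eq
  proof (intro conjI allI impI orb_Cb f)
    fix \<epsilon> :: real assume \<epsilon>: "0 < \<epsilon>"
    then obtain g where g: "g \<in> linear_combinations B" "norm_L2 m (\<lambda>x. f x - g x) \<le> \<epsilon>"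
      using fB unfolding closed_span_L2_def by blast
    obtain S c where S: "finite S" "S \<subseteq> B" and gS: "g = (\<lambda>x. \<Sum>e\<in>S. c e * e x)"
      using g(1) unfolding linear_combinations_def by blast
    define a where "a e = inner_L2 m f e" for e
    have SB: "e \<in> B" if "e \<in> S" for e using S(2) that by blast
    have "(norm_L2 m (\<lambda>x. f x - (\<Sum>e\<in>S. c e * e x)))\<^sup>2
        = (norm_L2 m f)\<^sup>2 - (\<Sum>e\<in>S. (cmod (a e))\<^sup>2) + (\<Sum>e\<in>S. (cmod (a e - c e))\<^sup>2)"
      unfolding a_def by (rule norm_L2_diff_orthonormal[OF fL S(1) eL[OF SB] orthB[OF SB SB]])
    moreover have "0 \<le> (\<Sum>e\<in>S. (cmod (a e - c e))\<^sup>2)" by (intro sum_nonneg) simp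
    moreover have "(norm_L2 m (\<lambda>x. f x - (\<Sum>e\<in>S. c e * e x)))\<^sup>2 \<le> \<epsilon>\<^sup>2"
      using g(2) unfolding gS by (rule power_mono) simp
    ultimately have small: "(norm_L2 m f)\<^sup>2 - (\<Sum>e\<in>S. (cmod (a e))\<^sup>2) \<le> \<epsilon>\<^sup>2" by linarith
    let ?p = "\<lambda>t. \<Sum>e\<in>S. a e * freq e t"
    have "(\<lambda>n. (norm_L2 (avg n) (\<lambda>t. orb f t - ?p t))\<^sup>2)
        \<longlonglongrightarrow> (norm_L2 m f)\<^sup>2 - (\<Sum>e\<in>S. (cmod (a e))\<^sup>2) + (\<Sum>e\<in>S. (cmod (a e - a e))\<^sup>2)"
    proof (rule trig_distance[OF orb_Cb[OF f] norm_lim S(1)])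
      show "inj_on freq S" by (rule inj_on_subset[OF inj S(2)])
      show "freq e \<in> dual_group" if "e \<in> S" for e by (rule freq_dual[OF SB[OF that]])
      show "(\<lambda>n. inner_L2 (avg n) (orb f) (freq e)) \<longlonglongrightarrow> a e" if "e \<in> S" for e
        unfolding a_def by (rule lim[OF f SB[OF that] freq[OF SB[OF that]]])
    qed
    then have sq: "(\<lambda>n. (norm_L2 (avg n) (\<lambda>t. orb f t - ?p t))\<^sup>2) \<longlonglongrightarrow> (norm_L2 m f)\<^sup>2 - (\<Sum>e\<in>S. (cmod (a e))\<^sup>2)"
      by simp
    have "besicovitch_le (\<lambda>t. orb f t - ?p t) \<epsilon>"
    proof (rule besicovitch_leI)
      fix \<delta> assume \<delta>: "\<epsilon> < \<delta>"
      then have "\<epsilon>\<^sup>2 < \<delta>\<^sup>2" using \<epsilon> by (intro power_strict_mono) simp_all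
      then have "(norm_L2 m f)\<^sup>2 - (\<Sum>e\<in>S. (cmod (a e))\<^sup>2) < \<delta>\<^sup>2" using small by linarith
      from order_tendstoD(2)[OF sq this]
      show "\<forall>\<^sub>F n in sequentially. norm_L2 (avg n) (\<lambda>t. orb f t - ?p t) < \<delta>"
      proof eventually_elim
        case (elim n)
        then show ?case by (rule power_less_imp_less_base) (use \<epsilon> \<delta> in simp)
      qed
    qed
    moreover have "?p \<in> linear_combinations dual_group"
      using freq_dual SB by (intro linear_combinations_sum linear_combinations_mem) blast
    ultimately show "\<exists>p\<in>linear_combinations dual_group. besicovitch_le (\<lambda>t. orb f t - p t) \<epsilon>" by (rule bexI)
  qed
qed

end

section \<open>The measure of orbit means and its eigenfunctions\<close>

text \<open>
  The means of orbit functions exist and form a positive functional; its representing measure is the measure of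
  the theorem.
\<close>

locale mean_orbit_system = orbit_system haar A C T x0
  for haar :: "'g::{topological_ab_group_add, t2_space} measure" and A :: "nat \<Rightarrow> 'g set"
    and C :: "'x::topological_space set" and T :: "'g \<Rightarrow> 'x \<Rightarrow> 'x" and x0 :: 'x +
  assumes orb_BAP: "continuous_on C f \<Longrightarrow> orb f \<in> BAP"
begin

definition mean_functional :: "('x \<Rightarrow> real) \<Rightarrow> real" where
  "mean_functional f = Re (mean (orb (\<lambda>x. complex_of_real (f x))))"

lemma mean_functional_LIMSEQ:
  assumes "continuous_on C f"
  shows "(\<lambda>n. LINT t|avg n. f (T t x0)) \<longlonglongrightarrow> mean_functional f"
proof -
  have "continuous_on C (\<lambda>x. complex_of_real (f x))" using assms by (intro continuous_intros)
  from tendsto_Re[OF mean_LIMSEQ[OF orb_BAP[OF this]]]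
  have "(\<lambda>n. Re (LINT t|avg n. complex_of_real (f (T t x0)))) \<longlonglongrightarrow> mean_functional f"
    by (simp only: mean_functional_def orb_def)
  then show ?thesis by (simp only: integral_complex_of_real Re_complex_of_real)
qed

lemma integrable_orb_real:
  assumes "continuous_on C f"
  shows "integrable (avg n) (\<lambda>t. f (T t x0) :: real)"
proof -
  have "continuous_on C (\<lambda>x. complex_of_real (f x))" using assms by (intro continuous_intros)
  from integrable_Re[OF integrable_Cb[OF orb_Cb[OF this], of n]] show ?thesis by (simp add: orb_def)
qed

sublocale I: positive_functional C mean_functional
proof
  show "compact C" by (rule compact_C)
  show "Hausdorff_space (top_of_set C)" by (rule Hausdorff_C)
next
  fix f g :: "'x \<Rightarrow> real" assume fg: "continuous_on C f" "continuous_on C g"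
  have "(\<lambda>n. (LINT t|avg n. f (T t x0)) + (LINT t|avg n. g (T t x0))) \<longlonglongrightarrow> mean_functional f + mean_functional g"
    by (intro tendsto_add mean_functional_LIMSEQ fg)
  moreover have "(LINT t|avg n. f (T t x0)) + (LINT t|avg n. g (T t x0)) = (LINT t|avg n. f (T t x0) + g (T t x0))" for n
    by (intro Bochner_Integration.integral_add[symmetric] integrable_orb_real fg)
  ultimately have "(\<lambda>n. LINT t|avg n. f (T t x0) + g (T t x0)) \<longlonglongrightarrow> mean_functional f + mean_functional g"
    by (simp only:)
  moreover have "(\<lambda>n. LINT t|avg n. f (T t x0) + g (T t x0)) \<longlonglongrightarrow> mean_functional (\<lambda>x. f x + g x)"
    by (rule mean_functional_LIMSEQ[OF continuous_on_add[OF fg]])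
  ultimately show "mean_functional (\<lambda>x. f x + g x) = mean_functional f + mean_functional g"
    by (rule LIMSEQ_unique[rotated])
next
  fix f :: "'x \<Rightarrow> real" and c assume f: "continuous_on C f"
  have "(\<lambda>n. c * (LINT t|avg n. f (T t x0))) \<longlonglongrightarrow> c * mean_functional f"
    by (intro tendsto_mult_left mean_functional_LIMSEQ f)
  moreover have "(\<lambda>n. c * (LINT t|avg n. f (T t x0))) \<longlonglongrightarrow> mean_functional (\<lambda>x. c * f x)"
    using mean_functional_LIMSEQ[OF continuous_on_mult[OF continuous_on_const f, of c]] by simp
  ultimately show "mean_functional (\<lambda>x. c * f x) = c * mean_functional f"
    by (rule LIMSEQ_unique[rotated])
next
  fix f :: "'x \<Rightarrow> real" assume f: "continuous_on C f" "\<And>x. x \<in> C \<Longrightarrow> 0 \<le> f x"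
  have "0 \<le> (LINT t|avg n. f (T t x0))" for n
    by (intro integral_nonneg_AE AE_I2 f(2) orbit_in)
  then show "0 \<le> mean_functional f" by (intro LIMSEQ_le_const[OF mean_functional_LIMSEQ[OF f(1)]]) simp
qed

abbreviation m :: "'x measure" where "m \<equiv> I.riesz_measure"

lemma mean_functional_one: "mean_functional (\<lambda>x. 1) = 1"
proof -
  have "(\<lambda>n. LINT t|avg n. (1 :: real)) \<longlonglongrightarrow> mean_functional (\<lambda>x. 1)"
    by (rule mean_functional_LIMSEQ[OF continuous_on_const])
  moreover have "(LINT t|avg n. (1 :: real)) = 1" for n using prob_space.prob_space[OF prob_space_avg, of n] by simp
  ultimately show ?thesis by (simp add: LIMSEQ_const_iff)
qed

lemma regular_m: "regular_probability (top_of_set C) m"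
  by (rule I.regular_riesz[OF mean_functional_one])

lemma prob_m: "prob_space m"
  using regular_m unfolding regular_probability_def by (rule conjunct1)

text \<open>
  The orbit function of \<open>f \<circ> T t\<close> is a translate of that of \<open>f\<close>, and means are translation invariant.
\<close>

lemma mean_functional_T:
  assumes "continuous_on C f"
  shows "mean_functional (\<lambda>x. f (T t x)) = mean_functional f"
proof -
  let ?g = "\<lambda>x. complex_of_real (f x)"
  have g: "continuous_on C ?g" using assms by (intro continuous_intros)
  have sh: "orb (\<lambda>x. ?g (T t x)) = (\<lambda>s. orb ?g (s + t))" by (rule ext, rule orb_T)
  have "mean (\<lambda>s. orb ?g (s + t)) = mean (orb ?g)"
    using orb_BAP[OF g] orb_BAP[OF continuous_T[OF g, of t]] unfolding sh by (rule mean_shift)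
  then show ?thesis unfolding mean_functional_def sh by simp
qed

lemma invariant_m: "invariant_probability (top_of_set C) T m"
  unfolding invariant_probability_def
proof (intro conjI allI regular_m)
  fix t
  show "T t \<in> measurable m m" by (rule measurable_borel_sigma_self[OF T_cont T_maps I.sets_riesz])
  have inv: "T s (T (- s) x) = x" if "x \<in> C" for s x
    using T_add[OF that, of s "- s"] T_0[OF that] by simp
  show "distr m m (T t) = m"
  proof (rule I.invariant_riesz[OF T_cont T_maps T_cont[of "- t"] T_maps])
    show "T t (T (- t) x) = x" if "x \<in> C" for x by (rule inv[OF that])
    show "T (- t) (T t x) = x" if "x \<in> C" for x using inv[OF that, of "- t"] by simp
  qed (rule mean_functional_T)
qed

sublocale M: measure_preserving_action T m
  by (rule invariant_measure_preserving[OF invariant_m])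

lemma cont_L2: "continuous_on C f \<Longrightarrow> f \<in> L2 m"
  by (rule continuous_in_L2[OF compact_C prob_m I.sets_riesz])

text \<open>
  By construction for real functions. For complex ones the real and imaginary parts are treated separately. With
  this formula for products, the map \<open>orb\<close> is isometric from \<open>L2 m\<close> to the Besicovitch geometry.
\<close>

lemma integral_LIMSEQ:
  assumes f: "continuous_on C f"
  shows "(\<lambda>n. LINT t|avg n. orb f t) \<longlonglongrightarrow> (LINT x|m. f x)"
proof -
  have int: "integrable m f"
    using L2_integrable_prod[OF cont_L2[OF f] M.const_L2[of 1]] by simp
  have Re: "continuous_on C (\<lambda>x. Re (f x))" and Im: "continuous_on C (\<lambda>x. Im (f x))"
    using f by (auto intro: continuous_on_Re continuous_on_Im)
  have io: "integrable (avg n) (orb f)" for n by (rule integrable_Cb[OF orb_Cb[OF f]])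
  have "Re (LINT t|avg n. orb f t) = (LINT t|avg n. Re (f (T t x0)))" for n
    using integral_Re[OF io[of n]] unfolding orb_def by (rule sym)
  then have "(\<lambda>n. Re (LINT t|avg n. orb f t)) \<longlonglongrightarrow> Re (LINT x|m. f x)"
    using mean_functional_LIMSEQ[OF Re] I.integral_riesz[OF Re] integral_Re[OF int] by simp
  moreover have "Im (LINT t|avg n. orb f t) = (LINT t|avg n. Im (f (T t x0)))" for n
    using integral_Im[OF io[of n]] unfolding orb_def by (rule sym)
  then have "(\<lambda>n. Im (LINT t|avg n. orb f t)) \<longlonglongrightarrow> Im (LINT x|m. f x)"
    using mean_functional_LIMSEQ[OF Im] I.integral_riesz[OF Im] integral_Im[OF int] by simp
  ultimately show ?thesis by (simp add: tendsto_complex_iff)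
qed

lemma inner_LIMSEQ:
  assumes f: "continuous_on C f" and g: "continuous_on C g"
  shows "(\<lambda>n. inner_L2 (avg n) (orb f) (orb g)) \<longlonglongrightarrow> inner_L2 m f g"
proof -
  have "continuous_on C (\<lambda>x. f x * cnj (g x))" using f g by (intro continuous_intros)
  from integral_LIMSEQ[OF this] show ?thesis by (simp add: inner_L2_def orb_def)
qed

lemma norm_sq_LIMSEQ:
  assumes f: "continuous_on C f"
  shows "(\<lambda>n. (norm_L2 (avg n) (orb f))\<^sup>2) \<longlonglongrightarrow> (norm_L2 m f)\<^sup>2"
  using tendsto_Re[OF inner_LIMSEQ[OF f f]] by (simp only: inner_L2_self Re_complex_of_real)

lemma norm_LIMSEQ:
  assumes f: "continuous_on C f"
  shows "(\<lambda>n. norm_L2 (avg n) (orb f)) \<longlonglongrightarrow> norm_L2 m f"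
  using tendsto_real_sqrt[OF norm_sq_LIMSEQ[OF f]] by simp

lemma norm_le:
  assumes f: "continuous_on C f" and r: "besicovitch_le (orb f) r"
  shows "norm_L2 m f \<le> r"
proof (rule field_le_epsilon)
  fix e :: real assume "0 < e"
  then have "r < r + e" by simp
  from besicovitch_le_less[OF r this] have "\<forall>\<^sub>F n in sequentially. norm_L2 (avg n) (orb f) \<le> r + e"
    by eventually_elim simp
  then show "norm_L2 m f \<le> r + e" by (rule tendsto_upperbound[OF norm_LIMSEQ[OF f]]) simp
qed

definition coef :: "('x \<Rightarrow> complex) \<Rightarrow> ('g \<Rightarrow> complex) \<Rightarrow> complex" where
  "coef f \<xi> = mean (\<lambda>t. orb f t * cnj (\<xi> t))"

lemma coef_LIMSEQ:
  assumes "continuous_on C f" "\<xi> \<in> dual_group"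
  shows "(\<lambda>n. inner_L2 (avg n) (orb f) \<xi>) \<longlonglongrightarrow> coef f \<xi>"
  unfolding coef_def inner_L2_def by (intro mean_LIMSEQ BAP_mult BAP_cnj orb_BAP BAP_dual assms)

definition spectrum :: "('g \<Rightarrow> complex) set" where
  "spectrum = {\<xi> \<in> dual_group. \<exists>f. continuous_on C f \<and> coef f \<xi> \<noteq> 0}"

lemma besicovitch_le_limit_bound:
  assumes k: "k \<in> Cb" "besicovitch_le k r" and g: "\<xi> \<in> dual_group"
    and lim: "(\<lambda>n. inner_L2 (avg n) k \<xi>) \<longlonglongrightarrow> l"
  shows "cmod l \<le> r"
proof (rule field_le_epsilon)
  fix e :: real assume "0 < e"
  then have "r < r + e" by simp
  from besicovitch_le_less[OF k(2) this] have "\<forall>\<^sub>F n in sequentially. cmod (inner_L2 (avg n) k \<xi>) \<le> r + e"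
  proof eventually_elim
    case (elim n)
    then show ?case using avg_norm_le[OF k(1) dual_Cb[OF g], of n] norm_L2_dual[OF g, of n] by simp
  qed
  then show "cmod l \<le> r + e" by (rule tendsto_upperbound[OF tendsto_norm[OF lim]]) simp
qed

text \<open>
  Normalize \<open>f\<close> so that its coefficient at \<open>\<xi>\<close> is \<open>1\<close>, approximate \<open>orb f\<close> by a trigonometric polynomial, and
  isolate the frequency \<open>\<xi>\<close>. The coefficient of the polynomial at \<open>\<xi>\<close> is close to \<open>1\<close>.
\<close>

lemma spectrum_approx:
  assumes \<xi>: "\<xi> \<in> spectrum" and \<epsilon>: "0 < \<epsilon>"
  shows "\<exists>g. continuous_on C g \<and> besicovitch_le (\<lambda>t. orb g t - \<xi> t) \<epsilon>"
proof -
  have \<xi>d: "\<xi> \<in> dual_group" using \<xi> by (simp add: spectrum_def)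
  obtain f0 where f0: "continuous_on C f0" "coef f0 \<xi> \<noteq> 0" using \<xi> unfolding spectrum_def by blast
  define f where "f x = (1 / coef f0 \<xi>) * f0 x" for x
  have f: "continuous_on C f" unfolding f_def by (intro continuous_on_mult continuous_on_const f0(1))
  have "(\<lambda>n. (1 / coef f0 \<xi>) * inner_L2 (avg n) (orb f0) \<xi>) \<longlonglongrightarrow> (1 / coef f0 \<xi>) * coef f0 \<xi>"
    by (intro tendsto_mult_left coef_LIMSEQ f0(1) \<xi>d)
  moreover have "inner_L2 (avg n) (orb f) \<xi> = (1 / coef f0 \<xi>) * inner_L2 (avg n) (orb f0) \<xi>" for n
    unfolding f_def[abs_def] orb_def[abs_def] by (rule inner_L2_scale_left)
  ultimately have flim: "(\<lambda>n. inner_L2 (avg n) (orb f) \<xi>) \<longlonglongrightarrow> 1" using f0(2) by simp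
  have e3: "0 < \<epsilon> / 3" "0 \<le> \<epsilon> / 3" "\<epsilon> / 3 < \<epsilon> / 2" using \<epsilon> by simp_all
  obtain p where p: "p \<in> linear_combinations dual_group" "besicovitch_le (\<lambda>t. orb f t - p t) (\<epsilon> / 3)"
    using BAP_approx[OF orb_BAP[OF f] e3(1)] by blast
  obtain S0 d where S0: "finite S0" "S0 \<subseteq> dual_group" "p = (\<lambda>x. \<Sum>e\<in>S0. d e * e x)"
    using p(1) unfolding linear_combinations_def by blast
  define S where "S = S0 - {\<xi>}"
  define a where "a = (if \<xi> \<in> S0 then d \<xi> else 0)"
  have S: "finite S" "S \<subseteq> dual_group - {\<xi>}" using S0 by (auto simp: S_def)
  have p_eq: "p s = a * \<xi> s + (\<Sum>\<eta>\<in>S. d \<eta> * \<eta> s)" for s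
    unfolding S0(3) a_def S_def using S0(1) by (cases "\<xi> \<in> S0") (simp_all add: sum.remove)
  have pBC: "p \<in> Cb" by (rule trig_Cb[OF p(1)])
  have Sd: "\<eta> \<in> dual_group" if "\<eta> \<in> S" for \<eta> using S(2) that by blast
  have "(\<lambda>n. inner_L2 (avg n) p \<xi>) \<longlonglongrightarrow> a"
  proof -
    have "inner_L2 (avg n) p \<xi> = a * inner_L2 (avg n) \<xi> \<xi> + (\<Sum>\<eta>\<in>S. d \<eta> * inner_L2 (avg n) \<eta> \<xi>)" for n
    proof -
      have "inner_L2 (avg n) p \<xi> = inner_L2 (avg n) (\<lambda>s. a * \<xi> s) \<xi> + inner_L2 (avg n) (\<lambda>s. \<Sum>\<eta>\<in>S. d \<eta> * \<eta> s) \<xi>"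
        unfolding p_eq[abs_def] by (intro inner_L2_add_left Cb_L2 Cb_scale Cb_sum dual_Cb \<xi>d Sd)
      also have "inner_L2 (avg n) (\<lambda>s. \<Sum>\<eta>\<in>S. d \<eta> * \<eta> s) \<xi> = (\<Sum>\<eta>\<in>S. d \<eta> * inner_L2 (avg n) \<eta> \<xi>)"
        by (intro inner_L2_sum_left S(1) Cb_L2 dual_Cb \<xi>d Sd)
      finally show ?thesis by (simp only: inner_L2_scale_left)
    qed
    moreover have "(\<lambda>n. a * inner_L2 (avg n) \<xi> \<xi> + (\<Sum>\<eta>\<in>S. d \<eta> * inner_L2 (avg n) \<eta> \<xi>))
        \<longlonglongrightarrow> a * (if \<xi> = \<xi> then 1 else 0) + (\<Sum>\<eta>\<in>S. d \<eta> * (if \<eta> = \<xi> then 1 else 0))"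
      by (intro tendsto_add tendsto_mult_left tendsto_sum orthogonal_characters \<xi>d Sd)
    moreover have "(\<Sum>\<eta>\<in>S. d \<eta> * (if \<eta> = \<xi> then 1 else 0)) = 0"
      using S(2) by (intro sum.neutral) auto
    ultimately show ?thesis by simp
  qed
  then have "(\<lambda>n. inner_L2 (avg n) (orb f) \<xi> - inner_L2 (avg n) p \<xi>) \<longlonglongrightarrow> 1 - a"
    by (intro tendsto_diff flim)
  moreover have "inner_L2 (avg n) (orb f) \<xi> - inner_L2 (avg n) p \<xi> = inner_L2 (avg n) (\<lambda>t. orb f t - p t) \<xi>" for n
    by (intro inner_L2_diff_left[symmetric] Cb_L2 orb_Cb f pBC dual_Cb \<xi>d)
  ultimately have "(\<lambda>n. inner_L2 (avg n) (\<lambda>t. orb f t - p t) \<xi>) \<longlonglongrightarrow> 1 - a" by (simp only:)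
  from besicovitch_le_limit_bound[OF Cb_diff[OF orb_Cb[OF f] pBC] p(2) \<xi>d this]
  have a1: "cmod (1 - a) \<le> \<epsilon> / 3" .
  define V where "V = orb ` {g. continuous_on C g}"
  have "\<exists>h'\<in>V. besicovitch_le (\<lambda>s. h' s - a * \<xi> s) (\<epsilon> / 2)"
  proof (rule isolate_frequency[OF _ _ \<xi>d S _ e3(2,3)])
    show "V \<subseteq> Cb" unfolding V_def using orb_Cb by blast
    show "orb f \<in> V" unfolding V_def using f by blast
    show "besicovitch_le (\<lambda>s. orb f s - (a * \<xi> s + (\<Sum>\<eta>\<in>S. d \<eta> * \<eta> s))) (\<epsilon> / 3)"
      using p(2) unfolding p_eq[abs_def] .
    fix h and u v :: complex and t assume "h \<in> V"
    then obtain g where g: "continuous_on C g" "h = orb g" unfolding V_def by blast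
    have "continuous_on C (\<lambda>x. u * g x + v * g (T t x))"
      by (intro continuous_on_add continuous_on_mult continuous_on_const g(1) continuous_T)
    moreover have "(\<lambda>s. u * h s + v * h (s + t)) = orb (\<lambda>x. u * g x + v * g (T t x))"
      unfolding g(2) orb_T[symmetric] by (rule ext) (simp add: orb_def)
    ultimately show "(\<lambda>s. u * h s + v * h (s + t)) \<in> V" unfolding V_def by blast
  qed
  then obtain g where g: "continuous_on C g" "besicovitch_le (\<lambda>s. orb g s - a * \<xi> s) (\<epsilon> / 2)" unfolding V_def by blast
  have "besicovitch_le (\<lambda>s. (a - 1) * \<xi> s) (\<epsilon> / 2)"
  proof (rule besicovitch_le_sup)
    show "cmod ((a - 1) * \<xi> s) \<le> \<epsilon> / 2" for s
      using a1 e3 dual_norm[OF \<xi>d, of s] by (simp add: norm_mult norm_minus_commute)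
    show "(\<lambda>s. (a - 1) * \<xi> s) \<in> Cb" by (intro Cb_scale dual_Cb \<xi>d)
  qed
  from besicovitch_le_add[OF Cb_diff[OF orb_Cb[OF g(1)] Cb_scale[OF dual_Cb[OF \<xi>d]]] Cb_scale[OF dual_Cb[OF \<xi>d]] g(2) this]
  have "besicovitch_le (\<lambda>s. (orb g s - a * \<xi> s) + (a - 1) * \<xi> s) (\<epsilon> / 2 + \<epsilon> / 2)" .
  moreover have "(orb g s - a * \<xi> s) + (a - 1) * \<xi> s = orb g s - \<xi> s" for s by (simp add: algebra_simps)
  ultimately have "besicovitch_le (\<lambda>s. orb g s - \<xi> s) \<epsilon>" by simp
  with g(1) show ?thesis by blast
qed

text \<open>
  Choose continuous functions whose orbit functions converge to \<open>\<xi>\<close> in the Besicovitch seminorm. As \<open>orb\<close> is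
  isometric they form a Cauchy sequence in \<open>L2 m\<close>. The norm, the inner products and the eigenvalue relation of the limit are
  those of \<open>\<xi>\<close>.
\<close>

lemma eigenfunction_exists:
  assumes \<xi>: "\<xi> \<in> spectrum"
  shows "\<exists>e. e \<in> eigenspace T m \<xi> \<and> norm_L2 m e = 1 \<and> (\<forall>f. continuous_on C f \<longrightarrow> inner_L2 m f e = coef f \<xi>)"
proof -
  have \<xi>d: "\<xi> \<in> dual_group" using \<xi> by (simp add: spectrum_def)
  have "\<exists>g. continuous_on C g \<and> besicovitch_le (\<lambda>t. orb g t - \<xi> t) ((1 / 2) ^ k)" for k
    by (rule spectrum_approx[OF \<xi>]) simp
  then obtain g where g: "\<And>k. continuous_on C (g k)" "\<And>k. besicovitch_le (\<lambda>t. orb (g k) t - \<xi> t) ((1 / 2) ^ k)"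
    by metis
  have gB: "orb (g k) \<in> Cb" for k by (rule orb_Cb[OF g(1)])
  have dB: "(\<lambda>t. orb (g k) t - \<xi> t) \<in> Cb" for k by (intro Cb_diff gB dual_Cb \<xi>d)
  have gL: "g k \<in> L2 m" for k by (rule cont_L2[OF g(1)])
  have pow: "0 \<le> (1 / 2 :: real) ^ k" for k by simp
  have step: "norm_L2 m (\<lambda>x. g k x - g (Suc k) x) \<le> 2 * (1 / 2) ^ k" for k
  proof (rule norm_le)
    show "continuous_on C (\<lambda>x. g k x - g (Suc k) x)" by (intro continuous_on_diff g(1))
    have "besicovitch_le (\<lambda>t. (orb (g k) t - \<xi> t) + (- 1) * (orb (g (Suc k)) t - \<xi> t)) ((1 / 2) ^ k + cmod (- 1) * (1 / 2) ^ Suc k)"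
      by (intro besicovitch_le_add dB Cb_scale g(2) besicovitch_le_scale pow)
    then have "besicovitch_le (orb (\<lambda>x. g k x - g (Suc k) x)) ((1 / 2) ^ k + (1 / 2) ^ Suc k)"
      by (simp add: orb_def[abs_def])
    then show "besicovitch_le (orb (\<lambda>x. g k x - g (Suc k) x)) (2 * (1 / 2) ^ k)" by (rule besicovitch_le_mono) simp
  qed
  obtain e where eL: "e \<in> L2 m" and conv: "(\<lambda>k. norm_L2 m (\<lambda>x. g k x - e x)) \<longlonglongrightarrow> 0"
    using L2_complete[OF prob_m gL step] by blast
  have pow0: "(\<lambda>k. (1 / 2 :: real) ^ k) \<longlonglongrightarrow> 0" by (rule LIMSEQ_power_zero) simp
  have "inner_L2 m f e = coef f \<xi>" if f: "continuous_on C f" for f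
  proof -
    have fL: "f \<in> L2 m" by (rule cont_L2[OF f])
    have "(\<lambda>k. inner_L2 m f (g k) - inner_L2 m f e) \<longlonglongrightarrow> 0"
    proof (rule Lim_null_comparison)
      show "(\<lambda>k. norm_L2 m f * norm_L2 m (\<lambda>x. g k x - e x)) \<longlonglongrightarrow> 0"
        using tendsto_mult_left[OF conv, of "norm_L2 m f"] by (simp only: mult_zero_right)
      show "\<forall>\<^sub>F k in sequentially. cmod (inner_L2 m f (g k) - inner_L2 m f e) \<le> norm_L2 m f * norm_L2 m (\<lambda>x. g k x - e x)"
      proof (intro always_eventually allI)
        fix k
        have "inner_L2 m f (g k) - inner_L2 m f e = inner_L2 m f (\<lambda>x. g k x - e x)"
          by (rule inner_L2_diff_right[symmetric, OF gL eL fL])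
        then show "cmod (inner_L2 m f (g k) - inner_L2 m f e) \<le> norm_L2 m f * norm_L2 m (\<lambda>x. g k x - e x)"
          using Cauchy_Schwarz_L2[OF fL L2_diff[OF gL eL]] by simp
      qed
    qed
    then have 1: "(\<lambda>k. inner_L2 m f (g k)) \<longlonglongrightarrow> inner_L2 m f e" by (rule LIM_zero_cancel)
    have bd: "cmod (inner_L2 m f (g k) - coef f \<xi>) \<le> (norm_L2 m f + 1) * (2 * (1 / 2) ^ k)" for k
    proof -
      have "(\<lambda>n. inner_L2 (avg n) (orb f) (orb (g k)) - inner_L2 (avg n) (orb f) \<xi>) \<longlonglongrightarrow> inner_L2 m f (g k) - coef f \<xi>"
        by (intro tendsto_diff inner_LIMSEQ coef_LIMSEQ f g(1) \<xi>d)
      then have lim: "(\<lambda>n. cmod (inner_L2 (avg n) (orb f) (orb (g k)) - inner_L2 (avg n) (orb f) \<xi>))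
          \<longlonglongrightarrow> cmod (inner_L2 m f (g k) - coef f \<xi>)" by (rule tendsto_norm)
      have "norm_L2 m f < norm_L2 m f + 1" by simp
      from order_tendstoD(2)[OF norm_LIMSEQ[OF f] this]
      have ev1: "\<forall>\<^sub>F n in sequentially. norm_L2 (avg n) (orb f) < norm_L2 m f + 1" .
      have "(1 / 2 :: real) ^ k < 2 * (1 / 2) ^ k" by simp
      from besicovitch_le_less[OF g(2) this] ev1
      have "\<forall>\<^sub>F n in sequentially. cmod (inner_L2 (avg n) (orb f) (orb (g k)) - inner_L2 (avg n) (orb f) \<xi>)
          \<le> (norm_L2 m f + 1) * (2 * (1 / 2) ^ k)"
      proof eventually_elim
        case (elim n)
        have "inner_L2 (avg n) (orb f) (orb (g k)) - inner_L2 (avg n) (orb f) \<xi>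
            = inner_L2 (avg n) (orb f) (\<lambda>t. orb (g k) t - \<xi> t)"
          by (rule inner_L2_diff_right[symmetric]) (intro Cb_L2 gB dual_Cb \<xi>d orb_Cb f)+
        then have "cmod (inner_L2 (avg n) (orb f) (orb (g k)) - inner_L2 (avg n) (orb f) \<xi>)
            \<le> norm_L2 (avg n) (orb f) * norm_L2 (avg n) (\<lambda>t. orb (g k) t - \<xi> t)"
          using avg_norm_le[OF orb_Cb[OF f] dB] by simp
        also have "\<dots> \<le> (norm_L2 m f + 1) * (2 * (1 / 2) ^ k)"
          using elim by (intro mult_mono) (simp_all add: add_nonneg_nonneg)
        finally show ?case .
      qed
      then show ?thesis by (rule tendsto_upperbound[OF lim]) simp
    qed
    have "(\<lambda>k. inner_L2 m f (g k) - coef f \<xi>) \<longlonglongrightarrow> 0"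
    proof (rule Lim_null_comparison[OF always_eventually[OF allI[OF bd]]])
      have "(\<lambda>k. (norm_L2 m f + 1) * (2 * (1 / 2) ^ k)) \<longlonglongrightarrow> (norm_L2 m f + 1) * (2 * 0)"
        by (intro tendsto_mult_left pow0)
      then show "(\<lambda>k. (norm_L2 m f + 1) * (2 * (1 / 2) ^ k)) \<longlonglongrightarrow> 0" by (simp only: mult_zero_right)
    qed
    then have 2: "(\<lambda>k. inner_L2 m f (g k)) \<longlonglongrightarrow> coef f \<xi>" by (rule LIM_zero_cancel)
    show ?thesis by (rule LIMSEQ_unique[OF 1 2])
  qed
  moreover have "norm_L2 m e = 1"
  proof -
    have bd: "norm (norm_L2 m (g k) - 1) \<le> 2 * (1 / 2) ^ k" for k
    proof -
      have lim: "(\<lambda>n. norm (norm_L2 (avg n) (orb (g k)) - 1)) \<longlonglongrightarrow> norm (norm_L2 m (g k) - 1)"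
        by (intro tendsto_norm tendsto_diff norm_LIMSEQ g(1) tendsto_const)
      have "(1 / 2 :: real) ^ k < 2 * (1 / 2) ^ k" by simp
      from besicovitch_le_less[OF g(2) this]
      have "\<forall>\<^sub>F n in sequentially. norm (norm_L2 (avg n) (orb (g k)) - 1) \<le> 2 * (1 / 2) ^ k"
      proof eventually_elim
        case (elim n)
        then show ?case
          using norm_L2_diff_ge[OF Cb_L2[OF gB[of k], of n] Cb_L2[OF dual_Cb[OF \<xi>d], of n]] norm_L2_dual[OF \<xi>d, of n]
          by simp
      qed
      then show ?thesis by (rule tendsto_upperbound[OF lim]) simp
    qed
    have "(\<lambda>k. norm_L2 m (g k) - 1) \<longlonglongrightarrow> 0"
    proof (rule Lim_null_comparison[OF always_eventually[OF allI[OF bd]]])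
      show "(\<lambda>k. 2 * (1 / 2 :: real) ^ k) \<longlonglongrightarrow> 0"
        using tendsto_mult_left[OF pow0, of 2] by (simp only: mult_zero_right)
    qed
    then have 1: "(\<lambda>k. norm_L2 m (g k)) \<longlonglongrightarrow> 1" by (rule LIM_zero_cancel)
    have "(\<lambda>k. norm_L2 m (g k) - norm_L2 m e) \<longlonglongrightarrow> 0"
    proof (rule Lim_null_comparison[OF _ conv], intro always_eventually allI)
      fix k show "norm (norm_L2 m (g k) - norm_L2 m e) \<le> norm_L2 m (\<lambda>x. g k x - e x)"
        using norm_L2_diff_ge[OF gL[of k] eL] by simp
    qed
    then have "(\<lambda>k. norm_L2 m (g k)) \<longlonglongrightarrow> norm_L2 m e" by (rule LIM_zero_cancel)
    from LIMSEQ_unique[OF this 1] show ?thesis .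
  qed
  moreover have "e \<in> eigenspace T m \<xi>"
    unfolding eigenspace_def mem_Collect_eq
  proof (intro conjI allI eL)
    fix t
    show "AE x in m. e (T t x) = \<xi> t * e x"
    proof (rule M.eigen_relation_closed[OF eL dual_norm[OF \<xi>d]])
      fix \<epsilon> :: real assume \<epsilon>: "0 < \<epsilon>"
      then have "0 < \<epsilon> / 2" by simp
      from eventually_conj[OF order_tendstoD(2)[OF conv \<epsilon>] order_tendstoD(2)[OF pow0 this]]
      obtain k where k: "norm_L2 m (\<lambda>x. g k x - e x) < \<epsilon>" "(1 / 2) ^ k < \<epsilon> / 2"
        using eventually_happens'[OF sequentially_bot] by blast
      have "norm_L2 m (\<lambda>x. g k (T t x) - \<xi> t * g k x) \<le> 2 * (1 / 2) ^ k"
      proof (rule norm_le)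
        show "continuous_on C (\<lambda>x. g k (T t x) - \<xi> t * g k x)"
          by (intro continuous_on_diff continuous_on_mult continuous_on_const g(1) continuous_T)
        let ?d = "\<lambda>s. orb (g k) s - \<xi> s"
        have "besicovitch_le (\<lambda>s. ?d (s + t) + (- \<xi> t) * ?d s) ((1 / 2) ^ k + cmod (- \<xi> t) * (1 / 2) ^ k)"
          by (intro besicovitch_le_add Cb_scale Cb_shift[OF dB] dB besicovitch_le_shift[OF dB] g(2) besicovitch_le_scale pow)
        moreover have "?d (s + t) + (- \<xi> t) * ?d s = orb (\<lambda>x. g k (T t x) - \<xi> t * g k x) s" for s
          using orb_T[of "g k" t s] dual_add[OF \<xi>d, of s t] by (simp add: orb_def algebra_simps)
        ultimately show "besicovitch_le (orb (\<lambda>x. g k (T t x) - \<xi> t * g k x)) (2 * (1 / 2) ^ k)"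
          using dual_norm[OF \<xi>d, of t] by simp
      qed
      then have "norm_L2 m (\<lambda>x. g k (T t x) - \<xi> t * g k x) \<le> \<epsilon>" using k(2) by linarith
      moreover have "norm_L2 m (\<lambda>x. e x - g k x) \<le> \<epsilon>" using k(1) norm_L2_commute[of m e "g k"] by simp
      ultimately show "\<exists>h\<in>L2 m. norm_L2 m (\<lambda>x. e x - h x) \<le> \<epsilon> \<and> norm_L2 m (\<lambda>x. h (T t x) - \<xi> t * h x) \<le> \<epsilon>"
        using gL by blast
    qed
  qed
  ultimately show ?thesis by blast
qed

end

section \<open>Eigenfunctions form a basis\<close>

context mean_orbit_system
begin

definition eigenf :: "('g \<Rightarrow> complex) \<Rightarrow> 'x \<Rightarrow> complex" where
  "eigenf \<xi> = (SOME e. e \<in> eigenspace T m \<xi> \<and> norm_L2 m e = 1 \<and>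
     (\<forall>f. continuous_on C f \<longrightarrow> inner_L2 m f e = coef f \<xi>))"

lemma eigenf:
  assumes "\<xi> \<in> spectrum"
  shows "eigenf \<xi> \<in> eigenspace T m \<xi>" "norm_L2 m (eigenf \<xi>) = 1"
    "continuous_on C f \<Longrightarrow> inner_L2 m f (eigenf \<xi>) = coef f \<xi>" "eigenf \<xi> \<in> L2 m"
proof -
  have *: "eigenf \<xi> \<in> eigenspace T m \<xi> \<and> norm_L2 m (eigenf \<xi>) = 1 \<and>
     (\<forall>f. continuous_on C f \<longrightarrow> inner_L2 m f (eigenf \<xi>) = coef f \<xi>)"
    unfolding eigenf_def by (rule someI_ex[OF eigenfunction_exists[OF assms]])
  then show "eigenf \<xi> \<in> eigenspace T m \<xi>" "norm_L2 m (eigenf \<xi>) = 1"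
    "continuous_on C f \<Longrightarrow> inner_L2 m f (eigenf \<xi>) = coef f \<xi>" by blast+
  show "eigenf \<xi> \<in> L2 m" using * by (intro M.eigenspaceD(1)) blast
qed

lemma spectrum_dual: "\<xi> \<in> spectrum \<Longrightarrow> \<xi> \<in> dual_group"
  by (simp add: spectrum_def)

lemma eigenf_orthonormal:
  assumes "\<xi> \<in> spectrum" "\<eta> \<in> spectrum"
  shows "inner_L2 m (eigenf \<xi>) (eigenf \<eta>) = (if \<xi> = \<eta> then 1 else 0)"
proof (cases "\<xi> = \<eta>")
  case True
  then show ?thesis using eigenf(2)[OF assms(1)] by (simp add: inner_L2_self)
next
  case False
  from M.eigenspaces_orthogonal[OF eigenf(1)[OF assms(1)] eigenf(1)[OF assms(2)]
      spectrum_dual[OF assms(1)] spectrum_dual[OF assms(2)] False]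
  show ?thesis using False by simp
qed

lemma eigenf_eigenfunction:
  assumes "\<xi> \<in> spectrum"
  shows "eigenfunction T m \<xi> (eigenf \<xi>)"
proof -
  have "\<not> (AE x in m. eigenf \<xi> x = 0)"
    using norm_L2_eq_0[OF eigenf(4)[OF assms]] eigenf(2)[OF assms] by simp
  then show ?thesis using eigenf(1)[OF assms] spectrum_dual[OF assms] by (simp add: eigenfunction_def)
qed

definition basis :: "('x \<Rightarrow> complex) set" where "basis = eigenf ` spectrum"

lemma basis_L2: "basis \<subseteq> L2 m"
  unfolding basis_def using eigenf(4) by blast

text \<open>
  Parseval's equation: \<open>orb f\<close> is close to a trigonometric polynomial, so its squared norm is almost exhausted by
  finitely many squared coefficients. These are the coefficients of \<open>f\<close> with respect to the eigenfunctions, since the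
  coefficients outside the spectrum vanish.
\<close>

lemma continuous_in_span:
  assumes f: "continuous_on C f"
  shows "f \<in> closed_span_L2 m basis"
  unfolding closed_span_L2_def mem_Collect_eq
proof (intro conjI allI impI cont_L2 f)
  fix \<epsilon>' :: real assume \<epsilon>': "0 < \<epsilon>'"
  \<comment> \<open>a seminorm bound \<open>\<epsilon>\<close> only keeps the norms eventually below any larger number, here \<open>2 * \<epsilon>\<close>\<close>
  define \<epsilon> where "\<epsilon> = \<epsilon>' / 2"
  have \<epsilon>: "0 < \<epsilon>" using \<epsilon>' by (simp add: \<epsilon>_def)
  obtain p where p: "p \<in> linear_combinations dual_group" "besicovitch_le (\<lambda>t. orb f t - p t) \<epsilon>"
    using BAP_approx[OF orb_BAP[OF f] \<epsilon>] by blast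
  obtain R d where R: "finite R" "R \<subseteq> dual_group" "p = (\<lambda>x. \<Sum>e\<in>R. d e * e x)"
    using p(1) unfolding linear_combinations_def by blast
  have Rd: "\<eta> \<in> dual_group" if "\<eta> \<in> R" for \<eta> using R(2) that by blast
  let ?a = "coef f"
  have sq: "(\<lambda>n. (norm_L2 (avg n) (\<lambda>t. orb f t - (\<Sum>\<eta>\<in>R. d \<eta> * \<eta> t)))\<^sup>2)
      \<longlonglongrightarrow> (norm_L2 m f)\<^sup>2 - (\<Sum>\<eta>\<in>R. (cmod (?a \<eta>))\<^sup>2) + (\<Sum>\<eta>\<in>R. (cmod (?a \<eta> - d \<eta>))\<^sup>2)"
    by (rule trig_distance[OF orb_Cb[OF f] norm_sq_LIMSEQ[OF f] R(1), where \<xi> = "\<lambda>\<eta>. \<eta>"])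
      (simp_all add: Rd coef_LIMSEQ[OF f])
  have "(norm_L2 m f)\<^sup>2 - (\<Sum>\<eta>\<in>R. (cmod (?a \<eta>))\<^sup>2) + (\<Sum>\<eta>\<in>R. (cmod (?a \<eta> - d \<eta>))\<^sup>2) \<le> (2 * \<epsilon>)\<^sup>2"
  proof (rule tendsto_upperbound[OF sq])
    have "\<epsilon> < 2 * \<epsilon>" using \<epsilon> by simp
    from besicovitch_le_less[OF p(2) this]
    show "\<forall>\<^sub>F n in sequentially. (norm_L2 (avg n) (\<lambda>t. orb f t - (\<Sum>\<eta>\<in>R. d \<eta> * \<eta> t)))\<^sup>2 \<le> (2 * \<epsilon>)\<^sup>2"
      unfolding R(3) by eventually_elim (rule power_mono[OF less_imp_le norm_L2_nonneg])
  qed simp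
  moreover have "0 \<le> (\<Sum>\<eta>\<in>R. (cmod (?a \<eta> - d \<eta>))\<^sup>2)" by (intro sum_nonneg) simp
  ultimately have small: "(norm_L2 m f)\<^sup>2 - (\<Sum>\<eta>\<in>R. (cmod (?a \<eta>))\<^sup>2) \<le> (2 * \<epsilon>)\<^sup>2" by linarith
  define S where "S = R \<inter> spectrum"
  have S: "finite S" and Ss: "\<xi> \<in> spectrum" if "\<xi> \<in> S" for \<xi> using R(1) that by (simp_all add: S_def)
  have finS: "finite S" using R(1) by (simp add: S_def)
  have RS: "(\<Sum>\<eta>\<in>R. (cmod (?a \<eta>))\<^sup>2) = (\<Sum>\<eta>\<in>S. (cmod (?a \<eta>))\<^sup>2)"
  proof (rule sum.mono_neutral_right[OF R(1)])
    show "S \<subseteq> R" by (simp add: S_def)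
    show "\<forall>\<eta>\<in>R - S. (cmod (?a \<eta>))\<^sup>2 = 0" using Rd f by (auto simp: S_def spectrum_def)
  qed
  let ?g = "\<lambda>x. \<Sum>\<xi>\<in>S. ?a \<xi> * eigenf \<xi> x"
  have "(norm_L2 m (\<lambda>x. f x - ?g x))\<^sup>2 = (norm_L2 m f)\<^sup>2 - (\<Sum>\<xi>\<in>S. (cmod (inner_L2 m f (eigenf \<xi>)))\<^sup>2)
      + (\<Sum>\<xi>\<in>S. (cmod (inner_L2 m f (eigenf \<xi>) - ?a \<xi>))\<^sup>2)"
    by (rule norm_L2_diff_orthonormal[OF cont_L2[OF f] finS eigenf(4)[OF Ss] eigenf_orthonormal[OF Ss Ss]])
  also have "(\<Sum>\<xi>\<in>S. (cmod (inner_L2 m f (eigenf \<xi>) - ?a \<xi>))\<^sup>2) = 0"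
    by (intro sum.neutral ballI) (simp add: eigenf(3)[OF Ss f])
  also have "(\<Sum>\<xi>\<in>S. (cmod (inner_L2 m f (eigenf \<xi>)))\<^sup>2) = (\<Sum>\<xi>\<in>S. (cmod (?a \<xi>))\<^sup>2)"
    by (intro sum.cong refl) (simp add: eigenf(3)[OF Ss f])
  finally have "(norm_L2 m (\<lambda>x. f x - ?g x))\<^sup>2 \<le> (2 * \<epsilon>)\<^sup>2" using small RS by simp
  then have "norm_L2 m (\<lambda>x. f x - ?g x) \<le> 2 * \<epsilon>" by (rule power2_le_imp_le) (use \<epsilon> in simp)
  moreover have "?g \<in> linear_combinations basis"
    unfolding basis_def using Ss by (intro linear_combinations_sum linear_combinations_mem imageI)
  ultimately show "\<exists>g\<in>linear_combinations basis. norm_L2 m (\<lambda>x. f x - g x) \<le> \<epsilon>'"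
    by (intro bexI[of _ ?g]) (simp_all add: \<epsilon>_def)
qed

lemma L2_span: "L2 m \<subseteq> closed_span_L2 m basis"
proof -
  have "{g. continuous_on C g} \<subseteq> closed_span_L2 m basis" using continuous_in_span by blast
  from closed_span_L2_trans[OF basis_L2 this] continuous_dense_L2[OF compact_C Hausdorff_C regular_m]
  show ?thesis by blast
qed

text \<open>
  The distance of \<open>g\<close> to any combination of the basis is at least the norm of \<open>g\<close>.
\<close>

lemma orthogonal_imp_null:
  assumes g: "g \<in> L2 m" and orth: "\<And>\<xi>. \<xi> \<in> spectrum \<Longrightarrow> inner_L2 m g (eigenf \<xi>) = 0"
  shows "norm_L2 m g = 0"
proof -
  have "norm_L2 m g \<le> 0 + \<epsilon>" if \<epsilon>: "0 < \<epsilon>" for \<epsilon>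
  proof -
    obtain h where h: "h \<in> linear_combinations basis" "norm_L2 m (\<lambda>x. g x - h x) \<le> \<epsilon>"
      using L2_span g \<epsilon> unfolding closed_span_L2_def by blast
    obtain S c where S: "finite S" "S \<subseteq> basis" "h = (\<lambda>x. \<Sum>e\<in>S. c e * e x)"
      using h(1) unfolding linear_combinations_def by blast
    have b: "e \<in> L2 m" "inner_L2 m g e = 0" if "e \<in> S" for e
      using S(2) that orth eigenf(4) unfolding basis_def by blast+
    have on: "inner_L2 m e e' = (if e = e' then 1 else 0)" if ee: "e \<in> S" "e' \<in> S" for e e'
    proof -
      obtain \<xi> where \<xi>: "\<xi> \<in> spectrum" "e = eigenf \<xi>" using S(2) ee(1) unfolding basis_def by blast
      obtain \<eta> where \<eta>: "\<eta> \<in> spectrum" "e' = eigenf \<eta>" using S(2) ee(2) unfolding basis_def by blast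
      show ?thesis
      proof (cases "e = e'")
        case True
        then show ?thesis using eigenf_orthonormal[OF \<xi>(1) \<xi>(1)] \<xi>(2) by simp
      next
        case False
        then have "\<xi> \<noteq> \<eta>" using \<xi>(2) \<eta>(2) by blast
        then show ?thesis using eigenf_orthonormal[OF \<xi>(1) \<eta>(1)] \<xi>(2) \<eta>(2) False by simp
      qed
    qed
    have "(norm_L2 m (\<lambda>x. g x - (\<Sum>e\<in>S. c e * e x)))\<^sup>2 = (norm_L2 m g)\<^sup>2
        - (\<Sum>e\<in>S. (cmod (inner_L2 m g e))\<^sup>2) + (\<Sum>e\<in>S. (cmod (inner_L2 m g e - c e))\<^sup>2)"
      by (rule norm_L2_diff_orthonormal[OF g S(1) b(1) on])
    moreover have "(\<Sum>e\<in>S. (cmod (inner_L2 m g e))\<^sup>2) = 0" by (intro sum.neutral ballI) (simp add: b(2))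
    moreover have "0 \<le> (\<Sum>e\<in>S. (cmod (inner_L2 m g e - c e))\<^sup>2)" by (intro sum_nonneg) simp
    ultimately have "(norm_L2 m g)\<^sup>2 \<le> (norm_L2 m (\<lambda>x. g x - h x))\<^sup>2" unfolding S(3) by linarith
    then have "norm_L2 m g \<le> norm_L2 m (\<lambda>x. g x - h x)" by (rule power2_le_imp_le) simp
    then show ?thesis using h(2) by simp
  qed
  then have "norm_L2 m g \<le> 0" by (rule field_le_epsilon)
  then show ?thesis using norm_L2_nonneg[of m g] by linarith
qed

text \<open>
  Otherwise an eigenfunction would be orthogonal to the whole basis.
\<close>

lemma eigenvalue_in_spectrum:
  assumes "eigenfunction T m \<xi> g"
  shows "\<xi> \<in> spectrum"
proof (rule ccontr)
  assume n: "\<xi> \<notin> spectrum"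
  have g: "g \<in> eigenspace T m \<xi>" "\<xi> \<in> dual_group" "\<not> (AE x in m. g x = 0)"
    using assms by (simp_all add: eigenfunction_def)
  have "norm_L2 m g = 0"
  proof (rule orthogonal_imp_null[OF M.eigenspaceD(1)[OF g(1)]])
    fix \<eta> assume \<eta>: "\<eta> \<in> spectrum"
    with n have "\<xi> \<noteq> \<eta>" by blast
    then show "inner_L2 m g (eigenf \<eta>) = 0"
      by (rule M.eigenspaces_orthogonal[OF g(1) eigenf(1)[OF \<eta>] g(2) spectrum_dual[OF \<eta>]])
  qed
  with norm_L2_eq_0[OF M.eigenspaceD(1)[OF g(1)]] g(3) show False by blast
qed

text \<open>
  The difference is orthogonal to the basis element of the same frequency by construction, and to the others as an
  eigenfunction.
\<close>

lemma eigenspace_one_dimensional: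
  assumes \<xi>: "\<xi> \<in> spectrum" and g: "g \<in> eigenspace T m \<xi>"
  shows "norm_L2 m (\<lambda>x. g x - inner_L2 m g (eigenf \<xi>) * eigenf \<xi> x) = 0"
proof -
  define c where "c = inner_L2 m g (eigenf \<xi>)"
  let ?d = "\<lambda>x. g x - c * eigenf \<xi> x"
  have d: "?d \<in> eigenspace T m \<xi>" by (rule M.eigenspace_diff_scale[OF g eigenf(1)[OF \<xi>]])
  have gL: "g \<in> L2 m" by (rule M.eigenspaceD(1)[OF g])
  have "norm_L2 m ?d = 0"
  proof (rule orthogonal_imp_null[OF M.eigenspaceD(1)[OF d]])
    fix \<eta> assume \<eta>: "\<eta> \<in> spectrum"
    show "inner_L2 m ?d (eigenf \<eta>) = 0"
    proof (cases "\<xi> = \<eta>")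
      case True
      have "inner_L2 m ?d (eigenf \<xi>) = inner_L2 m g (eigenf \<xi>) - inner_L2 m (\<lambda>x. c * eigenf \<xi> x) (eigenf \<xi>)"
        by (intro inner_L2_diff_left L2_scale gL eigenf(4)[OF \<xi>])
      also have "\<dots> = 0" using eigenf_orthonormal[OF \<xi> \<xi>] by (simp add: inner_L2_scale_left c_def)
      finally show ?thesis using True by simp
    next
      case False
      then show ?thesis
        by (rule M.eigenspaces_orthogonal[OF d eigenf(1)[OF \<eta>] spectrum_dual[OF \<xi>] spectrum_dual[OF \<eta>]])
    qed
  qed
  then show ?thesis by (simp only: c_def)
qed

lemma eigenspace_AE:
  assumes \<xi>: "\<xi> \<in> spectrum" and g: "g \<in> eigenspace T m \<xi>"
  shows "AE x in m. g x = inner_L2 m g (eigenf \<xi>) * eigenf \<xi> x"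
proof -
  have "(\<lambda>x. g x - inner_L2 m g (eigenf \<xi>) * eigenf \<xi> x) \<in> L2 m"
    by (intro L2_diff L2_scale eigenf(4)[OF \<xi>] M.eigenspaceD(1)[OF g])
  then have "AE x in m. g x - inner_L2 m g (eigenf \<xi>) * eigenf \<xi> x = 0"
    using eigenspace_one_dimensional[OF \<xi> g] norm_L2_eq_0 by blast
  then show ?thesis by eventually_elim simp
qed

lemma one_in_spectrum: "(\<lambda>t. 1) \<in> spectrum"
proof -
  have "eigenfunction T m (\<lambda>t. 1) (\<lambda>x. 1)"
    unfolding eigenfunction_def using dual_one M.const_eigenspace[of 1] M.AE_not_False by simp
  then show ?thesis by (rule eigenvalue_in_spectrum)
qed

text \<open>
  An invariant function need not be square-integrable. The injective map \<open>z \<mapsto> z / (1 + \<bar>z\<bar>)\<close> makes it bounded and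
  keeps it invariant; then it lies in the one-dimensional eigenspace of the trivial character, which contains the
  constants.
\<close>

lemma ergodic_m: "ergodic (top_of_set C) T m"
  unfolding ergodic_def
proof (intro conjI allI impI invariant_m)
  fix f :: "'x \<Rightarrow> complex"
  assume f [measurable]: "f \<in> borel_measurable m" and inv: "\<forall>t. AE x in m. f (T t x) = f x"
  define g where "g x = f x / of_real (1 + cmod (f x))" for x
  have pos: "1 + cmod z > 0" for z by (rule add_pos_nonneg) simp_all
  have gn: "cmod (g x) = cmod (f x) / (1 + cmod (f x))" for x
    unfolding g_def norm_divide norm_of_real using pos[of "f x"] by simp
  have g_le: "cmod (g x) \<le> 1" for x
    unfolding gn using pos[of "f x"] by (simp add: divide_le_eq)
  \<comment> \<open>\<open>z \<mapsto> z / (1 - \<bar>z\<bar>)\<close> is the inverse map\<close>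
  have f_eq: "f x = g x / of_real (1 - cmod (g x))" for x
  proof -
    have "1 - cmod (g x) = 1 / (1 + cmod (f x))" unfolding gn using pos[of "f x"] by (simp add: field_simps)
    moreover have "(1 + complex_of_real (cmod (f x))) \<noteq> 0"
      using pos[of "f x"] by (metis less_irrefl of_real_1 of_real_add of_real_eq_0_iff)
    ultimately show ?thesis unfolding g_def by simp
  qed
  have gm: "g \<in> borel_measurable m" unfolding g_def by measurable
  have gL: "g \<in> L2 m" by (rule L2_bounded[OF prob_space.finite_measure[OF prob_m] gm AE_I2[OF g_le]])
  have gE: "g \<in> eigenspace T m (\<lambda>t. 1)"
    unfolding eigenspace_def mem_Collect_eq
  proof (intro conjI allI gL)
    fix t
    have "AE x in m. f (T t x) = f x" using inv by blast
    then show "AE x in m. g (T t x) = 1 * g x" by eventually_elim (simp add: g_def)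
  qed
  let ?e = "eigenf (\<lambda>t. 1)"
  define c where "c = inner_L2 m g ?e"
  define c1 where "c1 = inner_L2 m (\<lambda>x. 1) ?e"
  have 1: "AE x in m. g x = c * ?e x" unfolding c_def by (rule eigenspace_AE[OF one_in_spectrum gE])
  have 2: "AE x in m. 1 = c1 * ?e x" unfolding c1_def by (rule eigenspace_AE[OF one_in_spectrum M.const_eigenspace])
  have "AE x in m. f x = (c / c1) / of_real (1 - cmod (c / c1))"
    using 1 2
  proof eventually_elim
    case (elim x)
    have "c1 \<noteq> 0" using elim(2) by auto
    then have "?e x = 1 / c1" using elim(2) by (simp add: field_simps)
    then have "g x = c / c1" using elim(1) by simp
    then show ?case using f_eq[of x] by simp
  qed
  then show "\<exists>c. AE x in m. f x = c" by blast
qed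

lemma pure_point_m: "pure_point_spectrum T m"
  unfolding pure_point_spectrum_def
proof
  show "closed_span_L2 m {f. \<exists>\<xi>. eigenfunction T m \<xi> f} \<subseteq> L2 m" unfolding closed_span_L2_def by blast
  have "basis \<subseteq> {f. \<exists>\<xi>. eigenfunction T m \<xi> f}" unfolding basis_def using eigenf_eigenfunction by blast
  then have "linear_combinations basis \<subseteq> linear_combinations {f. \<exists>\<xi>. eigenfunction T m \<xi> f}"
    unfolding linear_combinations_def by blast
  then have "closed_span_L2 m basis \<subseteq> closed_span_L2 m {f. \<exists>\<xi>. eigenfunction T m \<xi> f}"
    unfolding closed_span_L2_def by blast
  then show "L2 m \<subseteq> closed_span_L2 m {f. \<exists>\<xi>. eigenfunction T m \<xi> f}" using L2_span by blast
qed

lemma eigenspace_span: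
  assumes \<xi>: "\<xi> \<in> spectrum"
  shows "closed_span_L2 m {eigenf \<xi>} = eigenspace T m \<xi>"
proof
  have eL: "eigenf \<xi> \<in> L2 m" by (rule eigenf(4)[OF \<xi>])
  show "closed_span_L2 m {eigenf \<xi>} \<subseteq> eigenspace T m \<xi>"
  proof
    fix g assume g: "g \<in> closed_span_L2 m {eigenf \<xi>}"
    have gL: "g \<in> L2 m" using g by (simp add: closed_span_L2_def)
    have "AE x in m. g (T t x) = \<xi> t * g x" for t
    proof (rule M.eigen_relation_closed[OF gL dual_norm[OF spectrum_dual[OF \<xi>]]])
      fix \<epsilon> :: real assume \<epsilon>: "0 < \<epsilon>"
      obtain h where h: "h \<in> linear_combinations {eigenf \<xi>}" "norm_L2 m (\<lambda>x. g x - h x) \<le> \<epsilon>"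
        using g \<epsilon> unfolding closed_span_L2_def by blast
      obtain S c where S: "finite S" "S \<subseteq> {eigenf \<xi>}" "h = (\<lambda>x. \<Sum>e\<in>S. c e * e x)"
        using h(1) unfolding linear_combinations_def by blast
      have hL: "h \<in> L2 m" using S(2) eL unfolding S(3) by (intro L2_comb) blast
      have "AE x in m. h (T t x) - \<xi> t * h x = 0"
        using M.eigenspaceD(2)[OF eigenf(1)[OF \<xi>], of t]
      proof eventually_elim
        case (elim x)
        have "S = {} \<or> S = {eigenf \<xi>}" using S(2) by blast
        then show ?case unfolding S(3) using elim by auto
      qed
      then have "norm_L2 m (\<lambda>x. h (T t x) - \<xi> t * h x) = 0"
        using norm_L2_eq_0[OF L2_diff[OF M.L2_T[OF hL] L2_scale[OF hL]]] by blast
      then show "\<exists>h\<in>L2 m. norm_L2 m (\<lambda>x. g x - h x) \<le> \<epsilon> \<and> norm_L2 m (\<lambda>x. h (T t x) - \<xi> t * h x) \<le> \<epsilon>"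
        using h(2) hL \<epsilon> by (intro bexI[of _ h]) simp_all
    qed
    then show "g \<in> eigenspace T m \<xi>" using gL by (simp add: eigenspace_def)
  qed
  show "eigenspace T m \<xi> \<subseteq> closed_span_L2 m {eigenf \<xi>}"
  proof
    fix g assume g: "g \<in> eigenspace T m \<xi>"
    have "(\<lambda>x. inner_L2 m g (eigenf \<xi>) * eigenf \<xi> x) \<in> linear_combinations {eigenf \<xi>}"
      by (intro linear_combinations_scale linear_combinations_mem) simp
    then show "g \<in> closed_span_L2 m {eigenf \<xi>}"
      unfolding closed_span_L2_def mem_Collect_eq
      using eigenspace_one_dimensional[OF \<xi> g] M.eigenspaceD(1)[OF g] by (metis less_imp_le)
  qed
qed

lemma Wiener_Wintner_m: "wiener_wintner_point haar A (top_of_set C) T m x0"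
  unfolding wiener_wintner_point_def
proof (intro conjI exI[of _ basis])
  show "x0 \<in> topspace (top_of_set C)" using x0 by simp
  show "basis \<subseteq> L2 m" by (rule basis_L2)
  show "\<forall>e\<in>basis. \<exists>\<xi>. eigenfunction T m \<xi> e" unfolding basis_def using eigenf_eigenfunction by blast
  show "\<forall>\<xi>\<in>eigenvalues T m. orthonormal_basis_L2 m {e \<in> basis. eigenfunction T m \<xi> e} (eigenspace T m \<xi>)"
  proof
    fix \<xi> assume "\<xi> \<in> eigenvalues T m"
    then have \<xi>: "\<xi> \<in> spectrum" unfolding eigenvalues_def using eigenvalue_in_spectrum by blast
    have eq: "{e \<in> basis. eigenfunction T m \<xi> e} = {eigenf \<xi>}"
    proof (intro set_eqI iffI)
      fix e assume "e \<in> {e \<in> basis. eigenfunction T m \<xi> e}"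
      then obtain \<eta> where \<eta>: "\<eta> \<in> spectrum" "e = eigenf \<eta>" "eigenfunction T m \<xi> e" unfolding basis_def by blast
      from M.eigenfunction_unique[OF \<eta>(3)] eigenf_eigenfunction[OF \<eta>(1)] \<eta>(2) have "\<xi> = \<eta>" by blast
      with \<eta>(2) show "e \<in> {eigenf \<xi>}" by simp
    next
      fix e assume "e \<in> {eigenf \<xi>}"
      then show "e \<in> {e \<in> basis. eigenfunction T m \<xi> e}"
        using \<xi> eigenf_eigenfunction[OF \<xi>] by (simp add: basis_def)
    qed
    show "orthonormal_basis_L2 m {e \<in> basis. eigenfunction T m \<xi> e} (eigenspace T m \<xi>)"
      unfolding eq orthonormal_basis_L2_def
      using eigenf(4)[OF \<xi>] eigenf_orthonormal[OF \<xi> \<xi>] eigenspace_span[OF \<xi>] by simp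
  qed
  show "\<forall>f e \<xi>. continuous_map (top_of_set C) euclidean f \<and> e \<in> basis \<and> eigenfunction T m \<xi> e \<longrightarrow>
      (\<lambda>n. (LINT t:A n|haar. f (T t x0) * cnj (\<xi> t)) / of_real (measure haar (A n))) \<longlonglongrightarrow> inner_L2 m f e"
  proof (intro allI impI, elim conjE)
    fix f :: "'x \<Rightarrow> complex" and e \<xi>
    assume "continuous_map (top_of_set C) euclidean f" and e: "e \<in> basis" "eigenfunction T m \<xi> e"
    then have f: "continuous_on C f" by (simp add: continuous_map_iff_continuous)
    obtain \<eta> where \<eta>: "\<eta> \<in> spectrum" "e = eigenf \<eta>" using e(1) unfolding basis_def by blast
    from M.eigenfunction_unique[OF e(2)] eigenf_eigenfunction[OF \<eta>(1)] \<eta>(2) have "\<xi> = \<eta>" by blast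
    then have "(\<lambda>n. inner_L2 (avg n) (orb f) \<xi>) \<longlonglongrightarrow> inner_L2 m f e"
      using coef_LIMSEQ[OF f spectrum_dual[OF \<eta>(1)]] eigenf(3)[OF \<eta>(1) f] \<eta>(2) by simp
    moreover have "\<xi> \<in> Cb" using e(2) by (intro dual_Cb) (simp add: eigenfunction_def)
    ultimately show "(\<lambda>n. (LINT t:A n|haar. f (T t x0) * cnj (\<xi> t)) / of_real (measure haar (A n))) \<longlonglongrightarrow> inner_L2 m f e"
      using inner_avg_eq[OF f] by simp
  qed
qed

end

theorem (in orbit_system) all_orbits_BAP_iff:
  "(\<forall>f. continuous_on C f \<longrightarrow> orb f \<in> BAP) \<longleftrightarrow>
    (\<exists>m. ergodic (top_of_set C) T m \<and> pure_point_spectrum T m \<and>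
      wiener_wintner_point haar A (top_of_set C) T m x0)"
proof
  assume *: "\<forall>f. continuous_on C f \<longrightarrow> orb f \<in> BAP"
  interpret mean_orbit_system haar A C T x0 by unfold_locales (use * in blast)
  show "\<exists>m. ergodic (top_of_set C) T m \<and> pure_point_spectrum T m \<and>
      wiener_wintner_point haar A (top_of_set C) T m x0"
    using ergodic_m pure_point_m Wiener_Wintner_m by blast
next
  assume "\<exists>m. ergodic (top_of_set C) T m \<and> pure_point_spectrum T m \<and>
      wiener_wintner_point haar A (top_of_set C) T m x0"
  then show "\<forall>f. continuous_on C f \<longrightarrow> orb f \<in> BAP" using Wiener_Wintner_imp_BAP by blast
qed

section \<open>The hull of a translation bounded measure\<close>

text \<open>
  A copy of a function type with its product topology. Function types with an uncountable domain are
  Hausdorff spaces but not instances of the class of Hausdorff types; the copy is one, so that the Stone--Weierstrass theorem for that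
  class applies to it.
\<close>

typedef ('i, 'b) point_space = "UNIV :: ('i \<Rightarrow> 'b) set" ..

instantiation point_space :: (type, t2_space) t2_space
begin

definition open_point_space :: "('a, 'b) point_space set \<Rightarrow> bool" where
  "open_point_space U \<longleftrightarrow> open (Abs_point_space -` U)"

instance
proof
  show "open (UNIV :: ('a, 'b) point_space set)" by (simp add: open_point_space_def)
  fix U V :: "('a, 'b) point_space set" assume "open U" "open V"
  then show "open (U \<inter> V)" by (simp add: open_point_space_def vimage_Int open_Int)
next
  fix K :: "('a, 'b) point_space set set" assume "\<forall>U\<in>K. open U"
  then show "open (\<Union>K)" by (simp add: open_point_space_def vimage_Union open_UN)
next
  fix x y :: "('a, 'b) point_space" assume "x \<noteq> y"
  then have "Rep_point_space x \<noteq> Rep_point_space y" by (simp add: Rep_point_space_inject)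
  then obtain i where i: "Rep_point_space x i \<noteq> Rep_point_space y i" by blast
  obtain U V where UV: "open U" "open V" "Rep_point_space x i \<in> U" "Rep_point_space y i \<in> V" "U \<inter> V = {}"
    using hausdorff[OF i] by blast
  let ?P = "\<lambda>U. {z. Rep_point_space z i \<in> U}"
  have op: "open (?P U)" if "open U" for U
  proof -
    have "Abs_point_space -` ?P U = (\<lambda>f. f i) -` U" by (auto simp: Abs_point_space_inverse)
    then show ?thesis
      unfolding open_point_space_def using open_vimage[OF that continuous_on_product_coordinates] by simp
  qed
  show "\<exists>U V. open U \<and> open V \<and> x \<in> U \<and> y \<in> V \<and> U \<inter> V = {}"
    using UV op[OF UV(1)] op[OF UV(2)] by (intro exI[of _ "?P U"] exI[of _ "?P V"]) auto
qed

end

lemma continuous_Abs_point_space: "continuous_on X Abs_point_space"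
  by (rule continuous_on_subset[OF _ subset_UNIV])
    (simp add: continuous_on_open_vimage open_point_space_def)

lemma continuous_Rep_point_space: "continuous_on X Rep_point_space"
proof (rule continuous_on_subset[OF _ subset_UNIV])
  have "Abs_point_space -` (Rep_point_space -` U) = U" for U :: "('a \<Rightarrow> 'b) set"
    by (auto simp: Abs_point_space_inverse)
  then show "continuous_on UNIV (Rep_point_space :: ('a, 'b) point_space \<Rightarrow> _)"
    by (simp add: continuous_on_open_vimage open_point_space_def)
qed

text \<open>
  The homeomorphism with the copy of the function type carries the subalgebra over.
\<close>

lemma Stone_Weierstrass_functions:
  fixes C :: "('i \<Rightarrow> 'b::t2_space) set" and R :: "(('i \<Rightarrow> 'b) \<Rightarrow> real) set"
  assumes C: "compact C"
    and cont: "\<And>f. f \<in> R \<Longrightarrow> continuous_on C f"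
    and add: "\<And>f g. f \<in> R \<Longrightarrow> g \<in> R \<Longrightarrow> (\<lambda>x. f x + g x) \<in> R"
    and mult: "\<And>f g. f \<in> R \<Longrightarrow> g \<in> R \<Longrightarrow> (\<lambda>x. f x * g x) \<in> R"
    and const: "\<And>c. (\<lambda>x. c) \<in> R"
    and sep: "\<And>x y. x \<in> C \<Longrightarrow> y \<in> C \<Longrightarrow> x \<noteq> y \<Longrightarrow> \<exists>f\<in>R. f x \<noteq> f y"
    and f: "continuous_on C f" and \<epsilon>: "0 < \<epsilon>"
  shows "\<exists>g\<in>R. \<forall>x\<in>C. \<bar>f x - g x\<bar> < \<epsilon>"
proof -
  let ?C = "Abs_point_space ` C"
  let ?R = "{g. (\<lambda>x. g (Abs_point_space x)) \<in> R}"
  have Rep: "Rep_point_space ` ?C \<subseteq> C" by (auto simp: Abs_point_space_inverse)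
  interpret F: function_ring_on ?R ?C
  proof
    show "compact ?C" by (rule compact_continuous_image[OF continuous_Abs_point_space C])
    show "continuous_on ?C g" if "g \<in> ?R" for g
    proof -
      have "(\<lambda>x. g (Abs_point_space x)) \<in> R" using that by simp
      from continuous_on_compose2[OF cont[OF this] continuous_Rep_point_space Rep]
      show ?thesis by (simp add: Rep_point_space_inverse)
    qed
    fix x y :: "('i, 'b) point_space" assume xy: "x \<in> ?C" "y \<in> ?C" "x \<noteq> y"
    then have "Rep_point_space x \<in> C" "Rep_point_space y \<in> C" "Rep_point_space x \<noteq> Rep_point_space y"
      using Rep by (auto simp: Rep_point_space_inject Abs_point_space_inverse)
    from sep[OF this] obtain g where "g \<in> R" "g (Rep_point_space x) \<noteq> g (Rep_point_space y)" by blast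
    then show "\<exists>g\<in>?R. g x \<noteq> g y"
      by (intro bexI[of _ "\<lambda>z. g (Rep_point_space z)"]) (simp_all add: Abs_point_space_inverse)
  qed (simp_all add: add mult const)
  have "continuous_on ?C (\<lambda>z. f (Rep_point_space z))"
    by (rule continuous_on_compose2[OF f continuous_Rep_point_space Rep])
  from F.Stone_Weierstrass_basic[OF this \<epsilon>] obtain g where
    g: "g \<in> ?R" "\<forall>z\<in>?C. \<bar>f (Rep_point_space z) - g z\<bar> < \<epsilon>" by blast
  then show ?thesis
    by (intro bexI[of _ "\<lambda>x. g (Abs_point_space x)"]) (simp_all add: Abs_point_space_inverse)
qed

locale hull_system = van_Hove_sequence haar A
  for haar :: "'g::{topological_ab_group_add, t2_space} measure" and A :: "nat \<Rightarrow> 'g set" +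
  fixes \<mu> :: "('g \<Rightarrow> complex) \<Rightarrow> complex"
  assumes locally_compact: "locally_compact_space (euclidean :: 'g topology)"
    and translation_bounded: "\<mu> \<in> translation_bounded_measures"
begin

lemma radon: "\<mu> \<in> radon_measures"
  using translation_bounded by (simp add: translation_bounded_measures_def)

sublocale orbit_system haar A "orbit_closure \<mu>" "\<lambda>t. translate (- t)" \<mu>
proof
  show "compact (orbit_closure \<mu>)" by (rule compact_orbit_closure[OF translation_bounded])
  show "Hausdorff_space (top_of_set (orbit_closure \<mu>))" by (rule Hausdorff_space_fun)
  show "continuous_on (orbit_closure \<mu>) (translate (- t))" for t
    by (rule continuous_on_subset[OF continuous_translate subset_UNIV])
  show "translate (- t) ` orbit_closure \<mu> \<subseteq> orbit_closure \<mu>" for t by (rule translate_orbit_closure)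
  show "translate (- (s + t)) x = translate (- s) (translate (- t) x)" for s t :: 'g and x
    by (simp only: translate_translate minus_add_distrib)
  have ext: "\<nu> \<in> radon_measures \<Longrightarrow> \<nu> \<in> extensional Cc" for \<nu> :: "('g \<Rightarrow> complex) \<Rightarrow> complex"
    unfolding radon_measures_def by blast
  show "translate (- 0) x = x" if "x \<in> orbit_closure \<mu>" for x
    using translate_0[OF ext] orbit_closure_radon[OF translation_bounded] that by auto
  have "translate 0 \<mu> \<in> orbit_closure \<mu>" unfolding orbit_closure_def by (rule subsetD[OF closure_subset]) blast
  then show "\<mu> \<in> orbit_closure \<mu>" using translate_0[OF ext[OF radon]] by simp
  show "continuous_on UNIV (\<lambda>t. translate (- t) \<mu>)"
    by (rule continuous_on_compose2[OF continuous_orbit[OF locally_compact radon]])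
      (auto intro!: continuous_intros)
qed

lemma evaluation_continuous: "continuous_on (orbit_closure \<mu>) (\<lambda>\<nu>. \<nu> \<phi>)"
  by (rule continuous_on_subset[OF continuous_on_product_coordinates subset_UNIV])

text \<open>
  The functional \<open>translate (- t) \<mu>\<close> at \<open>\<phi>\<close> pairs \<open>\<mu>\<close> with \<open>\<lambda>s. \<phi> (s - t)\<close>, which is a convolution at \<open>t\<close> after
  reflecting \<open>\<phi>\<close>.
\<close>

lemma orb_evaluation:
  assumes "\<phi> \<in> Cc"
  shows "orb (\<lambda>\<nu>. \<nu> \<phi>) = mconv \<mu> (\<lambda>s. \<phi> (- s))"
  by (rule ext) (simp add: orb_def translate_apply[OF assms] mconv_def add.commute)

text \<open>
  Stone--Weierstrass for the real continuous functions with almost periodic orbit function. Real and imaginary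
  parts of evaluations separate points: a functional in the hull is determined by its values on \<open>Cc\<close>.
\<close>

lemma orbits_BAP:
  assumes ev: "\<And>\<phi>. \<phi> \<in> Cc \<Longrightarrow> orb (\<lambda>\<nu>. \<nu> \<phi>) \<in> BAP"
    and f: "continuous_on (orbit_closure \<mu>) f"
  shows "orb f \<in> BAP"
proof -
  let ?C = "orbit_closure \<mu>"
  define R where "R = {g :: (('g \<Rightarrow> complex) \<Rightarrow> complex) \<Rightarrow> real.
    continuous_on ?C g \<and> orb (\<lambda>\<nu>. complex_of_real (g \<nu>)) \<in> BAP}"
  have ReR: "(\<lambda>\<nu>. Re (\<nu> \<phi>)) \<in> R" and ImR: "(\<lambda>\<nu>. Im (\<nu> \<phi>)) \<in> R" if \<phi>: "\<phi> \<in> Cc" for \<phi>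
  proof -
    let ?h = "orb (\<lambda>\<nu>. \<nu> \<phi>)"
    have h: "?h \<in> BAP" by (rule ev[OF \<phi>])
    have "(\<lambda>t. (1 / 2) * (?h t + cnj (?h t))) \<in> BAP" by (intro BAP_scale BAP_add BAP_cnj h)
    moreover have "(1 / 2) * (?h t + cnj (?h t)) = orb (\<lambda>\<nu>. complex_of_real (Re (\<nu> \<phi>))) t" for t
      by (simp add: orb_def complex_add_cnj)
    ultimately have re: "orb (\<lambda>\<nu>. complex_of_real (Re (\<nu> \<phi>))) \<in> BAP" by simp
    have "(\<lambda>t. (- \<i> / 2) * (?h t + (- 1) * cnj (?h t))) \<in> BAP" by (intro BAP_scale BAP_add BAP_cnj h)
    moreover have "(- \<i> / 2) * (?h t + (- 1) * cnj (?h t)) = orb (\<lambda>\<nu>. complex_of_real (Im (\<nu> \<phi>))) t" for t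
      by (simp add: orb_def complex_eq_iff)
    ultimately have im: "orb (\<lambda>\<nu>. complex_of_real (Im (\<nu> \<phi>))) \<in> BAP" by simp
    show "(\<lambda>\<nu>. Re (\<nu> \<phi>)) \<in> R" "(\<lambda>\<nu>. Im (\<nu> \<phi>)) \<in> R"
      using re im continuous_on_Re[OF evaluation_continuous, of \<phi>] continuous_on_Im[OF evaluation_continuous, of \<phi>]
      by (simp_all add: R_def)
  qed
  have real: "orb (\<lambda>\<nu>. complex_of_real (k \<nu>)) \<in> BAP" if k: "continuous_on ?C k" for k
  proof (rule BAP_limit)
    have kc: "continuous_on ?C (\<lambda>\<nu>. complex_of_real (k \<nu>))" using k by (intro continuous_intros)
    then show kB: "orb (\<lambda>\<nu>. complex_of_real (k \<nu>)) \<in> Cb" by (rule orb_Cb)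
    fix \<epsilon> :: real assume \<epsilon>: "0 < \<epsilon>"
    have "\<exists>g\<in>R. \<forall>\<nu>\<in>?C. \<bar>k \<nu> - g \<nu>\<bar> < \<epsilon>"
    proof (rule Stone_Weierstrass_functions[OF compact_C _ _ _ _ _ k \<epsilon>])
      show "continuous_on ?C g" if "g \<in> R" for g using that by (simp add: R_def)
      show "(\<lambda>\<nu>. g \<nu> + h \<nu>) \<in> R" if "g \<in> R" "h \<in> R" for g h
        using BAP_add[of "orb (\<lambda>\<nu>. complex_of_real (g \<nu>))" "orb (\<lambda>\<nu>. complex_of_real (h \<nu>))"] that
        by (simp add: R_def continuous_on_add orb_def[abs_def])
      show "(\<lambda>\<nu>. g \<nu> * h \<nu>) \<in> R" if "g \<in> R" "h \<in> R" for g h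
        using BAP_mult[of "orb (\<lambda>\<nu>. complex_of_real (g \<nu>))" "orb (\<lambda>\<nu>. complex_of_real (h \<nu>))"] that
        by (simp add: R_def continuous_on_mult orb_def[abs_def])
      show "(\<lambda>\<nu>. c) \<in> R" for c using BAP_const[of "complex_of_real c"] by (simp add: R_def orb_def[abs_def])
      fix \<nu> \<nu>' assume n: "\<nu> \<in> ?C" "\<nu>' \<in> ?C" "\<nu> \<noteq> \<nu>'"
      obtain \<phi> where \<phi>: "\<nu> \<phi> \<noteq> \<nu>' \<phi>" using n(3) by blast
      have e: "\<nu> \<in> extensional Cc" "\<nu>' \<in> extensional Cc"
        using n(1,2) orbit_closure_radon[OF translation_bounded] unfolding radon_measures_def by blast+
      have "\<phi> \<in> Cc" using \<phi>
      proof (rule contrapos_np)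
        assume "\<phi> \<notin> Cc"
        then have "\<nu> \<phi> = undefined" "\<nu>' \<phi> = undefined"
          by (rule extensional_arb[OF e(1)], rule extensional_arb[OF e(2)])
        then show "\<nu> \<phi> = \<nu>' \<phi>" by simp
      qed
      show "\<exists>g\<in>R. g \<nu> \<noteq> g \<nu>'"
      proof (cases "Re (\<nu> \<phi>) = Re (\<nu>' \<phi>)")
        case True
        then have "Im (\<nu> \<phi>) \<noteq> Im (\<nu>' \<phi>)" using \<phi> by (simp add: complex_eq_iff)
        then show ?thesis by (rule bexI[OF _ ImR[OF \<open>\<phi> \<in> Cc\<close>]])
      next
        case False
        then show ?thesis by (rule bexI[OF _ ReR[OF \<open>\<phi> \<in> Cc\<close>]])
      qed
    qed
    then obtain g where g: "g \<in> R" "\<And>\<nu>. \<nu> \<in> ?C \<Longrightarrow> \<bar>k \<nu> - g \<nu>\<bar> < \<epsilon>" by blast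
    have gB: "orb (\<lambda>\<nu>. complex_of_real (g \<nu>)) \<in> BAP" using g(1) by (simp add: R_def)
    have "besicovitch_le (\<lambda>t. orb (\<lambda>\<nu>. complex_of_real (k \<nu>)) t - orb (\<lambda>\<nu>. complex_of_real (g \<nu>)) t) \<epsilon>"
    proof (rule besicovitch_le_sup)
      fix t
      have "orb (\<lambda>\<nu>. complex_of_real (k \<nu>)) t - orb (\<lambda>\<nu>. complex_of_real (g \<nu>)) t
          = complex_of_real (k (translate (- t) \<mu>) - g (translate (- t) \<mu>))" by (simp add: orb_def)
      then show "cmod (orb (\<lambda>\<nu>. complex_of_real (k \<nu>)) t - orb (\<lambda>\<nu>. complex_of_real (g \<nu>)) t) \<le> \<epsilon>"
        using g(2)[OF orbit_in[of t]] by (simp only: norm_of_real less_imp_le)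
    qed (intro Cb_diff kB BAP_Cb gB)
    with gB show "\<exists>h\<in>BAP. besicovitch_le (\<lambda>t. orb (\<lambda>\<nu>. complex_of_real (k \<nu>)) t - h t) \<epsilon>" by blast
  qed
  have "(\<lambda>t. orb (\<lambda>\<nu>. complex_of_real (Re (f \<nu>))) t + \<i> * orb (\<lambda>\<nu>. complex_of_real (Im (f \<nu>))) t) \<in> BAP"
    using f by (intro BAP_add BAP_scale real continuous_on_Re continuous_on_Im)
  moreover have "orb (\<lambda>\<nu>. complex_of_real (Re (f \<nu>))) t + \<i> * orb (\<lambda>\<nu>. complex_of_real (Im (f \<nu>))) t = orb f t" for t
    by (simp add: orb_def complex_eq_iff)
  ultimately show ?thesis by simp
qed

lemma Besicovitch_iff_orbits_BAP:
  "besicovitch_almost_periodic haar A \<mu> \<longleftrightarrow> (\<forall>f. continuous_on (orbit_closure \<mu>) f \<longrightarrow> orb f \<in> BAP)"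
proof
  assume b: "besicovitch_almost_periodic haar A \<mu>"
  have "orb (\<lambda>\<nu>. \<nu> \<phi>) \<in> BAP" if \<phi>: "\<phi> \<in> Cc" for \<phi>
  proof -
    have "orb (\<lambda>\<nu>. \<nu> \<phi>) \<in> Bap2 haar A"
      unfolding orb_evaluation[OF \<phi>] using b Cc_reflect[OF \<phi>] unfolding besicovitch_almost_periodic_def by blast
    then show ?thesis using BAP_iff_Bap2[OF orb_Cb[OF evaluation_continuous]] by blast
  qed
  then show "\<forall>f. continuous_on (orbit_closure \<mu>) f \<longrightarrow> orb f \<in> BAP" using orbits_BAP by blast
next
  assume o: "\<forall>f. continuous_on (orbit_closure \<mu>) f \<longrightarrow> orb f \<in> BAP"
  show "besicovitch_almost_periodic haar A \<mu>"
    unfolding besicovitch_almost_periodic_def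
  proof
    fix \<phi> :: "'g \<Rightarrow> complex" assume \<phi>: "\<phi> \<in> Cc"
    let ?\<psi> = "\<lambda>s. \<phi> (- s)"
    have "orb (\<lambda>\<nu>. \<nu> ?\<psi>) \<in> BAP" using o evaluation_continuous by blast
    then have "orb (\<lambda>\<nu>. \<nu> ?\<psi>) \<in> Bap2 haar A"
      using BAP_iff_Bap2[OF orb_Cb[OF evaluation_continuous]] by blast
    then show "mconv \<mu> \<phi> \<in> Bap2 haar A" unfolding orb_evaluation[OF Cc_reflect[OF \<phi>]] by simp
  qed
qed

end

theorem corollary7p1:
  fixes haar :: "'g::{topological_ab_group_add, t2_space} measure"
    and A :: "nat \<Rightarrow> 'g set"
    and \<mu> :: "('g \<Rightarrow> complex) \<Rightarrow> complex"
  assumes "locally_compact_space (euclidean :: 'g topology)"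
    and "sigma_compact (UNIV :: 'g set)"
    and "haar_measure haar"
    and "van_Hove haar A"
    and "\<mu> \<in> translation_bounded_measures"
  shows "besicovitch_almost_periodic haar A \<mu> \<longleftrightarrow>
    (\<exists>m. ergodic (measure_hull \<mu>) (\<lambda>t. translate (- t)) m \<and>
         pure_point_spectrum (\<lambda>t. translate (- t)) m \<and>
         wiener_wintner_point haar A (measure_hull \<mu>) (\<lambda>t. translate (- t)) m \<mu>)"
proof -
  interpret hull_system haar A \<mu> by unfold_locales (rule assms)+
  show ?thesis
    unfolding measure_hull_eq[OF assms(5)] Besicovitch_iff_orbits_BAP by (rule all_orbits_BAP_iff)
qed

end
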